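(* For every $\mathbf{p}\in\Bbbk^{\mathtt{I}}$ let $L(\mathbf{p})$ be the simple top of $P(\mathbf{p})=A/A\mathfrak{m}_{\mathbf{p}}$, and let $\sim$ be the equivalence relation on $\Bbbk^{\mathtt{I}}$ given by $\mathbf{p}\sim\mathbf{m}$ if and only if $\overline{\mathbf{p}}=\overline{\mathbf{m}}$. The map $\overline{\mathbf{p}}\mapsto L(\mathbf{p})$, $\mathbf{p}\in\Bbbk^{\mathtt{I}}$, is a (well-defined) bijection between $\Bbbk^{\mathtt{I}}/\sim$ and the set of isomorphism classes of simple weight $A$-modules.
   Context: Let $\Bbbk$ be an algebraically closed field of characteristic zero and $\mathtt{I}$ an infinite set with $|\mathtt{I}|<|\Bbbk|$. Let $B$ be the polynomial $\Bbbk$-algebra in the variables $x_i$, $i\in\mathtt{I}$. The infinite Weyl algebra $A$ is the subalgebra of $\mathrm{End}_{\Bbbk}(B)$ generated by all $X_i$ (multiplication by $x_i$) and all $Y_i$ (partial derivative $\partial_i$ with respect to $x_i$), $i\in\mathtt{I}$. Put $t_i:=X_iY_i$ and let $A_0\subset A$ be the (commutative) subalgebra generated by all $t_i$, $i\in\mathtt{I}$. Let $\Bbbk^{\mathtt{I}}$ be the additive group of all vectors $\mathbf{v}=(v_i)_{i\in\mathtt{I}}$ with coefficients in $\Bbbk$, and $\mathbb{Z}_f^{\mathtt{I}}\subset\Bbbk^{\mathtt{I}}$ the subgroup of integral vectors with at most finitely many nonzero coefficients. For $\mathbf{p}\in\Bbbk^{\mathtt{I}}$ let $\mathfrak{m}_{\mathbf{p}}$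 be the maximal ideal of $A_0$ generated by $t_i-p_i$, $i\in\mathtt{I}$. Modules are left modules. An $A$-module $M$ is a weight module if $M=\bigoplus_{\mathbf{p}\in\Bbbk^{\mathtt{I}}}M_{\mathbf{p}}$, where $M_{\mathbf{p}}=\{x\in M: t_i\cdot x=p_i x\ \forall i\in\mathtt{I}\}$. For $\mathbf{p}\in\Bbbk^{\mathtt{I}}$ put $P(\mathbf{p}):=A\otimes_{A_0}(A_0/\mathfrak{m}_{\mathbf{p}})\cong A/A\mathfrak{m}_{\mathbf{p}}$; this is a weight module having a unique maximal submodule, and $L(\mathbf{p})$ denotes its unique simple quotient (its top). For $\mathbf{p}\in\Bbbk^{\mathtt{I}}$, $\overline{\mathbf{p}}$ denotes the set of all $\mathbf{k}\in\mathbf{p}+\mathbb{Z}_f^{\mathtt{I}}$ such that for all $i\in\mathtt{I}$: $p_i\in\{-1,-2,-3,\dots\}$ implies $k_i\in\{-1,-2,-3,\dots\}$, and $p_i\in\{0,1,2,\dots\}$ implies $k_i\in\{0,1,2,\dots\}$. *)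

theory Defs
  imports
    "HOL-Algebra.Generated_Rings"
    "HOL-Algebra.Ideal"
    "HOL-Algebra.Module"
    "HOL-Library.Poly_Mapping"
    "HOL-Library.Equipollence"
    "HOL-Computational_Algebra.Polynomial"
begin

section \<open>Left modules over a not necessarily commutative ring\<close>

text \<open>
  The locale \<open>module\<close> of HOL-Algebra requires a commutative ring of scalars. The axioms below are
  the same ones over an arbitrary ring, on the same record type; the fields \<open>mult\<close> and \<open>one\<close> of a
  module record carry no meaning. The locale \<open>submodule\<close> of HOL-Algebra does not assume
  commutativity and is used as it is.
\<close>

locale left_module = R?: ring R + M?: abelian_group M
  for R :: "('a, 'r) ring_scheme" (structure) and M :: "('a, 'm, 's) module_scheme" (structure) +
  assumes smult_closed [simp, intro]:
      "\<lbrakk> a \<in> carrier R; x \<in> carrier M \<rbrakk> \<Longrightarrow> a \<odot>\<^bsub>M\<^esub> x \<in> carrier M"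
    and smult_l_distr:
      "\<lbrakk> a \<in> carrier R; b \<in> carrier R; x \<in> carrier M \<rbrakk> \<Longrightarrow>
        (a \<oplus>\<^bsub>R\<^esub> b) \<odot>\<^bsub>M\<^esub> x = a \<odot>\<^bsub>M\<^esub> x \<oplus>\<^bsub>M\<^esub> b \<odot>\<^bsub>M\<^esub> x"
    and smult_r_distr:
      "\<lbrakk> a \<in> carrier R; x \<in> carrier M; y \<in> carrier M \<rbrakk> \<Longrightarrow>
        a \<odot>\<^bsub>M\<^esub> (x \<oplus>\<^bsub>M\<^esub> y) = a \<odot>\<^bsub>M\<^esub> x \<oplus>\<^bsub>M\<^esub> a \<odot>\<^bsub>M\<^esub> y"
    and smult_assoc1:
      "\<lbrakk> a \<in> carrier R; b \<in> carrier R; x \<in> carrier M \<rbrakk> \<Longrightarrow>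
        (a \<otimes>\<^bsub>R\<^esub> b) \<odot>\<^bsub>M\<^esub> x = a \<odot>\<^bsub>M\<^esub> (b \<odot>\<^bsub>M\<^esub> x)"
    and smult_one [simp]:
      "x \<in> carrier M \<Longrightarrow> \<one>\<^bsub>R\<^esub> \<odot>\<^bsub>M\<^esub> x = x"

definition simple_module :: "('a, 'r) ring_scheme \<Rightarrow> ('a, 'm) module \<Rightarrow> bool" where
  "simple_module R M \<longleftrightarrow> left_module R M \<and> carrier M \<noteq> {\<zero>\<^bsub>M\<^esub>} \<and>
     (\<forall>N. submodule N R M \<longrightarrow> N = {\<zero>\<^bsub>M\<^esub>} \<or> N = carrier M)"

definition maximal_submodule :: "'m set \<Rightarrow> ('a, 'r) ring_scheme \<Rightarrow> ('a, 'm) module \<Rightarrow> bool" where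
  "maximal_submodule N R M \<longleftrightarrow> submodule N R M \<and> N \<noteq> carrier M \<and>
     (\<forall>N'. submodule N' R M \<and> N \<subseteq> N' \<longrightarrow> N' = N \<or> N' = carrier M)"

definition generated_submodule :: "('a, 'r) ring_scheme \<Rightarrow> ('a, 'm) module \<Rightarrow> 'm set \<Rightarrow> 'm set" where
  "generated_submodule R M S = \<Inter>{N. submodule N R M \<and> S \<subseteq> N}"

definition regular_module :: "('a, 'r) ring_scheme \<Rightarrow> ('a, 'a) module" where
  "regular_module R =
     \<lparr>carrier = carrier R, monoid.mult = undefined, one = undefined,
      zero = \<zero>\<^bsub>R\<^esub>, add = (\<oplus>\<^bsub>R\<^esub>), module.smult = (\<otimes>\<^bsub>R\<^esub>)\<rparr>"

text \<open>For \<open>N\<close> a submodule, the union in \<open>smult\<close> is the single coset \<open>a x + N\<close> of any \<open>x \<in> X\<close>.\<close>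

definition quotient_module :: "('a, 'm) module \<Rightarrow> 'm set \<Rightarrow> ('a, 'm set) module" where
  "quotient_module M N =
     \<lparr>carrier = a_rcosets\<^bsub>M\<^esub> N, monoid.mult = undefined, one = undefined,
      zero = N, add = (<+>\<^bsub>M\<^esub>), module.smult = (\<lambda>a X. \<Union>x\<in>X. N +>\<^bsub>M\<^esub> (a \<odot>\<^bsub>M\<^esub> x))\<rparr>"

definition module_isomorphic ::
    "('a, 'r) ring_scheme \<Rightarrow> ('a, 'm) module \<Rightarrow> ('a, 'n) module \<Rightarrow> bool" where
  "module_isomorphic R M N \<longleftrightarrow>
     (\<exists>f. bij_betw f (carrier M) (carrier N) \<and>
       (\<forall>x\<in>carrier M. \<forall>y\<in>carrier M. f (x \<oplus>\<^bsub>M\<^esub> y) = f x \<oplus>\<^bsub>N\<^esub> f y) \<and>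
       (\<forall>a\<in>carrier R. \<forall>x\<in>carrier M. f (a \<odot>\<^bsub>M\<^esub> x) = a \<odot>\<^bsub>N\<^esub> f x))"

text \<open>The isomorphism class of \<open>M\<close>, among the modules with elements in the same type as \<open>M\<close>.\<close>

definition iso_class :: "('a, 'r) ring_scheme \<Rightarrow> ('a, 'm) module \<Rightarrow> ('a, 'm) module set" where
  "iso_class R M = {N. left_module R N \<and> module_isomorphic R M N}"


section \<open>The infinite Weyl algebra\<close>

text \<open>
  The polynomial algebra \<open>B\<close> in variables indexed by \<open>'i\<close>: finitely supported functions from
  monomials, which are finitely supported exponent vectors, to \<open>'k\<close>.
\<close>

type_synonym ('i, 'k) pol = "('i \<Rightarrow>\<^sub>0 nat) \<Rightarrow>\<^sub>0 'k"
type_synonym ('i, 'k) pol_op = "('i, 'k) pol \<Rightarrow> ('i, 'k) pol"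

definition scal_op :: "'k::field \<Rightarrow> ('i, 'k) pol_op" where
  "scal_op c = (\<lambda>b. Poly_Mapping.single 0 c * b)"

definition X_op :: "'i \<Rightarrow> ('i, 'k::field) pol_op" where
  "X_op i = (\<lambda>b. Poly_Mapping.single (Poly_Mapping.single i 1) 1 * b)"

text \<open>
  The partial derivative: \<open>c x\<^sup>m\<close> is sent to \<open>m\<^sub>i c x\<^sup>m / x\<^sub>i\<close>. If \<open>m\<^sub>i = 0\<close>, the subtraction on
  exponents truncates, but the coefficient vanishes.
\<close>

definition Y_op :: "'i \<Rightarrow> ('i, 'k::field) pol_op" where
  "Y_op i = (\<lambda>b. \<Sum>m\<in>Poly_Mapping.keys b.
     Poly_Mapping.single (m - Poly_Mapping.single i 1)
       (of_nat (Poly_Mapping.lookup m i) * Poly_Mapping.lookup b m))"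

definition t_op :: "'i \<Rightarrow> ('i, 'k::field) pol_op" where
  "t_op i = X_op i \<circ> Y_op i"

definition End_pol :: "('i, 'k::field) pol_op ring" where
  "End_pol =
     \<lparr>carrier = {f. (\<forall>b b'. f (b + b') = f b + f b') \<and> (\<forall>c b. f (scal_op c b) = scal_op c (f b))},
      monoid.mult = (\<circ>), one = id, zero = (\<lambda>_. 0), add = (\<lambda>f g b. f b + g b)\<rparr>"

text \<open>The subalgebra generated by \<open>S\<close> is the subring generated by \<open>S\<close> and the scalars.\<close>

definition subalgebra_of :: "('i, 'k::field) pol_op set \<Rightarrow> ('i, 'k) pol_op ring" where
  "subalgebra_of S = End_pol\<lparr>carrier := generate_ring End_pol (S \<union> range scal_op)\<rparr>"

definition weyl :: "('i, 'k::field) pol_op ring" where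
  "weyl = subalgebra_of (range X_op \<union> range Y_op)"

definition weyl0 :: "('i, 'k::field) pol_op ring" where
  "weyl0 = subalgebra_of (range t_op)"


section \<open>Weight modules\<close>

definition weight_space :: "(('i, 'k::field) pol_op, 'm) module \<Rightarrow> ('i \<Rightarrow> 'k) \<Rightarrow> 'm set" where
  "weight_space M p = {x \<in> carrier M. \<forall>i. t_op i \<odot>\<^bsub>M\<^esub> x = scal_op (p i) \<odot>\<^bsub>M\<^esub> x}"

text \<open>
  \<open>M\<close> is the direct sum of its weight spaces: every element is in exactly one way the sum of a
  finitely supported family of elements of the weight spaces.
\<close>

definition weight_module :: "(('i, 'k::field) pol_op, 'm) module \<Rightarrow> bool" where
  "weight_module M \<longleftrightarrow> left_module weyl M \<and>
     (\<forall>x\<in>carrier M. \<exists>!f. (\<forall>p. f p \<in> weight_space M p) \<and> finite {p. f p \<noteq> \<zero>\<^bsub>M\<^esub>} \<and>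
        x = (\<Oplus>\<^bsub>M\<^esub>p\<in>{p. f p \<noteq> \<zero>\<^bsub>M\<^esub>}. f p))"

definition simple_weight_module :: "(('i, 'k::field) pol_op, 'm) module \<Rightarrow> bool" where
  "simple_weight_module M \<longleftrightarrow> simple_module weyl M \<and> weight_module M"

definition m_ideal :: "('i \<Rightarrow> 'k::field) \<Rightarrow> ('i, 'k) pol_op set" where
  "m_ideal p = genideal weyl0 (range (\<lambda>i. t_op i \<ominus>\<^bsub>weyl0\<^esub> scal_op (p i)))"

text \<open>\<open>P(p) = A / A m\<^sub>p\<close>, where \<open>A m\<^sub>p\<close> is the left ideal of \<open>A\<close> generated by \<open>m\<^sub>p\<close>.\<close>

definition P_module :: "('i \<Rightarrow> 'k::field) \<Rightarrow> (('i, 'k) pol_op, ('i, 'k) pol_op set) module" where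
  "P_module p = quotient_module (regular_module weyl)
     (generated_submodule weyl (regular_module weyl) (m_ideal p))"

definition L_module :: "('i \<Rightarrow> 'k::field) \<Rightarrow> (('i, 'k) pol_op, ('i, 'k) pol_op set set) module" where
  "L_module p = quotient_module (P_module p) (THE N. maximal_submodule N weyl (P_module p))"


section \<open>The equivalence relation on weights\<close>

definition Z_fin :: "('i \<Rightarrow> 'k::field) set" where
  "Z_fin = {v. (\<forall>i. v i \<in> \<int>) \<and> finite {i. v i \<noteq> 0}}"

definition neg_integers :: "'k::field set" where
  "neg_integers = {- of_nat n |n. n \<ge> 1}"

definition weight_bar :: "('i \<Rightarrow> 'k::field) \<Rightarrow> ('i \<Rightarrow> 'k) set" where
  "weight_bar p = {k. (\<exists>z\<in>Z_fin. k = (\<lambda>i. p i + z i)) \<and>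
     (\<forall>i. (p i \<in> neg_integers \<longrightarrow> k i \<in> neg_integers) \<and> (p i \<in> \<nat> \<longrightarrow> k i \<in> \<nat>))}"

definition weight_sim :: "(('i \<Rightarrow> 'k::field) \<times> ('i \<Rightarrow> 'k)) set" where
  "weight_sim = {(p, m). weight_bar p = weight_bar m}"

lemma equiv_weight_sim: "equiv UNIV weight_sim"
  by (auto simp: weight_sim_def equiv_def refl_on_def sym_def trans_def)

lemma Ints_neg_or_Nats:
  fixes x :: "'k::field"
  assumes "x \<in> \<int>"
  shows "x \<in> neg_integers \<or> x \<in> \<nat>"
proof -
  obtain z where z: "x = of_int z" using assms by (auto elim: Ints_cases)
  show ?thesis
  proof (cases "z \<ge> 0")
    case True
    then have "x = of_nat (nat z)" by (simp add: z)
    then show ?thesis by simp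
  next
    case False
    then have "x = - of_nat (nat (- z))" "nat (- z) \<ge> 1" by (simp_all add: z)
    then show ?thesis unfolding neg_integers_def by blast
  qed
qed

lemma neg_integers_not_Nats:
  fixes x :: "'k::field_char_0"
  assumes "x \<in> neg_integers"
  shows "x \<notin> \<nat>"
proof
  assume "x \<in> \<nat>"
  then obtain m where m: "x = of_nat m" by (auto elim: Nats_cases)
  obtain n where n: "x = - of_nat n" "n \<ge> 1" using assms by (auto simp: neg_integers_def)
  have "of_nat (m + n) = (of_nat m + of_nat n :: 'k)" by simp
  also have "\<dots> = 0" using m n by (metis add.left_inverse)
  finally have "of_nat (m + n) = (0 :: 'k)" .
  then show False using n(2) by (simp only: of_nat_eq_0_iff)
qed

text \<open>The set \<open>weight_bar p\<close> is the equivalence class of \<open>p\<close>.\<close>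

lemma weight_sim_class:
  fixes p :: "'i \<Rightarrow> 'k::field_char_0"
  shows "weight_sim `` {p} = weight_bar p"
proof -
  have refl: "q \<in> weight_bar q" for q :: "'i \<Rightarrow> 'k"
    by (auto simp: weight_bar_def Z_fin_def intro!: bexI[of _ "\<lambda>_. 0"])
  have neg_Ints: "x \<in> \<int>" if "x \<in> neg_integers" for x :: 'k
    using that by (auto simp: neg_integers_def)
  have Nats_Ints: "x \<in> \<int>" if "x \<in> \<nat>" for x :: 'k
    using that Nats_subset_Ints by blast
  have sym: "q \<in> weight_bar k" if k: "k \<in> weight_bar q" for k q :: "'i \<Rightarrow> 'k"
  proof -
    obtain z where z: "z \<in> Z_fin" "k = (\<lambda>i. q i + z i)"
      using k by (auto simp: weight_bar_def)
    have "(\<lambda>i. - z i) \<in> Z_fin" "q = (\<lambda>i. k i + - z i)"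
      using z by (auto simp: Z_fin_def)
    moreover have "(k i \<in> neg_integers \<longrightarrow> q i \<in> neg_integers) \<and> (k i \<in> \<nat> \<longrightarrow> q i \<in> \<nat>)" for i
    proof -
      have "z i \<in> \<int>" using z(1) by (simp add: Z_fin_def)
      then have "q i \<in> \<int>" if "k i \<in> \<int>"
        using that Ints_diff[of "k i" "z i"] by (simp add: z(2))
      then have "q i \<in> neg_integers \<or> q i \<in> \<nat>" if "k i \<in> neg_integers \<or> k i \<in> \<nat>"
        using that neg_Ints Nats_Ints Ints_neg_or_Nats by blast
      moreover have "q i \<in> neg_integers \<Longrightarrow> k i \<in> neg_integers" "q i \<in> \<nat> \<Longrightarrow> k i \<in> \<nat>"
        using k by (auto simp: weight_bar_def)
      ultimately show ?thesis using neg_integers_not_Nats by blast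
    qed
    ultimately show ?thesis
      unfolding weight_bar_def mem_Collect_eq
      by (intro conjI bexI[of _ "\<lambda>i. - z i"] allI) blast+
  qed
  have trans: "l \<in> weight_bar q" if k: "k \<in> weight_bar q" and l: "l \<in> weight_bar k"
    for k l q :: "'i \<Rightarrow> 'k"
  proof -
    obtain z where z: "z \<in> Z_fin" "k = (\<lambda>i. q i + z i)"
      using k by (auto simp: weight_bar_def)
    obtain w where w: "w \<in> Z_fin" "l = (\<lambda>i. k i + w i)"
      using l by (auto simp: weight_bar_def)
    have "finite {i. z i + w i \<noteq> 0}"
      by (rule finite_subset[of _ "{i. z i \<noteq> 0} \<union> {i. w i \<noteq> 0}"])
        (use z w in \<open>auto simp: Z_fin_def\<close>)
    then have "(\<lambda>i. z i + w i) \<in> Z_fin" "l = (\<lambda>i. q i + (z i + w i))"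
      using z w by (auto simp: Z_fin_def add.assoc)
    moreover have "\<forall>i. (q i \<in> neg_integers \<longrightarrow> l i \<in> neg_integers) \<and> (q i \<in> \<nat> \<longrightarrow> l i \<in> \<nat>)"
      using k l by (simp add: weight_bar_def)
    ultimately show ?thesis
      unfolding weight_bar_def mem_Collect_eq
      by (intro conjI bexI[of _ "\<lambda>i. z i + w i"]) blast+
  qed
  show ?thesis
    unfolding weight_sim_def using refl sym trans by blast
qed

end

theory Submission
  imports Defs
begin

text \<open>
  Let \<open>J\<close> be the left ideal of \<open>A\<close> generated by the maximal ideal \<open>m\<^sub>p\<close>. The algebra \<open>A\<close> is graded by
  finitely supported integral vectors, and an operator of degree \<open>z\<close> sends \<open>x\<^sup>m\<close> to \<open>f(m) x\<^sup>m\<^sup>+\<^sup>z\<close> for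
  a unique polynomial function \<open>f\<close>, its symbol. Evaluating the symbol of the degree zero part at
  \<open>p\<close> is a linear form on \<open>A\<close> that kills \<open>J\<close>; the largest left ideal \<open>I\<close> in its kernel is proper. A
  left ideal containing \<open>J\<close> contains the homogeneous components of its elements, as these have
  distinct weights modulo \<open>J\<close>, and in degree zero \<open>a - f(p)\<close> lies in \<open>J\<close>; hence every proper left ideal
  containing \<open>J\<close> is contained in \<open>I\<close>. So \<open>L(p)\<close> is \<open>A / I\<close>, and every simple module with a nonzero vector
  of weight \<open>p\<close> is isomorphic to it.

  It remains to see which weights occur in \<open>L(p)\<close>. If \<open>p\<^sub>i \<noteq> -1\<close>, then \<open>Y\<^sub>i X\<^sub>i\<close> acts on the generator by
  \<open>p\<^sub>i + 1 \<noteq> 0\<close>, so \<open>p\<close> may be moved up by one in coordinate \<open>i\<close>; likewise down if \<open>p\<^sub>i \<noteq> 0\<close>.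
  Conversely, if homogeneous operators with symbols \<open>f\<close> and \<open>g\<close> move the generator to weight \<open>q\<close> and
  back, then \<open>g(q) f(p) \<noteq> 0\<close>, while the symbol of an operator preserving polynomials vanishes
  wherever a coordinate would leave the natural numbers.
\<close>

section \<open>Cyclic modules\<close>

context left_module
begin

lemma smult_r_null [simp]: "a \<in> carrier R \<Longrightarrow> a \<odot>\<^bsub>M\<^esub> \<zero>\<^bsub>M\<^esub> = \<zero>\<^bsub>M\<^esub>"
  using smult_r_distr[of a "\<zero>\<^bsub>M\<^esub>" "\<zero>\<^bsub>M\<^esub>"] by (simp add: M.add.r_cancel_one')

lemma smult_l_null [simp]: "x \<in> carrier M \<Longrightarrow> \<zero>\<^bsub>R\<^esub> \<odot>\<^bsub>M\<^esub> x = \<zero>\<^bsub>M\<^esub>"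
  using smult_l_distr[of "\<zero>\<^bsub>R\<^esub>" "\<zero>\<^bsub>R\<^esub>" x] by (simp add: M.add.r_cancel_one')

lemma smult_r_minus: "a \<in> carrier R \<Longrightarrow> x \<in> carrier M \<Longrightarrow> a \<odot>\<^bsub>M\<^esub> (\<ominus>\<^bsub>M\<^esub> x) = \<ominus>\<^bsub>M\<^esub> (a \<odot>\<^bsub>M\<^esub> x)"
  using smult_r_distr[of a "\<ominus>\<^bsub>M\<^esub> x" x] by (simp add: M.l_neg M.minus_equality)

lemma smult_l_minus: "a \<in> carrier R \<Longrightarrow> x \<in> carrier M \<Longrightarrow> (\<ominus>\<^bsub>R\<^esub> a) \<odot>\<^bsub>M\<^esub> x = \<ominus>\<^bsub>M\<^esub> (a \<odot>\<^bsub>M\<^esub> x)"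
  using smult_l_distr[of "\<ominus>\<^bsub>R\<^esub> a" a x] by (simp add: R.l_neg M.minus_equality)

lemma smult_l_diff:
  "a \<in> carrier R \<Longrightarrow> b \<in> carrier R \<Longrightarrow> x \<in> carrier M \<Longrightarrow>
    (a \<ominus>\<^bsub>R\<^esub> b) \<odot>\<^bsub>M\<^esub> x = a \<odot>\<^bsub>M\<^esub> x \<ominus>\<^bsub>M\<^esub> b \<odot>\<^bsub>M\<^esub> x"
  by (simp add: a_minus_def smult_l_distr smult_l_minus)

lemma smult_finsum:
  assumes "finite S" "a \<in> carrier R" "x \<in> S \<rightarrow> carrier M"
  shows "a \<odot>\<^bsub>M\<^esub> (\<Oplus>\<^bsub>M\<^esub>s\<in>S. x s) = (\<Oplus>\<^bsub>M\<^esub>s\<in>S. a \<odot>\<^bsub>M\<^esub> x s)"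
  using assms(1,3)
proof (induction S)
  case empty
  then show ?case using assms(2) by simp
next
  case (insert s S)
  then have "x \<in> S \<rightarrow> carrier M" "x s \<in> carrier M" by auto
  moreover from this have "(\<lambda>s. a \<odot>\<^bsub>M\<^esub> x s) \<in> S \<rightarrow> carrier M" using assms(2) by auto
  ultimately show ?case
    using insert assms(2) by (simp add: smult_r_distr M.finsum_closed)
qed

lemma finsum_smult:
  assumes "finite S" "x \<in> carrier M" "a \<in> S \<rightarrow> carrier R"
  shows "(\<Oplus>\<^bsub>R\<^esub>s\<in>S. a s) \<odot>\<^bsub>M\<^esub> x = (\<Oplus>\<^bsub>M\<^esub>s\<in>S. a s \<odot>\<^bsub>M\<^esub> x)"
  using assms(1,3)
proof (induction S)
  case empty
  then show ?case using assms(2) by simp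
next
  case (insert s S)
  then have "a \<in> S \<rightarrow> carrier R" "a s \<in> carrier R" by auto
  moreover from this have "(\<lambda>s. a s \<odot>\<^bsub>M\<^esub> x) \<in> S \<rightarrow> carrier M" using assms(2) by auto
  ultimately show ?case
    using insert assms(2) by (simp add: smult_l_distr R.finsum_closed)
qed

text \<open>Additive inverses come for free, being multiples by the negative of 1.\<close>

lemma submoduleI:
  assumes "H \<subseteq> carrier M" "\<zero>\<^bsub>M\<^esub> \<in> H"
    and add: "\<And>x y. \<lbrakk> x \<in> H; y \<in> H \<rbrakk> \<Longrightarrow> x \<oplus>\<^bsub>M\<^esub> y \<in> H"
    and smult: "\<And>a x. \<lbrakk> a \<in> carrier R; x \<in> H \<rbrakk> \<Longrightarrow> a \<odot>\<^bsub>M\<^esub> x \<in> H"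
  shows "submodule H R M"
proof -
  have "\<ominus>\<^bsub>M\<^esub> x \<in> H" if "x \<in> H" for x
    using smult[of "\<ominus>\<^bsub>R\<^esub> \<one>\<^bsub>R\<^esub>" x] that assms(1) smult_l_minus[of "\<one>\<^bsub>R\<^esub>" x] by auto
  then show ?thesis
    using assms by (intro submodule.intro subgroup.intro submodule_axioms.intro) (auto simp: a_inv_def)
qed

lemma submoduleE:
  assumes "submodule H R M"
  shows "H \<subseteq> carrier M" "\<zero>\<^bsub>M\<^esub> \<in> H"
    and "\<And>x y. \<lbrakk> x \<in> H; y \<in> H \<rbrakk> \<Longrightarrow> x \<oplus>\<^bsub>M\<^esub> y \<in> H"
    and "\<And>a x. \<lbrakk> a \<in> carrier R; x \<in> H \<rbrakk> \<Longrightarrow> a \<odot>\<^bsub>M\<^esub> x \<in> H"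
    and "\<And>x. x \<in> H \<Longrightarrow> \<ominus>\<^bsub>M\<^esub> x \<in> H"
    and "\<And>x y. \<lbrakk> x \<in> H; y \<in> H \<rbrakk> \<Longrightarrow> x \<ominus>\<^bsub>M\<^esub> y \<in> H"
proof -
  interpret H: submodule H R M by fact
  show sub: "H \<subseteq> carrier M" using H.subset by simp
  show "\<zero>\<^bsub>M\<^esub> \<in> H" using H.one_closed by simp
  show add: "x \<oplus>\<^bsub>M\<^esub> y \<in> H" if "x \<in> H" "y \<in> H" for x y
    using H.m_closed that by simp
  show "a \<odot>\<^bsub>M\<^esub> x \<in> H" if "a \<in> carrier R" "x \<in> H" for a x
    using H.smult_closed that by simp
  show minus: "\<ominus>\<^bsub>M\<^esub> x \<in> H" if "x \<in> H" for x
    using H.m_inv_closed[OF that] by (simp add: a_inv_def)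
  show "x \<ominus>\<^bsub>M\<^esub> y \<in> H" if "x \<in> H" "y \<in> H" for x y
    unfolding a_minus_def using add minus that by blast
qed

lemma submodule_finsum:
  assumes "submodule N R M" "finite S" "\<And>s. s \<in> S \<Longrightarrow> x s \<in> N"
  shows "(\<Oplus>\<^bsub>M\<^esub>s\<in>S. x s) \<in> N"
  using assms(2,3)
proof (induction S)
  case empty
  then show ?case using submoduleE(2)[OF assms(1)] by simp
next
  case (insert s S)
  have "x s \<in> N" "\<And>s. s \<in> S \<Longrightarrow> x s \<in> N" using insert.prems by auto
  moreover from this have "x \<in> S \<rightarrow> carrier M" "x s \<in> carrier M"
    using submoduleE(1)[OF assms(1)] by auto
  ultimately show ?case
    using insert submoduleE(3)[OF assms(1)] by simp
qed

lemma zero_submodule: "submodule {\<zero>\<^bsub>M\<^esub>} R M"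
  by (rule submoduleI) auto

lemma carrier_submodule: "submodule (carrier M) R M"
  by (rule submoduleI) auto

lemma submodule_cancel:
  assumes "submodule N R M" "x \<in> N" "y \<in> carrier M" "x \<oplus>\<^bsub>M\<^esub> y \<in> N"
  shows "y \<in> N"
proof -
  have "\<ominus>\<^bsub>M\<^esub> x \<oplus>\<^bsub>M\<^esub> (x \<oplus>\<^bsub>M\<^esub> y) \<in> N"
    by (intro submoduleE(3)[OF assms(1)] submoduleE(5)[OF assms(1)] assms)
  moreover have "x \<in> carrier M" using assms(1,2) submoduleE(1) by blast
  ultimately show ?thesis using assms(3) by (simp add: M.r_neg1)
qed

end

section \<open>The regular module and quotient modules\<close>

lemma left_module_regular:
  assumes "ring R"
  shows "left_module R (regular_module R)"
proof -
  interpret ring R by fact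
  have "abelian_group (regular_module R)"
  proof (rule abelian_groupI)
    show "\<exists>y\<in>carrier (regular_module R).
        y \<oplus>\<^bsub>regular_module R\<^esub> x = \<zero>\<^bsub>regular_module R\<^esub>"
      if "x \<in> carrier (regular_module R)" for x
      using that by (intro bexI[of _ "a_inv R x"]) (simp_all add: regular_module_def l_neg)
  qed (simp_all add: regular_module_def a_ac)
  then show ?thesis
    by (intro left_module.intro left_module_axioms.intro assms)
      (auto simp: regular_module_def l_distr r_distr m_assoc)
qed

text \<open>Both operations of the quotient are defined on sets; computing on representatives here
  spares the later proofs the unfolding of that record.\<close>

lemma quotient_module_simps:
  assumes "left_module R M" "submodule N R M"
  shows "carrier (quotient_module M N) = (\<lambda>x. N +>\<^bsub>M\<^esub> x) ` carrier M"
    and "\<zero>\<^bsub>quotient_module M N\<^esub> = N"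
    and "\<lbrakk> x \<in> carrier M; y \<in> carrier M \<rbrakk> \<Longrightarrow>
      (N +>\<^bsub>M\<^esub> x) \<oplus>\<^bsub>quotient_module M N\<^esub> (N +>\<^bsub>M\<^esub> y) = N +>\<^bsub>M\<^esub> (x \<oplus>\<^bsub>M\<^esub> y)"
    and "\<lbrakk> a \<in> carrier R; x \<in> carrier M \<rbrakk> \<Longrightarrow>
      a \<odot>\<^bsub>quotient_module M N\<^esub> (N +>\<^bsub>M\<^esub> x) = N +>\<^bsub>M\<^esub> (a \<odot>\<^bsub>M\<^esub> x)"
    and "x \<in> carrier M \<Longrightarrow> N +>\<^bsub>M\<^esub> x = N \<longleftrightarrow> x \<in> N"
proof -
  interpret left_module R M by fact
  note E = submoduleE[OF assms(2)]
  interpret N: abelian_subgroup N M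
    using submodule.axioms(1)[OF assms(2)]
    by (intro abelian_subgroupI3 additive_subgroup.intro M.abelian_group_axioms)
  show "carrier (quotient_module M N) = (\<lambda>x. N +>\<^bsub>M\<^esub> x) ` carrier M"
    by (auto simp: quotient_module_def A_RCOSETS_def')
  show "\<zero>\<^bsub>quotient_module M N\<^esub> = N" by (simp add: quotient_module_def)
  show "(N +>\<^bsub>M\<^esub> x) \<oplus>\<^bsub>quotient_module M N\<^esub> (N +>\<^bsub>M\<^esub> y) = N +>\<^bsub>M\<^esub> (x \<oplus>\<^bsub>M\<^esub> y)"
    if "x \<in> carrier M" "y \<in> carrier M"
    using that by (simp add: quotient_module_def N.a_rcos_sum)
  show "a \<odot>\<^bsub>quotient_module M N\<^esub> (N +>\<^bsub>M\<^esub> x) = N +>\<^bsub>M\<^esub> (a \<odot>\<^bsub>M\<^esub> x)"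
    if a: "a \<in> carrier R" and x: "x \<in> carrier M"
  proof -
    \<comment> \<open>Two representatives of a coset differ by some \<open>n\<close> in
      \<open>N\<close>, and \<open>a n\<close> stays in \<open>N\<close>; so all members of the
      union in the scalar action are the same coset.\<close>
    have "N +>\<^bsub>M\<^esub> (a \<odot>\<^bsub>M\<^esub> y) = N +>\<^bsub>M\<^esub> (a \<odot>\<^bsub>M\<^esub> x)" if y: "y \<in> N +>\<^bsub>M\<^esub> x" for y
    proof -
      obtain n where n: "n \<in> N" "y = n \<oplus>\<^bsub>M\<^esub> x" using y by (auto simp: a_r_coset_def')
      then have "a \<odot>\<^bsub>M\<^esub> y = a \<odot>\<^bsub>M\<^esub> n \<oplus>\<^bsub>M\<^esub> a \<odot>\<^bsub>M\<^esub> x" using a x E(1) by (auto simp: smult_r_distr)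
      then have "a \<odot>\<^bsub>M\<^esub> y \<in> N +>\<^bsub>M\<^esub> (a \<odot>\<^bsub>M\<^esub> x)"
        using E(4)[OF a n(1)] by (auto simp: a_r_coset_def')
      then show ?thesis using a x by (metis N.a_subgroup M.a_repr_independence smult_closed)
    qed
    moreover have "x \<in> N +>\<^bsub>M\<^esub> x" using x E(2) by (force simp: a_r_coset_def')
    ultimately have "(\<lambda>y. N +>\<^bsub>M\<^esub> (a \<odot>\<^bsub>M\<^esub> y)) ` (N +>\<^bsub>M\<^esub> x) = {N +>\<^bsub>M\<^esub> (a \<odot>\<^bsub>M\<^esub> x)}"
      unfolding image_def by blast
    then show ?thesis by (simp add: quotient_module_def)
  qed
  show "N +>\<^bsub>M\<^esub> x = N \<longleftrightarrow> x \<in> N" if "x \<in> carrier M"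
    using that by (metis N.a_subgroup M.a_coset_join1 M.a_coset_join2)
qed

lemma left_module_quotient:
  assumes "left_module R M" "submodule N R M"
  shows "left_module R (quotient_module M N)"
proof -
  interpret left_module R M by fact
  note S = quotient_module_simps[OF assms]
  have "abelian_group (quotient_module M N)"
  proof (rule abelian_groupI)
    show "\<zero>\<^bsub>quotient_module M N\<^esub> \<in> carrier (quotient_module M N)"
      using S(1,2) S(5)[of "\<zero>\<^bsub>M\<^esub>"] submoduleE(2)[OF assms(2)] M.zero_closed
      by (metis imageI)
    fix X assume "X \<in> carrier (quotient_module M N)"
    then obtain x where x: "x \<in> carrier M" "X = N +>\<^bsub>M\<^esub> x" using S(1) by auto
    have Z: "\<zero>\<^bsub>quotient_module M N\<^esub> = N +>\<^bsub>M\<^esub> \<zero>\<^bsub>M\<^esub>"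
      using S(2) S(5)[of "\<zero>\<^bsub>M\<^esub>"] submoduleE(2)[OF assms(2)] by simp
    show "\<zero>\<^bsub>quotient_module M N\<^esub> \<oplus>\<^bsub>quotient_module M N\<^esub> X = X"
      unfolding Z x(2) using x(1) S(3) by simp
    show "\<exists>Y\<in>carrier (quotient_module M N). Y \<oplus>\<^bsub>quotient_module M N\<^esub> X = \<zero>\<^bsub>quotient_module M N\<^esub>"
      unfolding Z x(2) using x(1) S(1) S(3)[of "\<ominus>\<^bsub>M\<^esub> x" x] by (force simp: M.l_neg)
  qed (auto simp: S(1,3) M.a_ac)
  then show ?thesis
    by (intro left_module.intro left_module_axioms.intro R.ring_axioms)
      (auto simp: S(1,3,4) smult_l_distr smult_r_distr smult_assoc1)
qed

text \<open>\<open>presents R M v I\<close>: the vector \<open>v\<close> identifies \<open>M\<close> with \<open>R / I\<close>.\<close>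

definition presents :: "('a, 'r) ring_scheme \<Rightarrow> ('a, 'm) module \<Rightarrow> 'm \<Rightarrow> 'a set \<Rightarrow> bool" where
  "presents R M v I \<longleftrightarrow> left_module R M \<and> v \<in> carrier M \<and>
     (\<forall>x\<in>carrier M. \<exists>a\<in>carrier R. x = a \<odot>\<^bsub>M\<^esub> v) \<and> I = {a \<in> carrier R. a \<odot>\<^bsub>M\<^esub> v = \<zero>\<^bsub>M\<^esub>}"

lemma presents_regular:
  assumes "ring R"
  shows "presents R (regular_module R) \<one>\<^bsub>R\<^esub> {\<zero>\<^bsub>R\<^esub>}"
proof -
  interpret ring R by fact
  show ?thesis
    unfolding presents_def using left_module_regular[OF assms]
    by (auto simp: regular_module_def)
qed

text \<open>Applied twice below, to pass from the algebra to \<open>P_module p\<close> and from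
  there to \<open>L_module p\<close>.\<close>

lemma presents_quotient:
  assumes "presents R M v I" "submodule N R M"
  shows "presents R (quotient_module M N) (N +>\<^bsub>M\<^esub> v) {a \<in> carrier R. a \<odot>\<^bsub>M\<^esub> v \<in> N}"
proof -
  have M: "left_module R M" and v: "v \<in> carrier M"
    and gen: "\<And>x. x \<in> carrier M \<Longrightarrow> \<exists>a\<in>carrier R. x = a \<odot>\<^bsub>M\<^esub> v"
    using assms(1) by (auto simp: presents_def)
  interpret left_module R M by fact
  note S = quotient_module_simps[OF M assms(2)]
  show ?thesis
    unfolding presents_def
  proof (intro conjI ballI)
    show "left_module R (quotient_module M N)" by (rule left_module_quotient[OF M assms(2)])
    show "N +>\<^bsub>M\<^esub> v \<in> carrier (quotient_module M N)" using v by (simp add: S(1))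
    show "\<exists>a\<in>carrier R. X = a \<odot>\<^bsub>quotient_module M N\<^esub> (N +>\<^bsub>M\<^esub> v)"
      if X: "X \<in> carrier (quotient_module M N)" for X
    proof -
      obtain x where x: "x \<in> carrier M" "X = N +>\<^bsub>M\<^esub> x" using X S(1) by auto
      obtain a where "a \<in> carrier R" "x = a \<odot>\<^bsub>M\<^esub> v" using gen x(1) by blast
      then show ?thesis using x v S(4) by auto
    qed
    have "a \<odot>\<^bsub>quotient_module M N\<^esub> (N +>\<^bsub>M\<^esub> v) = \<zero>\<^bsub>quotient_module M N\<^esub> \<longleftrightarrow> a \<odot>\<^bsub>M\<^esub> v \<in> N"
      if "a \<in> carrier R" for a
      using S(2) S(4)[OF that v] S(5)[OF smult_closed[OF that v]] by simp
    then show "{a \<in> carrier R. a \<odot>\<^bsub>M\<^esub> v \<in> N} =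
        {a \<in> carrier R. a \<odot>\<^bsub>quotient_module M N\<^esub> (N +>\<^bsub>M\<^esub> v) = \<zero>\<^bsub>quotient_module M N\<^esub>}"
      by blast
  qed
qed

lemma presents_diff:
  assumes "presents R M v I" "a \<in> carrier R" "b \<in> carrier R"
  shows "a \<odot>\<^bsub>M\<^esub> v = b \<odot>\<^bsub>M\<^esub> v \<longleftrightarrow> a \<ominus>\<^bsub>R\<^esub> b \<in> I"
proof -
  interpret left_module R M using assms(1) by (simp add: presents_def)
  have "v \<in> carrier M" "I = {a \<in> carrier R. a \<odot>\<^bsub>M\<^esub> v = \<zero>\<^bsub>M\<^esub>}"
    using assms(1) by (auto simp: presents_def)
  moreover have "x = y \<longleftrightarrow> x \<ominus>\<^bsub>M\<^esub> y = \<zero>\<^bsub>M\<^esub>" if "x \<in> carrier M" "y \<in> carrier M" for x y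
    using that by (metis M.add.inv_closed M.minus_eq M.minus_equality M.minus_minus M.r_neg)
  ultimately show ?thesis using assms(2,3) by (simp add: smult_l_diff)
qed

text \<open>Both modules are \<open>R / I\<close>: sending \<open>a v\<close> to \<open>a w\<close>
  is well defined and injective, since two scalars agree on either generator exactly when their
  difference lies in \<open>I\<close>.\<close>

lemma presents_isomorphic:
  assumes "presents R M v I" "presents R N w I"
  shows "module_isomorphic R M N"
proof -
  interpret M: left_module R M using assms(1) by (simp add: presents_def)
  interpret N: left_module R N using assms(2) by (simp add: presents_def)
  have v: "v \<in> carrier M" and genv: "\<And>x. x \<in> carrier M \<Longrightarrow> \<exists>a\<in>carrier R. x = a \<odot>\<^bsub>M\<^esub> v"
    using assms(1) by (auto simp: presents_def)
  have w: "w \<in> carrier N" and genw: "\<And>x. x \<in> carrier N \<Longrightarrow> \<exists>a\<in>carrier R. x = a \<odot>\<^bsub>N\<^esub> w"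
    using assms(2) by (auto simp: presents_def)
  \<comment> \<open>Any coefficient of \<open>x\<close> will do: by \<open>eq\<close> below,
    \<open>f x\<close> does not depend on the choice.\<close>
  define g where "g = (\<lambda>x. SOME a. a \<in> carrier R \<and> x = a \<odot>\<^bsub>M\<^esub> v)"
  define f where "f = (\<lambda>x. g x \<odot>\<^bsub>N\<^esub> w)"
  have g: "g x \<in> carrier R \<and> x = g x \<odot>\<^bsub>M\<^esub> v" if "x \<in> carrier M" for x
    unfolding g_def by (rule someI_ex) (use genv[OF that] in blast)
  have eq: "a \<odot>\<^bsub>M\<^esub> v = b \<odot>\<^bsub>M\<^esub> v \<longleftrightarrow> a \<odot>\<^bsub>N\<^esub> w = b \<odot>\<^bsub>N\<^esub> w" if "a \<in> carrier R" "b \<in> carrier R" for a b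
    using presents_diff[OF assms(1) that] presents_diff[OF assms(2) that] by simp
  have f: "f (a \<odot>\<^bsub>M\<^esub> v) = a \<odot>\<^bsub>N\<^esub> w" if "a \<in> carrier R" for a
    unfolding f_def using g[of "a \<odot>\<^bsub>M\<^esub> v"] eq[of a "g (a \<odot>\<^bsub>M\<^esub> v)"] that v by simp
  have "bij_betw f (carrier M) (carrier N)"
    unfolding bij_betw_def
  proof
    show "inj_on f (carrier M)"
      by (rule inj_onI) (metis g eq f_def)
    show "f ` carrier M = carrier N"
    proof (intro equalityI subsetI)
      fix y assume "y \<in> carrier N"
      then obtain a where a: "a \<in> carrier R" "y = a \<odot>\<^bsub>N\<^esub> w" using genw by blast
      then show "y \<in> f ` carrier M" using f v by (metis M.smult_closed imageI)
    qed (use g w in \<open>auto simp: f_def\<close>)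
  qed
  moreover have "f (x \<oplus>\<^bsub>M\<^esub> y) = f x \<oplus>\<^bsub>N\<^esub> f y" if xy: "x \<in> carrier M" "y \<in> carrier M" for x y
  proof -
    obtain a b where ab: "a \<in> carrier R" "x = a \<odot>\<^bsub>M\<^esub> v" "b \<in> carrier R" "y = b \<odot>\<^bsub>M\<^esub> v"
      using genv[OF xy(1)] genv[OF xy(2)] by auto
    then have "x \<oplus>\<^bsub>M\<^esub> y = (a \<oplus>\<^bsub>R\<^esub> b) \<odot>\<^bsub>M\<^esub> v" using v by (simp add: M.smult_l_distr)
    then show ?thesis using ab w by (simp add: f N.smult_l_distr)
  qed
  moreover have "f (c \<odot>\<^bsub>M\<^esub> x) = c \<odot>\<^bsub>N\<^esub> f x" if c: "c \<in> carrier R" and x: "x \<in> carrier M" for c x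
  proof -
    obtain a where a: "a \<in> carrier R" "x = a \<odot>\<^bsub>M\<^esub> v" using genv[OF x] by auto
    then have "c \<odot>\<^bsub>M\<^esub> x = (c \<otimes>\<^bsub>R\<^esub> a) \<odot>\<^bsub>M\<^esub> v" using v c by (simp add: M.smult_assoc1)
    then show ?thesis using a w c by (simp add: f N.smult_assoc1)
  qed
  ultimately show ?thesis unfolding module_isomorphic_def by blast
qed

text \<open>An isomorphism carries the generator to a generator with the same annihilator; this
  moves weight vectors from one \<open>L_module\<close> to another.\<close>

lemma presents_transport:
  assumes "presents R M v I" "module_isomorphic R M N" "left_module R N"
  obtains w where "presents R N w I"
proof -
  interpret M: left_module R M using assms(1) by (simp add: presents_def)
  interpret N: left_module R N by fact
  obtain f where f: "bij_betw f (carrier M) (carrier N)"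
    and add: "\<And>x y. x \<in> carrier M \<Longrightarrow> y \<in> carrier M \<Longrightarrow> f (x \<oplus>\<^bsub>M\<^esub> y) = f x \<oplus>\<^bsub>N\<^esub> f y"
    and sm: "\<And>a x. a \<in> carrier R \<Longrightarrow> x \<in> carrier M \<Longrightarrow> f (a \<odot>\<^bsub>M\<^esub> x) = a \<odot>\<^bsub>N\<^esub> f x"
    using assms(2) by (auto simp: module_isomorphic_def)
  have v: "v \<in> carrier M" using assms(1) by (simp add: presents_def)
  have fM: "f x \<in> carrier N" if "x \<in> carrier M" for x using f that by (auto simp: bij_betw_def)
  have f0: "f \<zero>\<^bsub>M\<^esub> = \<zero>\<^bsub>N\<^esub>"
    using sm[of "\<zero>\<^bsub>R\<^esub>" "\<zero>\<^bsub>M\<^esub>"] fM[OF M.zero_closed] by simp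
  have "presents R N (f v) I"
    unfolding presents_def
  proof (intro conjI ballI)
    show "\<exists>a\<in>carrier R. y = a \<odot>\<^bsub>N\<^esub> f v" if y: "y \<in> carrier N" for y
    proof -
      obtain x where x: "x \<in> carrier M" "y = f x" using f y by (auto simp: bij_betw_def)
      then show ?thesis using assms(1) sm v unfolding presents_def by metis
    qed
    have "a \<odot>\<^bsub>N\<^esub> f v = \<zero>\<^bsub>N\<^esub> \<longleftrightarrow> a \<odot>\<^bsub>M\<^esub> v = \<zero>\<^bsub>M\<^esub>" if "a \<in> carrier R" for a
      using sm[OF that v] f0 f that v by (metis M.smult_closed M.zero_closed bij_betw_def inj_onD)
    then show "I = {a \<in> carrier R. a \<odot>\<^bsub>N\<^esub> f v = \<zero>\<^bsub>N\<^esub>}"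
      using assms(1) by (auto simp: presents_def)
  qed (use fM v assms(3) in auto)
  then show thesis by (rule that)
qed

section \<open>Isomorphism of modules as an equivalence relation\<close>

lemma module_isomorphic_refl: "module_isomorphic R M M"
  unfolding module_isomorphic_def by (intro exI[of _ id]) auto

lemma module_isomorphic_sym:
  assumes "left_module R M" "module_isomorphic R M N"
  shows "module_isomorphic R N M"
proof -
  interpret M: left_module R M by fact
  obtain f where f: "bij_betw f (carrier M) (carrier N)"
    and add: "\<And>x y. x \<in> carrier M \<Longrightarrow> y \<in> carrier M \<Longrightarrow> f (x \<oplus>\<^bsub>M\<^esub> y) = f x \<oplus>\<^bsub>N\<^esub> f y"
    and sm: "\<And>a x. a \<in> carrier R \<Longrightarrow> x \<in> carrier M \<Longrightarrow> f (a \<odot>\<^bsub>M\<^esub> x) = a \<odot>\<^bsub>N\<^esub> f x"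
    using assms(2) by (auto simp: module_isomorphic_def)
  define g where "g = the_inv_into (carrier M) f"
  have g: "bij_betw g (carrier N) (carrier M)" unfolding g_def by (rule bij_betw_the_inv_into[OF f])
  have gf: "g (f x) = x" if "x \<in> carrier M" for x
    unfolding g_def using f that by (simp add: bij_betw_def the_inv_into_f_f)
  have ex: "\<exists>x\<in>carrier M. y = f x" if "y \<in> carrier N" for y using f that by (auto simp: bij_betw_def)
  have "g (x \<oplus>\<^bsub>N\<^esub> y) = g x \<oplus>\<^bsub>M\<^esub> g y" if "x \<in> carrier N" "y \<in> carrier N" for x y
    using ex[OF that(1)] ex[OF that(2)] gf by (auto simp flip: add)
  moreover have "g (a \<odot>\<^bsub>N\<^esub> x) = a \<odot>\<^bsub>M\<^esub> g x" if "a \<in> carrier R" "x \<in> carrier N" for a x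
    using ex[OF that(2)] gf that(1) by (auto simp flip: sm)
  ultimately show ?thesis unfolding module_isomorphic_def using g by blast
qed

lemma module_isomorphic_trans:
  assumes "module_isomorphic R M N" "module_isomorphic R N K"
  shows "module_isomorphic R M K"
proof -
  obtain f where f: "bij_betw f (carrier M) (carrier N)"
    "\<And>x y. x \<in> carrier M \<Longrightarrow> y \<in> carrier M \<Longrightarrow> f (x \<oplus>\<^bsub>M\<^esub> y) = f x \<oplus>\<^bsub>N\<^esub> f y"
    "\<And>a x. a \<in> carrier R \<Longrightarrow> x \<in> carrier M \<Longrightarrow> f (a \<odot>\<^bsub>M\<^esub> x) = a \<odot>\<^bsub>N\<^esub> f x"
    using assms(1) by (auto simp: module_isomorphic_def)
  obtain g where g: "bij_betw g (carrier N) (carrier K)"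
    "\<And>x y. x \<in> carrier N \<Longrightarrow> y \<in> carrier N \<Longrightarrow> g (x \<oplus>\<^bsub>N\<^esub> y) = g x \<oplus>\<^bsub>K\<^esub> g y"
    "\<And>a x. a \<in> carrier R \<Longrightarrow> x \<in> carrier N \<Longrightarrow> g (a \<odot>\<^bsub>N\<^esub> x) = a \<odot>\<^bsub>K\<^esub> g x"
    using assms(2) by (auto simp: module_isomorphic_def)
  have "f x \<in> carrier N" if "x \<in> carrier M" for x using f(1) that by (auto simp: bij_betw_def)
  then show ?thesis
    unfolding module_isomorphic_def
    by (intro exI[of _ "g \<circ> f"]) (simp add: bij_betw_trans[OF f(1) g(1)] f(2,3) g(2,3))
qed

lemma iso_class_eq:
  assumes "left_module R M" "left_module R N"
  shows "iso_class R M = iso_class R N \<longleftrightarrow> module_isomorphic R M N"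
proof
  assume "iso_class R M = iso_class R N"
  moreover have "N \<in> iso_class R N" using assms(2) by (simp add: iso_class_def module_isomorphic_refl)
  ultimately show "module_isomorphic R M N" by (auto simp: iso_class_def)
next
  assume "module_isomorphic R M N"
  then show "iso_class R M = iso_class R N"
    unfolding iso_class_def
    using module_isomorphic_trans module_isomorphic_sym[OF assms(1)] by blast
qed

section \<open>Largest proper left ideals, tops and simple modules\<close>

text \<open>A left ideal is proper precisely when it misses 1. Asking for a largest such ideal, not
  only a maximal one, is what forces \<open>R / J\<close> to have a unique maximal
  submodule.\<close>

definition largest_proper_left_ideal :: "('a, 'r) ring_scheme \<Rightarrow> 'a set \<Rightarrow> 'a set \<Rightarrow> bool" where
  "largest_proper_left_ideal R J I \<longleftrightarrow>
     submodule I R (regular_module R) \<and> J \<subseteq> I \<and> \<one>\<^bsub>R\<^esub> \<notin> I \<and>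
     (\<forall>K. submodule K R (regular_module R) \<and> J \<subseteq> K \<and> \<one>\<^bsub>R\<^esub> \<notin> K \<longrightarrow> K \<subseteq> I)"

text \<open>With \<open>left_ideal_image\<close> this is the dictionary between submodules of a
  cyclic module and left ideals, through the map sending \<open>a\<close> to
  \<open>a v\<close>.\<close>

lemma left_ideal_preimage:
  assumes "left_module R M" "v \<in> carrier M" "submodule N R M"
  shows "submodule {a \<in> carrier R. a \<odot>\<^bsub>M\<^esub> v \<in> N} R (regular_module R)"
proof -
  interpret M: left_module R M by fact
  interpret reg: left_module R "regular_module R" by (rule left_module_regular) unfold_locales
  note E = M.submoduleE[OF assms(3)]
  show ?thesis
    by (rule reg.submoduleI)
      (use assms(2) E in \<open>auto simp: regular_module_def M.smult_l_distr M.smult_assoc1\<close>)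
qed

lemma left_ideal_image:
  assumes "left_module R M" "v \<in> carrier M" "submodule I R (regular_module R)"
  shows "submodule ((\<lambda>a. a \<odot>\<^bsub>M\<^esub> v) ` I) R M"
proof -
  interpret M: left_module R M by fact
  interpret reg: left_module R "regular_module R" by (rule left_module_regular) unfold_locales
  note E = reg.submoduleE[OF assms(3)]
  have I: "I \<subseteq> carrier R" using E(1) by (simp add: regular_module_def)
  show ?thesis
  proof (rule M.submoduleI)
    show "\<zero>\<^bsub>M\<^esub> \<in> (\<lambda>a. a \<odot>\<^bsub>M\<^esub> v) ` I"
      using E(2) assms(2) by (intro image_eqI[of _ _ "\<zero>\<^bsub>R\<^esub>"]) (auto simp: regular_module_def)
  next
    fix x y assume "x \<in> (\<lambda>a. a \<odot>\<^bsub>M\<^esub> v) ` I" "y \<in> (\<lambda>a. a \<odot>\<^bsub>M\<^esub> v) ` I"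
    then obtain a b where ab: "a \<in> I" "x = a \<odot>\<^bsub>M\<^esub> v" "b \<in> I" "y = b \<odot>\<^bsub>M\<^esub> v" by blast
    then have "x \<oplus>\<^bsub>M\<^esub> y = (a \<oplus>\<^bsub>R\<^esub> b) \<odot>\<^bsub>M\<^esub> v"
      using I assms(2) by (simp add: M.smult_l_distr subset_eq)
    moreover have "a \<oplus>\<^bsub>R\<^esub> b \<in> I" using E(3)[of a b] ab by (simp add: regular_module_def)
    ultimately show "x \<oplus>\<^bsub>M\<^esub> y \<in> (\<lambda>a. a \<odot>\<^bsub>M\<^esub> v) ` I" by blast
  next
    fix c x assume c: "c \<in> carrier R" and "x \<in> (\<lambda>a. a \<odot>\<^bsub>M\<^esub> v) ` I"
    then obtain a where a: "a \<in> I" "x = a \<odot>\<^bsub>M\<^esub> v" by blast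
    then have "c \<odot>\<^bsub>M\<^esub> x = (c \<otimes>\<^bsub>R\<^esub> a) \<odot>\<^bsub>M\<^esub> v"
      using I assms(2) c by (simp add: M.smult_assoc1 subset_eq)
    moreover have "c \<otimes>\<^bsub>R\<^esub> a \<in> I" using E(4)[OF c a(1)] by (simp add: regular_module_def)
    ultimately show "c \<odot>\<^bsub>M\<^esub> x \<in> (\<lambda>a. a \<odot>\<^bsub>M\<^esub> v) ` I" by blast
  qed (use I assms(2) in auto)
qed

text \<open>As \<open>I\<close> contains the kernel \<open>J\<close> of the action on
  \<open>v\<close>, a scalar with the same image as a member of \<open>I\<close> differs from it by
  an element of \<open>I\<close>.\<close>

lemma largest_proper_left_ideal_vimage:
  assumes "presents R M v J" "largest_proper_left_ideal R J I"
  shows "{a \<in> carrier R. a \<odot>\<^bsub>M\<^esub> v \<in> (\<lambda>a. a \<odot>\<^bsub>M\<^esub> v) ` I} = I"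
proof -
  interpret M: left_module R M using assms(1) by (simp add: presents_def)
  interpret reg: left_module R "regular_module R" by (rule left_module_regular) unfold_locales
  have I: "submodule I R (regular_module R)" "J \<subseteq> I"
    using assms(2) by (auto simp: largest_proper_left_ideal_def)
  note E = reg.submoduleE[OF I(1)]
  have IR: "I \<subseteq> carrier R" using E(1) by (simp add: regular_module_def)
  have "a \<in> I" if a: "a \<in> carrier R" "b \<in> I" "a \<odot>\<^bsub>M\<^esub> v = b \<odot>\<^bsub>M\<^esub> v" for a b
  proof -
    have "a \<ominus>\<^bsub>R\<^esub> b \<in> I" using presents_diff[OF assms(1), of a b] a IR I(2) by auto
    then have "(a \<ominus>\<^bsub>R\<^esub> b) \<oplus>\<^bsub>R\<^esub> b \<in> I" using E(3) a(2) by (auto simp: regular_module_def)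
    moreover have "(a \<ominus>\<^bsub>R\<^esub> b) \<oplus>\<^bsub>R\<^esub> b = a"
      using a IR by (auto simp: a_minus_def M.R.a_assoc M.R.l_neg)
    ultimately show ?thesis by simp
  qed
  then show ?thesis using IR by auto
qed

text \<open>A submodule other than the whole module misses the generator, so its preimage is a
  proper left ideal over \<open>J\<close> and lies in \<open>I\<close>. Hence the image of
  \<open>I\<close> is the only maximal submodule, and the definite description denotes it.\<close>

lemma presents_top:
  assumes "presents R M v J" "largest_proper_left_ideal R J I"
  shows "submodule (THE N. maximal_submodule N R M) R M"
    and "{a \<in> carrier R. a \<odot>\<^bsub>M\<^esub> v \<in> (THE N. maximal_submodule N R M)} = I"
proof -
  interpret M: left_module R M using assms(1) by (simp add: presents_def)
  have v: "v \<in> carrier M" and gen: "\<And>x. x \<in> carrier M \<Longrightarrow> \<exists>a\<in>carrier R. x = a \<odot>\<^bsub>M\<^esub> v"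
    and J: "J = {a \<in> carrier R. a \<odot>\<^bsub>M\<^esub> v = \<zero>\<^bsub>M\<^esub>}"
    using assms(1) by (auto simp: presents_def)
  have I: "submodule I R (regular_module R)" "\<one>\<^bsub>R\<^esub> \<notin> I"
    and Imax: "\<And>K. submodule K R (regular_module R) \<Longrightarrow> J \<subseteq> K \<Longrightarrow> \<one>\<^bsub>R\<^esub> \<notin> K \<Longrightarrow> K \<subseteq> I"
    using assms(2) by (auto simp: largest_proper_left_ideal_def)
  define N0 where "N0 = (\<lambda>a. a \<odot>\<^bsub>M\<^esub> v) ` I"
  have N0: "submodule N0 R M" unfolding N0_def by (rule left_ideal_image) (use v I in \<open>simp_all add: M.left_module_axioms\<close>)
  have pre: "{a \<in> carrier R. a \<odot>\<^bsub>M\<^esub> v \<in> N0} = I"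
    unfolding N0_def by (rule largest_proper_left_ideal_vimage[OF assms])
  have "v \<notin> N0" using pre I(2) v by force
  then have N0_neq: "N0 \<noteq> carrier M" using v by blast
  have sub: "N \<subseteq> N0" if N: "submodule N R M" "N \<noteq> carrier M" for N
  proof -
    note E = M.submoduleE[OF N(1)]
    have "v \<notin> N"
    proof
      assume "v \<in> N"
      then have "x \<in> N" if "x \<in> carrier M" for x using gen[OF that] E(4) by auto
      then show False using N(2) E(1) by blast
    qed
    moreover have "J \<subseteq> {a \<in> carrier R. a \<odot>\<^bsub>M\<^esub> v \<in> N}" using J E(2) by auto
    ultimately have I_sup: "{a \<in> carrier R. a \<odot>\<^bsub>M\<^esub> v \<in> N} \<subseteq> I"
      using Imax[OF left_ideal_preimage[OF M.left_module_axioms v N(1)]] v by simp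
    show ?thesis
    proof
      fix x assume x: "x \<in> N"
      then obtain a where "a \<in> carrier R" "x = a \<odot>\<^bsub>M\<^esub> v" using gen[of x] E(1) by auto
      then show "x \<in> N0" using I_sup x unfolding N0_def by blast
    qed
  qed
  have "maximal_submodule N0 R M"
    unfolding maximal_submodule_def using N0 N0_neq sub by blast
  \<comment> \<open>A maximal submodule lies in \<open>N0\<close> by \<open>sub\<close>, and
    \<open>N0\<close> is not the whole module.\<close>
  moreover have "N = N0" if "maximal_submodule N R M" for N
    using that sub N0 N0_neq unfolding maximal_submodule_def by metis
  ultimately have the: "(THE N. maximal_submodule N R M) = N0" by (rule the_equality)
  show "submodule (THE N. maximal_submodule N R M) R M"
    "{a \<in> carrier R. a \<odot>\<^bsub>M\<^esub> v \<in> (THE N. maximal_submodule N R M)} = I"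
    unfolding the by (fact N0 pre)+
qed

text \<open>The preimage of a submodule that misses \<open>v\<close> is a proper left ideal over
  \<open>J\<close>, hence contained in the annihilator \<open>I\<close>; the submodule is then
  zero.\<close>

lemma presents_simple:
  assumes "presents R M v I" "largest_proper_left_ideal R J I"
  shows "simple_module R M"
proof -
  interpret M: left_module R M using assms(1) by (simp add: presents_def)
  have v: "v \<in> carrier M" and gen: "\<And>x. x \<in> carrier M \<Longrightarrow> \<exists>a\<in>carrier R. x = a \<odot>\<^bsub>M\<^esub> v"
    and I: "I = {a \<in> carrier R. a \<odot>\<^bsub>M\<^esub> v = \<zero>\<^bsub>M\<^esub>}"
    using assms(1) by (auto simp: presents_def)
  have one: "\<one>\<^bsub>R\<^esub> \<notin> I" "J \<subseteq> I"
    and Imax: "\<And>K. submodule K R (regular_module R) \<Longrightarrow> J \<subseteq> K \<Longrightarrow> \<one>\<^bsub>R\<^esub> \<notin> K \<Longrightarrow> K \<subseteq> I"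
    using assms(2) by (auto simp: largest_proper_left_ideal_def)
  have "N = {\<zero>\<^bsub>M\<^esub>} \<or> N = carrier M" if N: "submodule N R M" for N
  proof (cases "v \<in> N")
    case True
    note E = M.submoduleE[OF N]
    have "x \<in> N" if "x \<in> carrier M" for x using gen[OF that] E(4) True by auto
    then show ?thesis using E(1) by blast
  next
    case False
    note E = M.submoduleE[OF N]
    have "I \<subseteq> {a \<in> carrier R. a \<odot>\<^bsub>M\<^esub> v \<in> N}" using I E(2) by auto
    then have "{a \<in> carrier R. a \<odot>\<^bsub>M\<^esub> v \<in> N} \<subseteq> I"
      using Imax[OF left_ideal_preimage[OF M.left_module_axioms v N]] one(2) v False by auto
    then have "x = \<zero>\<^bsub>M\<^esub>" if "x \<in> N" for x
      using gen[of x] that E(1) I by blast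
    then show ?thesis using E(2) by blast
  qed
  moreover have "carrier M \<noteq> {\<zero>\<^bsub>M\<^esub>}" using one(1) I v by auto
  ultimately show ?thesis unfolding simple_module_def using M.left_module_axioms by blast
qed

text \<open>The annihilator \<open>K\<close> of \<open>v\<close> is proper and contains
  \<open>J\<close>, so it lies in \<open>I\<close>. Conversely \<open>I v\<close> is zero or
  everything, and the second case would put 1 into \<open>I\<close>; thus \<open>I\<close> kills
  \<open>v\<close> and \<open>I = K\<close>.\<close>

lemma simple_module_presents:
  assumes "simple_module R M" "v \<in> carrier M" "v \<noteq> \<zero>\<^bsub>M\<^esub>"
    and "\<And>a. a \<in> J \<Longrightarrow> a \<in> carrier R \<and> a \<odot>\<^bsub>M\<^esub> v = \<zero>\<^bsub>M\<^esub>" "largest_proper_left_ideal R J I"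
  shows "presents R M v I"
proof -
  interpret M: left_module R M using assms(1) by (simp add: simple_module_def)
  interpret reg: left_module R "regular_module R" by (rule left_module_regular) unfold_locales
  have dich: "N = {\<zero>\<^bsub>M\<^esub>} \<or> N = carrier M" if "submodule N R M" for N
    using assms(1) that by (simp add: simple_module_def)
  have I: "submodule I R (regular_module R)" "\<one>\<^bsub>R\<^esub> \<notin> I"
    and Imax: "\<And>K. submodule K R (regular_module R) \<Longrightarrow> J \<subseteq> K \<Longrightarrow> \<one>\<^bsub>R\<^esub> \<notin> K \<Longrightarrow> K \<subseteq> I"
    using assms(5) by (auto simp: largest_proper_left_ideal_def)
  have IR: "I \<subseteq> carrier R" using reg.submoduleE(1)[OF I(1)] by (simp add: regular_module_def)
  have v_im: "v \<in> (\<lambda>a. a \<odot>\<^bsub>M\<^esub> v) ` carrier R" using assms(2) by (intro image_eqI[of _ _ "\<one>\<^bsub>R\<^esub>"]) auto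
  have "submodule ((\<lambda>a. a \<odot>\<^bsub>M\<^esub> v) ` carrier R) R M"
    using left_ideal_image[OF M.left_module_axioms assms(2) reg.carrier_submodule]
    by (simp add: regular_module_def)
  from dich[OF this] v_im assms(3) have gen: "(\<lambda>a. a \<odot>\<^bsub>M\<^esub> v) ` carrier R = carrier M" by blast
  define K where "K = {a \<in> carrier R. a \<odot>\<^bsub>M\<^esub> v \<in> {\<zero>\<^bsub>M\<^esub>}}"
  have "submodule K R (regular_module R)"
    unfolding K_def by (rule left_ideal_preimage[OF M.left_module_axioms assms(2) M.zero_submodule])
  then have K: "K \<subseteq> I"
    using Imax[of K] assms(2-4) by (auto simp: K_def)
  have pK: "presents R M v K"
    unfolding presents_def K_def using gen assms(2) M.left_module_axioms by auto
  have "(\<lambda>a. a \<odot>\<^bsub>M\<^esub> v) ` I = {\<zero>\<^bsub>M\<^esub>}"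
  proof (rule ccontr)
    assume "(\<lambda>a. a \<odot>\<^bsub>M\<^esub> v) ` I \<noteq> {\<zero>\<^bsub>M\<^esub>}"
    then have "(\<lambda>a. a \<odot>\<^bsub>M\<^esub> v) ` I = carrier M"
      using dich[OF left_ideal_image[OF M.left_module_axioms assms(2) I(1)]] by blast
    then obtain a where a: "a \<in> I" "\<one>\<^bsub>R\<^esub> \<odot>\<^bsub>M\<^esub> v = a \<odot>\<^bsub>M\<^esub> v" using assms(2) by force
    \<comment> \<open>Now \<open>1 - a\<close> annihilates \<open>v\<close>, so it is in
      \<open>K\<close> and thereby in \<open>I\<close>; adding \<open>a\<close> gives 1.\<close>
    then have "\<one>\<^bsub>R\<^esub> \<ominus>\<^bsub>R\<^esub> a \<in> I" using presents_diff[OF pK, of "\<one>\<^bsub>R\<^esub>" a] IR K by auto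
    then have "(\<one>\<^bsub>R\<^esub> \<ominus>\<^bsub>R\<^esub> a) \<oplus>\<^bsub>R\<^esub> a \<in> I"
      using reg.submoduleE(3)[OF I(1), of "\<one>\<^bsub>R\<^esub> \<ominus>\<^bsub>R\<^esub> a" a] a(1) by (simp add: regular_module_def)
    moreover have "(\<one>\<^bsub>R\<^esub> \<ominus>\<^bsub>R\<^esub> a) \<oplus>\<^bsub>R\<^esub> a = \<one>\<^bsub>R\<^esub>"
      using a IR by (auto simp: a_minus_def M.R.a_assoc M.R.l_neg)
    ultimately show False using I(2) by simp
  qed
  then have "I = K" using K IR by (auto simp: K_def)
  then show ?thesis using pK by simp
qed

section \<open>Polynomial functions of infinitely many variables\<close>

text \<open>Functions rather than formal polynomials: composing operators will shift the argument,
  and symbols are evaluated at weights with arbitrary coordinates. In characteristic zero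
  \<open>polyfun_eq_0\<close> shows that the values at exponent vectors determine the
  function.\<close>

inductive polyfun :: "(('i \<Rightarrow> 'k::comm_ring_1) \<Rightarrow> 'k) \<Rightarrow> bool" where
  const: "polyfun (\<lambda>_. c)"
| coord: "polyfun (\<lambda>v. v i)"
| add: "polyfun f \<Longrightarrow> polyfun g \<Longrightarrow> polyfun (\<lambda>v. f v + g v)"
| mult: "polyfun f \<Longrightarrow> polyfun g \<Longrightarrow> polyfun (\<lambda>v. f v * g v)"

lemma polyfun_shift: "polyfun f \<Longrightarrow> polyfun (\<lambda>v. f (\<lambda>i. v i + z i))"
  by (induction rule: polyfun.induct) (auto intro: polyfun.intros)

lemma polyfun_diff: "polyfun f \<Longrightarrow> polyfun g \<Longrightarrow> polyfun (\<lambda>v. f v - g v)"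
  using polyfun.add[of f "\<lambda>v. - 1 * g v"] polyfun.mult[OF polyfun.const[of "- 1"], of g] by simp

text \<open>Infinitely many variables are reduced to finitely many: coordinates outside
  \<open>S\<close> may be set to 0 at will.\<close>

lemma polyfun_finite_dependence:
  assumes "polyfun f"
  shows "\<exists>S. finite S \<and> (\<forall>v w. (\<forall>i\<in>S. v i = w i) \<longrightarrow> f v = f w)"
  using assms
proof (induction rule: polyfun.induct)
  case (const c)
  then show ?case by auto
next
  case (coord i)
  then show ?case by (intro exI[of _ "{i}"]) auto
next
  case (add f g)
  then obtain S T where "finite S" "\<forall>v w. (\<forall>i\<in>S. v i = w i) \<longrightarrow> f v = f w"
    "finite T" "\<forall>v w. (\<forall>i\<in>T. v i = w i) \<longrightarrow> g v = g w" by blast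
  then show ?case by (intro exI[of _ "S \<union> T"] conjI allI impI arg_cong2[of _ _ _ _ "(+)"]) auto
next
  case (mult f g)
  then obtain S T where "finite S" "\<forall>v w. (\<forall>i\<in>S. v i = w i) \<longrightarrow> f v = f w"
    "finite T" "\<forall>v w. (\<forall>i\<in>T. v i = w i) \<longrightarrow> g v = g w" by blast
  then show ?case by (intro exI[of _ "S \<union> T"] conjI allI impI arg_cong2[of _ _ _ _ "(*)"]) auto
qed

text \<open>On a line parallel to a coordinate axis, root counting in one variable becomes
  available.\<close>

lemma polyfun_univariate:
  assumes "polyfun f"
  shows "\<exists>q. \<forall>c. f (v(i := c)) = poly q c"
  using assms
proof (induction rule: polyfun.induct)
  case (const c)
  show ?case by (intro exI[of _ "[:c:]"]) simp
next
  case (coord j)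
  show ?case by (intro exI[of _ "if j = i then [:0, 1:] else [:v j:]"]) simp
next
  case (add f g)
  then obtain q r where "\<forall>c. f (v(i := c)) = poly q c" "\<forall>c. g (v(i := c)) = poly r c" by blast
  then show ?case by (intro exI[of _ "q + r"]) (simp del: fun_upd_apply)
next
  case (mult f g)
  then obtain q r where "\<forall>c. f (v(i := c)) = poly q c" "\<forall>c. g (v(i := c)) = poly r c" by blast
  then show ?case by (intro exI[of _ "q * r"]) (simp del: fun_upd_apply)
qed

section \<open>Exponent vectors as weights, and their density\<close>

text \<open>The monomial \<open>x^m\<close> is an eigenvector of every \<open>t_op i\<close>, and
  this is its weight.\<close>

definition nat_weight :: "('i \<Rightarrow>\<^sub>0 nat) \<Rightarrow> 'i \<Rightarrow> 'k::semiring_1" where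
  "nat_weight m = (\<lambda>i. of_nat (Poly_Mapping.lookup m i))"

lemma nat_weight_eq_iff [simp]:
  "(nat_weight m :: 'i \<Rightarrow> 'k::semiring_char_0) = nat_weight n \<longleftrightarrow> m = n"
  by (auto simp: nat_weight_def fun_eq_iff intro: poly_mapping_eqI)

lemma nat_weight_in_Nats: "nat_weight m i \<in> \<nat>"
  by (simp add: nat_weight_def)

lemma nat_weight_add_single:
  "nat_weight (m + Poly_Mapping.single i 1) = (\<lambda>j. nat_weight m j + (if j = i then 1 else 0))"
  by (auto simp: nat_weight_def lookup_add lookup_single when_def fun_eq_iff)

lemma ex_nat_weight:
  assumes "\<And>i. v i \<in> \<nat>" "finite {i. v i \<noteq> (0 :: 'k::semiring_char_0)}"
  shows "\<exists>m. v = nat_weight m"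
proof -
  have "\<forall>i. \<exists>n. v i = of_nat n" using assms(1) by (auto elim: Nats_cases)
  then obtain h where h: "\<And>i. v i = of_nat (h i)" by metis
  then have "finite {i. h i \<noteq> 0}" using assms(2) by simp
  then have "v = nat_weight (Abs_poly_mapping h)"
    by (auto simp: nat_weight_def h)
  then show ?thesis ..
qed

text \<open>Exponent vectors are Zariski dense. Coordinates are freed one at a time: in each of them
  the function is a polynomial in one variable that vanishes at all natural numbers, which are
  infinitely many in characteristic zero.\<close>

lemma polyfun_eq_0:
  fixes f :: "('i \<Rightarrow> 'k::field_char_0) \<Rightarrow> 'k"
  assumes "polyfun f" and zero: "\<And>m. f (nat_weight m) = 0"
  shows "f v = 0"
proof -
  obtain S where S: "finite S" and dep: "\<And>v w. (\<forall>i\<in>S. v i = w i) \<Longrightarrow> f v = f w"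
    using polyfun_finite_dependence[OF assms(1)] by blast
  \<comment> \<open>\<open>T\<close> holds the coordinates already freed from being natural numbers;
    \<open>v\<close> varies, so that the induction hypothesis applies with a natural number put into
    coordinate \<open>i\<close>.\<close>
  have "f v = 0" if "finite T" "\<And>i. i \<notin> T \<Longrightarrow> v i \<in> \<nat>" for T v
    using that
  proof (induction T arbitrary: v)
    case empty
    \<comment> \<open>Cutting off outside \<open>S\<close> does not change the value and makes the
      support finite, so the result is an exponent vector.\<close>
    have "\<exists>m. (\<lambda>i. if i \<in> S then v i else 0) = nat_weight m"
      by (rule ex_nat_weight) (use empty S in \<open>auto intro: finite_subset[of _ S]\<close>)
    then obtain m where m: "(\<lambda>i. if i \<in> S then v i else 0) = nat_weight m" by blast
    have "f v = f (\<lambda>i. if i \<in> S then v i else 0)" by (rule dep) simp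
    then show ?case by (simp add: m zero)
  next
    case (insert i T)
    obtain q where q: "\<And>c. f (v(i := c)) = poly q c" using polyfun_univariate[OF assms(1)] by blast
    have "poly q (of_nat n) = 0" for n
      unfolding q[symmetric] by (rule insert.IH) (use insert.prems in auto)
    then have "range of_nat \<subseteq> {c. poly q c = 0}" by auto
    moreover have "infinite (range (of_nat :: nat \<Rightarrow> 'k))" by (rule range_inj_infinite[OF inj_of_nat])
    ultimately have "infinite {c. poly q c = 0}" using finite_subset by blast
    then have "q = 0" using poly_roots_finite by blast
    then show ?case using q[of "v i"] by simp
  qed
  from this[of S "\<lambda>i. if i \<in> S then v i else 0"] S
  have "f (\<lambda>i. if i \<in> S then v i else 0) = 0" by simp
  moreover have "f v = f (\<lambda>i. if i \<in> S then v i else 0)" by (rule dep) simp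
  ultimately show ?thesis by simp
qed

section \<open>The Weyl algebra as a graded ring\<close>

lemma End_pol_simps [simp]:
  "(\<otimes>\<^bsub>End_pol\<^esub>) = (\<circ>)" "\<one>\<^bsub>End_pol\<^esub> = id" "\<zero>\<^bsub>End_pol\<^esub> = (\<lambda>_. 0)"
  "(\<oplus>\<^bsub>End_pol\<^esub>) = (\<lambda>f g b. f b + g b)"
  by (simp_all add: End_pol_def)

lemma End_polD:
  assumes "f \<in> carrier End_pol"
  shows "f (b + b') = f b + f b'" "f (scal_op c b) = scal_op c (f b)" "f 0 = 0" "f (- b) = - f b"
    "f (sum g S) = (\<Sum>s\<in>S. f (g s))"
proof -
  show add: "f (b + b') = f b + f b'" for b b' using assms by (simp add: End_pol_def)
  show "f (scal_op c b) = scal_op c (f b)" using assms by (simp add: End_pol_def)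
  show zero: "f 0 = 0" using add[of 0 0] by simp
  show "f (- b) = - f b" using add[of b "- b"] zero by (simp add: eq_neg_iff_add_eq_0 add.commute)
  show "f (sum g S) = (\<Sum>s\<in>S. f (g s))"
    by (induction S rule: infinite_finite_induct) (simp_all add: zero add)
qed

lemma End_pol_diff: "f \<in> carrier End_pol \<Longrightarrow> f (b - b') = f b - f b'"
  using End_polD(1)[of f b "- b'"] End_polD(4)[of f b'] by simp

lemma ring_End_pol: "ring (End_pol :: ('i, 'k::field) pol_op ring)"
proof (rule ringI)
  show "abelian_group (End_pol :: ('i, 'k) pol_op ring)"
  proof (rule abelian_groupI)
    fix f :: "('i, 'k) pol_op" assume f: "f \<in> carrier End_pol"
    show "\<exists>g\<in>carrier End_pol. g \<oplus>\<^bsub>End_pol\<^esub> f = \<zero>\<^bsub>End_pol\<^esub>"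
      by (rule bexI[of _ "\<lambda>b. - f b"]) (use f in \<open>auto simp: End_pol_def scal_op_def\<close>)
  qed (auto simp: End_pol_def scal_op_def algebra_simps)
  show "monoid (End_pol :: ('i, 'k) pol_op ring)"
    by (rule monoidI) (auto simp: End_pol_def)
qed (auto simp: End_pol_def)

lemma scal_op_single: "scal_op d (Poly_Mapping.single m c) = Poly_Mapping.single m (d * c)"
  by (simp add: scal_op_def mult_single)

lemma scal_op_scal_op: "scal_op c (scal_op d b) = scal_op (c * d) b"
  unfolding scal_op_def mult.assoc[symmetric] by (simp add: mult_single)

lemma scal_op_1: "scal_op 1 b = b"
  by (simp add: scal_op_def)

lemma scal_op_minus_1: "scal_op (- 1) b = - b"
  by (simp add: scal_op_def single_uminus)

lemma lookup_scal_op: "Poly_Mapping.lookup (scal_op d b) n = d * Poly_Mapping.lookup b n"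
  unfolding scal_op_def mult_map_scale_conv_mult[symmetric] by (simp add: Poly_Mapping.map.rep_eq when_def)

lemma X_op_single:
  "X_op i (Poly_Mapping.single m c) = Poly_Mapping.single (m + Poly_Mapping.single i 1) c"
  by (simp add: X_op_def mult_single add.commute)

text \<open>Reading off coefficients removes the truncated subtraction: a term with positive
  exponent \<open>m_i\<close> lands on \<open>n\<close> only for \<open>m = n + e_i\<close>, and
  terms with \<open>m_i = 0\<close> have coefficient zero.\<close>

lemma lookup_Y_op:
  "Poly_Mapping.lookup (Y_op i b) n =
    of_nat (Poly_Mapping.lookup n i + 1) * Poly_Mapping.lookup b (n + Poly_Mapping.single i 1)"
proof -
  let ?e = "Poly_Mapping.single i (1::nat)"
  have eq: "(of_nat (Poly_Mapping.lookup m i) * Poly_Mapping.lookup b m when m - ?e = n) =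
      (of_nat (Poly_Mapping.lookup n i + 1) * Poly_Mapping.lookup b m when m = n + ?e)" for m
  proof (cases "Poly_Mapping.lookup m i = 0")
    case True
    then have "m \<noteq> n + ?e" by (auto simp: lookup_add)
    then show ?thesis using True by simp
  next
    case False
    then have "m - ?e + ?e = m"
      by (intro poly_mapping_eqI) (auto simp: lookup_add lookup_minus lookup_single when_def)
    then have "m - ?e = n \<longleftrightarrow> m = n + ?e" by auto
    then show ?thesis by (auto simp: when_def lookup_add)
  qed
  have "Poly_Mapping.lookup (Y_op i b) n =
      (\<Sum>m\<in>Poly_Mapping.keys b. of_nat (Poly_Mapping.lookup m i) * Poly_Mapping.lookup b m when m - ?e = n)"
    by (simp add: Y_op_def lookup_sum lookup_single)
  also have "\<dots> = (\<Sum>m\<in>Poly_Mapping.keys b. of_nat (Poly_Mapping.lookup n i + 1) * Poly_Mapping.lookup b m when m = n + ?e)"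
    by (simp only: eq)
  also have "\<dots> = of_nat (Poly_Mapping.lookup n i + 1) * Poly_Mapping.lookup b (n + ?e)"
    by (auto simp: when_def in_keys_iff)
  finally show ?thesis .
qed

lemma scal_op_in_End_pol: "scal_op c \<in> carrier End_pol"
  by (auto simp: End_pol_def scal_op_def algebra_simps)

lemma X_op_in_End_pol: "X_op i \<in> carrier End_pol"
  by (auto simp: End_pol_def X_op_def scal_op_def algebra_simps)

lemma Y_op_in_End_pol: "Y_op i \<in> carrier End_pol"
  unfolding End_pol_def
  by (auto intro!: poly_mapping_eqI simp: lookup_Y_op lookup_add lookup_scal_op algebra_simps)

lemma End_pol_single:
  assumes "f \<in> carrier End_pol"
  shows "f (Poly_Mapping.single m c) = scal_op c (f (Poly_Mapping.single m 1))"
  using End_polD(2)[OF assms, of c "Poly_Mapping.single m 1"] by (simp add: scal_op_single)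

lemma End_pol_eqI:
  fixes f g :: "('i, 'k::field) pol_op"
  assumes "f \<in> carrier End_pol" "g \<in> carrier End_pol"
    and "\<And>m. f (Poly_Mapping.single m 1) = g (Poly_Mapping.single m 1)"
  shows "f = g"
proof
  fix b :: "('i, 'k) pol"
  have b: "b = (\<Sum>m\<in>Poly_Mapping.keys b. Poly_Mapping.single m (Poly_Mapping.lookup b m))"
    by (rule poly_mapping_eqI) (auto simp: lookup_sum lookup_single when_def in_keys_iff)
  have "f (Poly_Mapping.single m c) = g (Poly_Mapping.single m c)" for m c
    using End_pol_single assms by metis
  then show "f b = g b"
    by (subst (1 2) b) (simp add: End_polD(5)[OF assms(1)] End_polD(5)[OF assms(2)])
qed

section \<open>The Weyl algebra and \<open>weyl0\<close> as subrings\<close>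

lemma weyl_simps [simp]:
  "(\<otimes>\<^bsub>weyl\<^esub>) = (\<circ>)" "\<one>\<^bsub>weyl\<^esub> = id" "\<zero>\<^bsub>weyl\<^esub> = (\<lambda>_. 0)" "(\<oplus>\<^bsub>weyl\<^esub>) = (\<lambda>f g b. f b + g b)"
  "(\<otimes>\<^bsub>weyl0\<^esub>) = (\<circ>)" "\<one>\<^bsub>weyl0\<^esub> = id" "\<zero>\<^bsub>weyl0\<^esub> = (\<lambda>_. 0)" "(\<oplus>\<^bsub>weyl0\<^esub>) = (\<lambda>f g b. f b + g b)"
  by (simp_all add: weyl_def weyl0_def subalgebra_of_def)

lemma carrier_weyl:
  "carrier weyl = generate_ring End_pol (range X_op \<union> range Y_op \<union> range scal_op)"
  by (simp add: weyl_def subalgebra_of_def)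

lemma carrier_weyl0: "carrier weyl0 = generate_ring End_pol (range t_op \<union> range scal_op)"
  by (simp add: weyl0_def subalgebra_of_def)

lemma carrier_weyl_subset: "carrier weyl \<subseteq> carrier End_pol"
  unfolding carrier_weyl
  by (rule ring.generate_ring_incl[OF ring_End_pol])
    (auto simp: scal_op_in_End_pol X_op_in_End_pol Y_op_in_End_pol)

lemma ring_weyl: "ring weyl"
  unfolding weyl_def subalgebra_of_def
  by (rule ring.generate_ring_is_ring[OF ring_End_pol])
    (auto simp: scal_op_in_End_pol X_op_in_End_pol Y_op_in_End_pol)

lemma scal_op_in_weyl: "scal_op c \<in> carrier weyl"
  and X_op_in_weyl: "X_op i \<in> carrier weyl"
  and Y_op_in_weyl: "Y_op i \<in> carrier weyl"
  unfolding carrier_weyl by (auto intro: generate_ring.incl)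

lemma weyl_zero: "(\<lambda>_. 0) \<in> carrier weyl"
  using ring.ring_simprules(2)[OF ring_weyl] by simp

lemma weyl_comp: "a \<in> carrier weyl \<Longrightarrow> b \<in> carrier weyl \<Longrightarrow> a \<circ> b \<in> carrier weyl"
  using ring.ring_simprules(5)[OF ring_weyl, of a b] by simp

lemma weyl_add: "a \<in> carrier weyl \<Longrightarrow> b \<in> carrier weyl \<Longrightarrow> (\<lambda>x. a x + b x) \<in> carrier weyl"
  using ring.ring_simprules(1)[OF ring_weyl, of a b] by simp

lemma t_op_in_weyl: "t_op i \<in> carrier weyl"
  unfolding t_op_def by (intro weyl_comp X_op_in_weyl Y_op_in_weyl)

lemma t_op_in_End_pol: "t_op i \<in> carrier End_pol"
  by (rule subsetD[OF carrier_weyl_subset t_op_in_weyl])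

lemma carrier_weyl0_subset: "carrier weyl0 \<subseteq> carrier weyl"
proof -
  have "subring (carrier weyl) End_pol"
    unfolding carrier_weyl
    by (rule ring.generate_ring_is_subring[OF ring_End_pol])
      (auto simp: scal_op_in_End_pol X_op_in_End_pol Y_op_in_End_pol)
  then show ?thesis
    unfolding carrier_weyl0
    by (intro ring.generate_ring_min_subring1[OF ring_End_pol])
      (auto simp: t_op_in_weyl scal_op_in_weyl t_op_in_End_pol scal_op_in_End_pol)
qed

lemma ring_weyl0: "ring weyl0"
  unfolding weyl0_def subalgebra_of_def
  by (rule ring.generate_ring_is_ring[OF ring_End_pol])
    (auto simp: t_op_in_End_pol scal_op_in_End_pol)

lemma t_op_in_weyl0: "t_op i \<in> carrier weyl0" and scal_op_in_weyl0: "scal_op c \<in> carrier weyl0"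
  unfolding carrier_weyl0 by (auto intro: generate_ring.incl)

lemma End_pol_uminus: "f \<in> carrier End_pol \<Longrightarrow> \<ominus>\<^bsub>End_pol\<^esub> f = (\<lambda>b. - f b)"
  by (rule abelian_group.minus_equality[OF ring.is_abelian_group[OF ring_End_pol]])
    (auto simp: End_pol_def scal_op_def)

lemma weyl_uminus: "f \<in> carrier weyl \<Longrightarrow> \<ominus>\<^bsub>weyl\<^esub> f = (\<lambda>b. - f b)"
  using generate_ring.a_inv[of f End_pol "range X_op \<union> range Y_op \<union> range scal_op"]
    End_pol_uminus[of f] carrier_weyl_subset
  by (intro abelian_group.minus_equality[OF ring.is_abelian_group[OF ring_weyl]])
    (auto simp: carrier_weyl)

lemma weyl0_uminus: "f \<in> carrier weyl0 \<Longrightarrow> \<ominus>\<^bsub>weyl0\<^esub> f = (\<lambda>b. - f b)"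
  using generate_ring.a_inv[of f End_pol "range t_op \<union> range scal_op"]
    End_pol_uminus[of f] carrier_weyl_subset carrier_weyl0_subset
  by (intro abelian_group.minus_equality[OF ring.is_abelian_group[OF ring_weyl0]])
    (auto simp: carrier_weyl0)

lemma weyl_minus:
  "a \<in> carrier weyl \<Longrightarrow> b \<in> carrier weyl \<Longrightarrow> a \<ominus>\<^bsub>weyl\<^esub> b = (\<lambda>x. a x - b x)"
  "a \<in> carrier weyl0 \<Longrightarrow> b \<in> carrier weyl0 \<Longrightarrow> a \<ominus>\<^bsub>weyl0\<^esub> b = (\<lambda>x. a x - b x)"
  by (simp_all add: a_minus_def weyl_uminus weyl0_uminus)

lemma weyl_minus_closed:
  "a \<in> carrier weyl \<Longrightarrow> b \<in> carrier weyl \<Longrightarrow> (\<lambda>x. a x - b x) \<in> carrier weyl"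
  using ring.ring_simprules(4)[OF ring_weyl, of a b] by (simp add: weyl_minus)

section \<open>Homogeneous operators and their symbols\<close>

text \<open>
  The symbol \<open>f\<close> is evaluated at arbitrary vectors later on, so the reason why \<open>a\<close> cannot leave the
  polynomials, namely that \<open>f\<close> vanishes where a coordinate would leave the natural numbers, is
  required for all vectors.
\<close>

definition homog ::
    "('i \<Rightarrow> 'k::field_char_0) \<Rightarrow> (('i \<Rightarrow> 'k) \<Rightarrow> 'k) \<Rightarrow> ('i, 'k) pol_op \<Rightarrow> bool" where
  "homog z f a \<longleftrightarrow> a \<in> carrier weyl \<and> polyfun f \<and> z \<in> Z_fin \<and>
     (\<forall>v i. v i \<in> \<nat> \<longrightarrow> v i + z i \<notin> \<nat> \<longrightarrow> f v = 0) \<and>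
     (\<forall>m n. Poly_Mapping.lookup (a (Poly_Mapping.single m 1)) n =
        (if nat_weight n = (\<lambda>i. nat_weight m i + z i) then f (nat_weight m) else 0))"

lemma homog_weyl: "homog z f a \<Longrightarrow> a \<in> carrier weyl"
  and homog_polyfun: "homog z f a \<Longrightarrow> polyfun f"
  and homog_Z_fin: "homog z f a \<Longrightarrow> z \<in> Z_fin"
  by (simp_all add: homog_def)

lemma homog_exit: "homog z f a \<Longrightarrow> v i \<in> \<nat> \<Longrightarrow> v i + z i \<notin> \<nat> \<Longrightarrow> f v = 0"
  unfolding homog_def by blast

lemma homog_lookup:
  "homog z f a \<Longrightarrow> Poly_Mapping.lookup (a (Poly_Mapping.single m c)) n =
    (if nat_weight n = (\<lambda>i. nat_weight m i + z i) then c * f (nat_weight m) else 0)"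
  unfolding homog_def using End_pol_single[of a m c] carrier_weyl_subset
  by (auto simp: lookup_scal_op)

lemma homog_single:
  assumes "homog z f a" "nat_weight n = (\<lambda>i. nat_weight m i + z i)"
  shows "a (Poly_Mapping.single m c) = Poly_Mapping.single n (c * f (nat_weight m))"
  by (rule poly_mapping_eqI)
    (auto simp: homog_lookup[OF assms(1)] lookup_single when_def assms(2)[symmetric])

text \<open>\<open>nat_weight m + z\<close> has finite support, so if it is no exponent vector, some
  coordinate is not a natural number; there \<open>homog_exit\<close> makes the symbol
  vanish.\<close>

lemma homog_single_0:
  assumes "homog z f a" "\<And>n. nat_weight n \<noteq> (\<lambda>i. nat_weight m i + z i)"
  shows "a (Poly_Mapping.single m c) = 0" "f (nat_weight m) = 0"
proof -
  show "a (Poly_Mapping.single m c) = 0"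
    by (rule poly_mapping_eqI) (auto simp: homog_lookup[OF assms(1)] assms(2))
  have "finite {i. nat_weight m i + z i \<noteq> 0}"
    by (rule finite_subset[of _ "Poly_Mapping.keys m \<union> {i. z i \<noteq> 0}"])
      (use homog_Z_fin[OF assms(1)] in \<open>auto simp: Z_fin_def nat_weight_def in_keys_iff\<close>)
  then have "\<exists>i. nat_weight m i + z i \<notin> \<nat>"
    using ex_nat_weight[of "\<lambda>i. nat_weight m i + z i"] assms(2) by metis
  then show "f (nat_weight m) = 0"
    using homog_exit[OF assms(1)] nat_weight_in_Nats by metis
qed

text \<open>Degree and symbol determine the operator on every monomial. Identities in the Weyl
  algebra are proved below by comparing symbols.\<close>

lemma homog_unique:
  assumes "homog z f a" "homog z f b"
  shows "a = b"
proof (rule End_pol_eqI)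
  show "a \<in> carrier End_pol" "b \<in> carrier End_pol"
    using assms[THEN homog_weyl] carrier_weyl_subset by auto
  show "a (Poly_Mapping.single m 1) = b (Poly_Mapping.single m 1)" for m
    by (rule poly_mapping_eqI) (simp add: assms[THEN homog_lookup])
qed

lemma homog_scal: "homog (\<lambda>_. 0) (\<lambda>_. c) (scal_op c)"
  by (auto simp: homog_def scal_op_in_weyl polyfun.const Z_fin_def scal_op_single lookup_single when_def)

lemma homog_id: "homog (\<lambda>_. 0) (\<lambda>_. 1) (id :: ('i, 'k::field_char_0) pol_op)"
proof -
  have "homog (\<lambda>_. 0) (\<lambda>_. 1) (scal_op 1 :: ('i, 'k) pol_op)" by (rule homog_scal)
  moreover have "scal_op 1 = (id :: ('i, 'k) pol_op)" by (rule ext) (simp add: scal_op_1)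
  ultimately show ?thesis by simp
qed

lemma homog_X: "homog (\<lambda>j. if j = i then 1 else 0) (\<lambda>_. 1) (X_op i)"
proof -
  have "(\<lambda>j. if j = i then 1 else 0) \<in> Z_fin" by (auto simp: Z_fin_def)
  then show ?thesis
    by (auto simp: homog_def X_op_in_weyl polyfun.const X_op_single lookup_single when_def
      nat_weight_add_single[symmetric])
qed

lemma homog_Y: "homog (\<lambda>j. if j = i then - 1 else 0) (\<lambda>v. v i) (Y_op i :: ('i, 'k::field_char_0) pol_op)"
proof -
  have "(\<lambda>j. if j = i then - 1 else 0 :: 'k) \<in> Z_fin" by (auto simp: Z_fin_def)
  \<comment> \<open>Subtracting 1 leads out of the natural numbers only from 0, where the symbol of
    the derivative vanishes.\<close>
  moreover have "x = 0" if x: "x \<in> \<nat>" "x - 1 \<notin> \<nat>" for x :: 'k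
  proof -
    obtain n where n: "x = of_nat n" using x(1) by (auto elim: Nats_cases)
    show ?thesis
    proof (cases n)
      case (Suc k)
      then have "x - 1 = of_nat k" using n by simp
      then show ?thesis using x(2) by simp
    qed (simp add: n)
  qed
  moreover have "Poly_Mapping.lookup (Y_op i (Poly_Mapping.single m 1)) n =
      (if (nat_weight n :: 'i \<Rightarrow> 'k) = (\<lambda>j. nat_weight m j + (if j = i then - 1 else 0))
        then (nat_weight m i :: 'k) else 0)" for m n
  proof -
    have "(nat_weight n :: 'i \<Rightarrow> 'k) = (\<lambda>j. nat_weight m j + (if j = i then - 1 else 0)) \<longleftrightarrow>
        nat_weight (n + Poly_Mapping.single i 1) = (nat_weight m :: 'i \<Rightarrow> 'k)"
      unfolding nat_weight_add_single by (auto simp: fun_eq_iff eq_diff_eq)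
    also have "\<dots> \<longleftrightarrow> n + Poly_Mapping.single i 1 = m" by (rule nat_weight_eq_iff)
    finally have iff: "(nat_weight n :: 'i \<Rightarrow> 'k) = (\<lambda>j. nat_weight m j + (if j = i then - 1 else 0)) \<longleftrightarrow>
        n + Poly_Mapping.single i 1 = m" .
    show ?thesis
      unfolding iff by (auto simp: lookup_Y_op lookup_single nat_weight_def lookup_add)
  qed
  ultimately show ?thesis by (auto simp: homog_def Y_op_in_weyl polyfun.coord)
qed

text \<open>The operator \<open>b\<close> meets the monomial after \<open>a\<close> has moved it by
  \<open>z\<close>, whence the shifted argument. If \<open>v + z + w\<close> leaves the natural
  numbers in some coordinate, either \<open>v + z\<close> has left already and \<open>f\<close>
  vanishes, or the second move leaves and \<open>g\<close> does.\<close>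

lemma homog_comp:
  assumes a: "homog z f a" and b: "homog w g b"
  shows "homog (\<lambda>i. z i + w i) (\<lambda>v. g (\<lambda>i. v i + z i) * f v) (b \<circ> a)"
  unfolding homog_def
proof (intro conjI allI impI)
  show "b \<circ> a \<in> carrier weyl" by (intro weyl_comp a[THEN homog_weyl] b[THEN homog_weyl])
  show "polyfun (\<lambda>v. g (\<lambda>i. v i + z i) * f v)"
    by (intro polyfun.mult polyfun_shift homog_polyfun[OF a] homog_polyfun[OF b])
  have "finite ({i. z i \<noteq> 0} \<union> {i. w i \<noteq> 0})"
    using homog_Z_fin[OF a] homog_Z_fin[OF b] by (simp add: Z_fin_def)
  then have "finite {i. z i + w i \<noteq> 0}" by (rule rev_finite_subset) auto
  then show "(\<lambda>i. z i + w i) \<in> Z_fin"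
    using homog_Z_fin[OF a] homog_Z_fin[OF b] by (simp add: Z_fin_def)
next
  fix v i assume "v i \<in> \<nat>" "v i + (z i + w i) \<notin> \<nat>"
  then show "g (\<lambda>i. v i + z i) * f v = 0"
    using homog_exit[OF a, of v i] homog_exit[OF b, of "\<lambda>i. v i + z i" i] by (auto simp: add.assoc)
next
  fix m n
  show "Poly_Mapping.lookup ((b \<circ> a) (Poly_Mapping.single m 1)) n =
      (if nat_weight n = (\<lambda>i. nat_weight m i + (z i + w i))
        then g (\<lambda>i. nat_weight m i + z i) * f (nat_weight m) else 0)"
  proof (cases "\<exists>k. nat_weight k = (\<lambda>i. nat_weight m i + z i)")
    case True
    then obtain k where k: "nat_weight k = (\<lambda>i. nat_weight m i + z i)" by blast
    have ki: "nat_weight m i + z i = nat_weight k i" for i using k by simp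
    show ?thesis
      by (simp add: homog_single[OF a k] homog_lookup[OF b] ki add.assoc[symmetric])
  next
    \<comment> \<open>Here \<open>a\<close> kills the monomial and \<open>f\<close> is zero at its
      exponent vector, so both sides are 0.\<close>
    case False
    then have "nat_weight k \<noteq> (\<lambda>i. nat_weight m i + z i)" for k by blast
    from homog_single_0[OF a this] show ?thesis
      using End_polD(3)[of b] homog_weyl[OF b] carrier_weyl_subset by auto
  qed
qed

lemma homog_add:
  "homog z f a \<Longrightarrow> homog z g b \<Longrightarrow> homog z (\<lambda>v. f v + g v) (\<lambda>x. a x + b x)"
  by (auto simp: homog_def weyl_add polyfun.add lookup_add)

lemma homog_t: "homog (\<lambda>_. 0) (\<lambda>v. v i) (t_op i :: ('i, 'k::field_char_0) pol_op)"
proof -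
  have "homog (\<lambda>j. (if j = i then - 1 else 0) + (if j = i then 1 else 0)) (\<lambda>v. 1 * v i) (t_op i :: ('i, 'k) pol_op)"
    unfolding t_op_def by (rule homog_comp[OF homog_Y homog_X])
  moreover have "(\<lambda>j :: 'i. (if j = i then - 1 else 0) + (if j = i then 1 else 0)) = (\<lambda>_. 0 :: 'k)"
    by auto
  ultimately show ?thesis by simp
qed

text \<open>The Weyl relation \<open>Y X = X Y + 1\<close>, in symbols.\<close>

lemma homog_YX:
  "homog (\<lambda>_. 0) (\<lambda>v. v i + 1) (Y_op i \<circ> X_op i :: ('i, 'k::field_char_0) pol_op)"
proof -
  have "homog (\<lambda>j. (if j = i then 1 else 0) + (if j = i then - 1 else 0)) (\<lambda>v. (v i + (if i = i then 1 else 0)) * 1)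
      (Y_op i \<circ> X_op i :: ('i, 'k) pol_op)"
    by (rule homog_comp[OF homog_X homog_Y])
  moreover have "(\<lambda>j :: 'i. (if j = i then 1 else 0) + (if j = i then - 1 else 0)) = (\<lambda>_. 0 :: 'k)"
    by auto
  ultimately show ?thesis by simp
qed

text \<open>Both sides have degree \<open>z\<close> and symbol \<open>(v i + z i) * f v\<close>. The
  relation means that an operator of degree \<open>z\<close> shifts weights by
  \<open>z\<close>.\<close>

lemma homog_t_comm:
  assumes "homog z f a"
  shows "t_op i \<circ> a = (\<lambda>x. (a \<circ> t_op i) x + (scal_op (z i) \<circ> a) x)"
proof (rule homog_unique)
  show "homog z (\<lambda>v. (v i + z i) * f v) (t_op i \<circ> a)"
    using homog_comp[OF assms homog_t[of i]] by simp
  have "homog z (\<lambda>v. f v * v i + z i * f v) (\<lambda>x. (a \<circ> t_op i) x + (scal_op (z i) \<circ> a) x)"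
    using homog_add[OF homog_comp[OF homog_t[of i] assms, simplified]
        homog_comp[OF assms homog_scal[of "z i"], simplified]]
    by simp
  then show "homog z (\<lambda>v. (v i + z i) * f v) (\<lambda>x. (a \<circ> t_op i) x + (scal_op (z i) \<circ> a) x)"
    by (simp add: algebra_simps)
qed

lemma scal_op_comm: "a \<in> carrier weyl \<Longrightarrow> scal_op c \<circ> a = a \<circ> scal_op c"
  using End_polD(2)[of a c] carrier_weyl_subset by (auto simp: fun_eq_iff)

section \<open>Decomposition into homogeneous components\<close>

text \<open>Summands are added one by one and degrees may repeat, which makes closure under sums and
  products a plain induction; \<open>weyl_decomposition\<close> merges equal degrees
  afterwards.\<close>

inductive homog_span :: "('i, 'k::field_char_0) pol_op \<Rightarrow> bool" where
  zero: "homog_span (\<lambda>_. 0)"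
| add: "homog z f a \<Longrightarrow> homog_span b \<Longrightarrow> homog_span (\<lambda>x. a x + b x)"

lemma homog_homog_span: "homog z f a \<Longrightarrow> homog_span a"
  using homog_span.add[OF _ homog_span.zero] by fastforce

lemma homog_span_add: "homog_span a \<Longrightarrow> homog_span b \<Longrightarrow> homog_span (\<lambda>x. a x + b x)"
proof (induction rule: homog_span.induct)
  case (add z f a c)
  then show ?case using homog_span.add[of z f a "\<lambda>x. c x + b x"] by (simp add: add.assoc)
qed simp

lemma homog_span_comp: "homog_span a \<Longrightarrow> homog_span b \<Longrightarrow> homog_span (a \<circ> b)"
proof (induction rule: homog_span.induct)
  case zero
  then show ?case by (simp add: comp_def homog_span.zero)
next
  case (add z f a c)
  have a: "a \<in> carrier End_pol" using homog_weyl[OF add.hyps(1)] carrier_weyl_subset by blast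
  have "homog_span (a \<circ> b)"
    using add.prems
  proof (induction rule: homog_span.induct)
    case zero
    then show ?case by (simp add: comp_def End_polD(3)[OF a] homog_span.zero)
  next
    case (add w g b d)
    then show ?case
      using homog_span.add[OF homog_comp[OF add.hyps(1) \<open>homog z f a\<close>] add.IH]
      by (simp add: comp_def End_polD(1)[OF a])
  qed
  then show ?case using homog_span_add[OF _ add.IH[OF add.prems]] by (simp add: comp_def)
qed

text \<open>Generators and scalars are homogeneous, and the sums of homogeneous operators are closed
  under the ring operations, negation being composition with the scalar -1.\<close>

lemma weyl_homog_span:
  assumes "a \<in> carrier weyl"
  shows "homog_span a"
  using assms unfolding carrier_weyl
proof (induction rule: generate_ring.induct)
  case one
  then show ?case using homog_homog_span[OF homog_id] by (simp only: End_pol_simps)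
next
  case (incl h)
  then show ?case by (auto intro: homog_homog_span[OF homog_X] homog_homog_span[OF homog_Y] homog_homog_span[OF homog_scal])
next
  case (a_inv h)
  have "h \<in> carrier End_pol" using a_inv(1) carrier_weyl_subset by (auto simp: carrier_weyl)
  moreover have "scal_op (- 1) \<circ> h = (\<lambda>b. - h b)"
    by (simp add: comp_def scal_op_minus_1)
  ultimately show ?case
    using homog_span_comp[OF homog_homog_span[OF homog_scal[of "- 1"]] a_inv(2)]
    by (simp add: End_pol_uminus)
next
  case (eng_add a b)
  then show ?case unfolding End_pol_simps by (intro homog_span_add)
next
  case (eng_mult a b)
  then show ?case unfolding End_pol_simps by (intro homog_span_comp)
qed

text \<open>Indexing the summands by their degrees makes these degrees distinct, as the separation
  of weights requires.\<close>

lemma weyl_decomposition: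
  assumes "a \<in> carrier weyl"
  obtains S F G where "finite S" "\<And>z. z \<in> S \<Longrightarrow> homog z (G z) (F z)" "a = (\<lambda>x. \<Sum>z\<in>S. F z x)"
proof -
  have "\<exists>S F G. finite S \<and> (\<forall>z\<in>S. homog z (G z) (F z)) \<and> a = (\<lambda>x. \<Sum>z\<in>S. F z x)"
    using weyl_homog_span[OF assms]
  proof (induction rule: homog_span.induct)
    case zero
    show ?case by (intro exI[of _ "{}"]) simp
  next
    case (add z f a b)
    then obtain S F G where S: "finite S" "\<forall>z\<in>S. homog z (G z) (F z)" "b = (\<lambda>x. \<Sum>z\<in>S. F z x)"
      by blast
    show ?case
    proof (cases "z \<in> S")
      case True
      \<comment> \<open>The degree \<open>z\<close> occurs already, so the new summand is merged
        into its component.\<close>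
      define F' where "F' = F(z := (\<lambda>x. a x + F z x))"
      have "homog z (\<lambda>v. f v + G z v) (\<lambda>x. a x + F z x)" using add.hyps(1) S(2) True by (intro homog_add) auto
      then have "\<forall>w\<in>S. homog w ((G(z := (\<lambda>v. f v + G z v))) w) (F' w)"
        using S(2) by (auto simp: F'_def)
      moreover have "(\<lambda>x. a x + b x) = (\<lambda>x. \<Sum>w\<in>S. F' w x)"
        unfolding S(3) F'_def using S(1) True by (simp add: sum.remove[of S z] add.assoc)
      ultimately show ?thesis using S(1) by blast
    next
      case False
      have "\<forall>w\<in>insert z S. homog w ((G(z := f)) w) ((F(z := a)) w)"
        using S(2) add.hyps(1) False by auto
      moreover have "(\<lambda>x. a x + b x) = (\<lambda>x. \<Sum>w\<in>insert z S. (F(z := a)) w x)"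
      proof
        fix x
        have "(\<Sum>w\<in>S. (F(z := a)) w x) = (\<Sum>w\<in>S. F w x)"
          using False by (intro sum.cong) auto
        then show "a x + b x = (\<Sum>w\<in>insert z S. (F(z := a)) w x)"
          unfolding S(3) using S(1) False by simp
      qed
      ultimately show ?thesis using S(1) by blast
    qed
  qed
  then show thesis using that by blast
qed

section \<open>The largest proper left ideal containing a given weight ideal\<close>

text \<open>
  The degree zero part of \<open>a\<close> acts on \<open>x\<^sup>m\<close> by a polynomial in \<open>m\<close>; \<open>diag_coeff p a\<close> is its value
  at \<open>p\<close>.
\<close>

definition diag_coeff :: "('i \<Rightarrow> 'k::field_char_0) \<Rightarrow> ('i, 'k) pol_op \<Rightarrow> 'k" where
  "diag_coeff p a = (THE f. polyfun f \<and>
     (\<forall>m. Poly_Mapping.lookup (a (Poly_Mapping.single m 1)) m = f (nat_weight m))) p"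

text \<open>Two polynomial functions that agree on all exponent vectors are equal, so the definite
  description picks out \<open>f\<close>.\<close>

lemma diag_coeff_eqI:
  assumes "polyfun f"
    and "\<And>m. Poly_Mapping.lookup (a (Poly_Mapping.single m 1)) m = f (nat_weight m)"
  shows "diag_coeff p a = f p"
proof -
  have "(THE f. polyfun f \<and>
      (\<forall>m. Poly_Mapping.lookup (a (Poly_Mapping.single m 1)) m = f (nat_weight m))) = f"
  proof (rule the_equality)
    fix g assume g: "polyfun g \<and>
      (\<forall>m. Poly_Mapping.lookup (a (Poly_Mapping.single m 1)) m = g (nat_weight m))"
    have "g (nat_weight m) - f (nat_weight m) = 0" for m
      unfolding assms(2)[of m, symmetric] conjunct2[OF g, THEN spec, of m, symmetric] by simp
    then have "g v - f v = 0" for v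
      using polyfun_eq_0[OF polyfun_diff[OF conjunct1[OF g] assms(1)]] by blast
    then show "g = f" by auto
  qed (use assms in blast)
  then show ?thesis by (simp add: diag_coeff_def)
qed

lemma homog_diag:
  assumes "homog z f a"
  shows "Poly_Mapping.lookup (a (Poly_Mapping.single m 1)) m = (if z = (\<lambda>_. 0) then f else (\<lambda>_. 0)) (nat_weight m)"
  by (auto simp: homog_lookup[OF assms] fun_eq_iff)

lemma diag_coeff_homog:
  assumes "homog z f a"
  shows "diag_coeff p a = (if z = (\<lambda>_. 0) then f p else 0)"
proof -
  have "polyfun (if z = (\<lambda>_. 0) then f else (\<lambda>_. 0))"
    using homog_polyfun[OF assms] by (simp add: polyfun.const)
  from diag_coeff_eqI[OF this homog_diag[OF assms]] show ?thesis by simp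
qed

text \<open>Only summands of degree zero reach the diagonal, where they contribute their
  symbol.\<close>

lemma ex_diag:
  fixes a :: "('i, 'k::field_char_0) pol_op"
  assumes "a \<in> carrier weyl"
  shows "\<exists>f. polyfun f \<and> (\<forall>m. Poly_Mapping.lookup (a (Poly_Mapping.single m 1)) m = f (nat_weight m))"
  using weyl_homog_span[OF assms]
proof (induction rule: homog_span.induct)
  case zero
  show ?case by (intro exI[of _ "\<lambda>_. 0"]) (simp add: polyfun.const)
next
  case (add z f a b)
  then obtain g where g: "polyfun g"
    "\<And>m. Poly_Mapping.lookup (b (Poly_Mapping.single m 1)) m = g (nat_weight m)" by blast
  have "polyfun (if z = (\<lambda>_. 0) then f else (\<lambda>_. 0))"
    using homog_polyfun[OF add.hyps(1)] by (simp add: polyfun.const)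
  from polyfun.add[OF this g(1)] show ?case
    using homog_diag[OF add.hyps(1)] g(2) by (intro exI conjI) (auto simp: lookup_add)
qed

lemma diag_coeff_add:
  assumes "a \<in> carrier weyl" "b \<in> carrier weyl"
  shows "diag_coeff p (\<lambda>x. a x + b x) = diag_coeff p a + diag_coeff p b"
proof -
  obtain f where f: "polyfun f"
    "\<And>m. Poly_Mapping.lookup (a (Poly_Mapping.single m 1)) m = f (nat_weight m)"
    using ex_diag[OF assms(1)] by blast
  obtain g where g: "polyfun g"
    "\<And>m. Poly_Mapping.lookup (b (Poly_Mapping.single m 1)) m = g (nat_weight m)"
    using ex_diag[OF assms(2)] by blast
  have "diag_coeff p (\<lambda>x. a x + b x) = f p + g p"
    by (rule diag_coeff_eqI[OF polyfun.add[OF f(1) g(1)]]) (simp add: lookup_add f g)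
  moreover have "diag_coeff p a = f p" by (rule diag_coeff_eqI) (use f in auto)
  moreover have "diag_coeff p b = g p" by (rule diag_coeff_eqI) (use g in auto)
  ultimately show ?thesis by simp
qed

lemma diag_coeff_zero [simp]: "diag_coeff p (\<lambda>_. 0) = 0"
  by (rule diag_coeff_eqI[OF polyfun.const]) simp

lemma diag_coeff_sum:
  assumes "finite S" "\<And>z. z \<in> S \<Longrightarrow> F z \<in> carrier weyl"
  shows "diag_coeff p (\<lambda>x. \<Sum>z\<in>S. F z x) = (\<Sum>z\<in>S. diag_coeff p (F z))
    \<and> (\<lambda>x. \<Sum>z\<in>S. F z x) \<in> carrier weyl"
  using assms
proof (induction S)
  case empty
  then show ?case by (simp add: weyl_zero)
next
  case (insert z S)
  then show ?case by (simp add: diag_coeff_add weyl_add)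
qed

text \<open>On \<open>x^m\<close> the operator \<open>a\<close> acts first, as the scalar
  \<open>f (nat_weight m)\<close>, so diagonal entries multiply even when \<open>b\<close> is not
  homogeneous. If \<open>f p = 0\<close>, the form kills every left multiple of
  \<open>a\<close>.\<close>

lemma diag_coeff_comp:
  assumes "b \<in> carrier weyl" "homog (\<lambda>_. 0) f a"
  shows "diag_coeff p (b \<circ> a) = diag_coeff p b * f p"
proof -
  obtain g where g: "polyfun g"
    "\<And>m. Poly_Mapping.lookup (b (Poly_Mapping.single m 1)) m = g (nat_weight m)"
    using ex_diag[OF assms(1)] by blast
  have b: "b \<in> carrier End_pol" using assms(1) carrier_weyl_subset by blast
  have "diag_coeff p (b \<circ> a) = g p * f p"
  proof (rule diag_coeff_eqI[OF polyfun.mult[OF g(1) homog_polyfun[OF assms(2)]]])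
    fix m
    have "a (Poly_Mapping.single m 1) = Poly_Mapping.single m (f (nat_weight m))"
      using homog_single[OF assms(2), of m m 1] by simp
    then show "Poly_Mapping.lookup ((b \<circ> a) (Poly_Mapping.single m 1)) m =
        g (nat_weight m) * f (nat_weight m)"
      using End_pol_single[OF b, of m "f (nat_weight m)"] g(2)[of m] by (simp add: lookup_scal_op)
  qed
  moreover have "diag_coeff p b = g p" by (rule diag_coeff_eqI) (use g in auto)
  ultimately show ?thesis by simp
qed

section \<open>Left ideals of the Weyl algebra\<close>

lemma regular_weyl_simps [simp]:
  "carrier (regular_module weyl) = carrier weyl" "\<zero>\<^bsub>regular_module weyl\<^esub> = (\<lambda>_. 0)"
  "(\<oplus>\<^bsub>regular_module weyl\<^esub>) = (\<lambda>f g b. f b + g b)" "(\<odot>\<^bsub>regular_module weyl\<^esub>) = (\<circ>)"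
  by (simp_all add: regular_module_def)

lemma regular_weyl_minus:
  assumes "a \<in> carrier weyl" "b \<in> carrier weyl"
  shows "a \<ominus>\<^bsub>regular_module weyl\<^esub> b = (\<lambda>x. a x - b x)"
proof -
  interpret left_module weyl "regular_module weyl" by (rule left_module_regular[OF ring_weyl])
  have "\<ominus>\<^bsub>regular_module weyl\<^esub> b = (\<lambda>x. - b x)"
    using assms R.a_inv_closed[OF assms(2)] by (intro M.minus_equality) (auto simp: weyl_uminus)
  then show ?thesis by (simp add: a_minus_def)
qed

lemma left_idealD:
  assumes "submodule K weyl (regular_module weyl)"
  shows "K \<subseteq> carrier weyl" "(\<lambda>_. 0) \<in> K"
    and "\<And>a b. a \<in> K \<Longrightarrow> b \<in> K \<Longrightarrow> (\<lambda>x. a x + b x) \<in> K"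
    and "\<And>a b. a \<in> K \<Longrightarrow> b \<in> K \<Longrightarrow> (\<lambda>x. a x - b x) \<in> K"
    and "\<And>a b. a \<in> carrier weyl \<Longrightarrow> b \<in> K \<Longrightarrow> a \<circ> b \<in> K"
proof -
  interpret left_module weyl "regular_module weyl" by (rule left_module_regular[OF ring_weyl])
  note E = submoduleE[OF assms, simplified]
  show "K \<subseteq> carrier weyl" "(\<lambda>_. 0) \<in> K" by (fact E)+
  show "\<And>a b. a \<in> K \<Longrightarrow> b \<in> K \<Longrightarrow> (\<lambda>x. a x + b x) \<in> K" by (fact E(3))
  show "\<And>a b. a \<in> carrier weyl \<Longrightarrow> b \<in> K \<Longrightarrow> a \<circ> b \<in> K" by (fact E(4))
  show "(\<lambda>x. a x - b x) \<in> K" if "a \<in> K" "b \<in> K" for a b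
  proof -
    have "a \<in> carrier weyl" "b \<in> carrier weyl" using that E(1) by auto
    then show ?thesis using E(6)[OF that] by (simp add: regular_weyl_minus)
  qed
qed

lemma left_idealI:
  assumes "K \<subseteq> carrier weyl" "(\<lambda>_. 0) \<in> K"
    and "\<And>a b. a \<in> K \<Longrightarrow> b \<in> K \<Longrightarrow> (\<lambda>x. a x + b x) \<in> K"
    and "\<And>a b. a \<in> carrier weyl \<Longrightarrow> b \<in> K \<Longrightarrow> a \<circ> b \<in> K"
  shows "submodule K weyl (regular_module weyl)"
proof -
  interpret left_module weyl "regular_module weyl" by (rule left_module_regular[OF ring_weyl])
  show ?thesis by (rule submoduleI) (use assms in simp_all)
qed

section \<open>The weight ideal and the largest left ideal in the kernel of the diagonal
  form\<close>

text \<open>The left ideal \<open>J\<close> of the overview, so that \<open>P_module p\<close> is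
  the regular module modulo \<open>weight_ideal p\<close>.\<close>

definition weight_ideal :: "('i \<Rightarrow> 'k::field) \<Rightarrow> ('i, 'k) pol_op set" where
  "weight_ideal p = generated_submodule weyl (regular_module weyl) (m_ideal p)"

text \<open>The left ideal \<open>I\<close> of the overview: testing all left multiples of
  \<open>a\<close> cuts the kernel of the linear form down to its largest left ideal.\<close>

definition max_weight_ideal :: "('i \<Rightarrow> 'k::field_char_0) \<Rightarrow> ('i, 'k) pol_op set" where
  "max_weight_ideal p = {a \<in> carrier weyl. \<forall>b\<in>carrier weyl. diag_coeff p (b \<circ> a) = 0}"

lemma weight_ideal_subset:
  "submodule K weyl (regular_module weyl) \<Longrightarrow> m_ideal p \<subseteq> K \<Longrightarrow> weight_ideal p \<subseteq> K"
  unfolding weight_ideal_def generated_submodule_def by blast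

lemma m_ideal_subset_weyl0: "m_ideal p \<subseteq> carrier weyl0"
proof -
  have "range (\<lambda>i. t_op i \<ominus>\<^bsub>weyl0\<^esub> scal_op (p i)) \<subseteq> carrier weyl0"
    by (rule image_subsetI) (rule ring.ring_simprules(4)[OF ring_weyl0 t_op_in_weyl0 scal_op_in_weyl0])
  from ring.genideal_ideal[OF ring_weyl0 this] have I: "ideal (m_ideal p) weyl0"
    unfolding m_ideal_def .
  show ?thesis by (rule subsetI) (rule ideal.Icarr[OF I])
qed

lemma left_ideal_weight_ideal: "submodule (weight_ideal p) weyl (regular_module weyl)"
proof -
  interpret left_module weyl "regular_module weyl" by (rule left_module_regular[OF ring_weyl])
  let ?N = "{N. submodule N weyl (regular_module weyl) \<and> m_ideal p \<subseteq> N}"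
  \<comment> \<open>The intersected family is not empty, so the intersection stays inside the
    algebra.\<close>
  have "carrier weyl \<in> ?N"
    using carrier_submodule m_ideal_subset_weyl0 carrier_weyl0_subset by auto
  moreover have "(\<lambda>x. a x + b x) \<in> \<Inter>?N" if "a \<in> \<Inter>?N" "b \<in> \<Inter>?N" for a b
    using that by (intro InterI) (auto intro!: left_idealD(3))
  moreover have "a \<circ> b \<in> \<Inter>?N" if "a \<in> carrier weyl" "b \<in> \<Inter>?N" for a b
    using that by (intro InterI) (auto intro!: left_idealD(5))
  ultimately show ?thesis
    unfolding weight_ideal_def generated_submodule_def
    by (intro left_idealI) (auto intro: left_idealD(2))
qed

lemma weight_ideal_t:
  fixes p :: "'i \<Rightarrow> 'k::field"
  shows "(\<lambda>x. t_op i x - scal_op (p i) x) \<in> weight_ideal p"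
proof -
  have "range (\<lambda>i. t_op i \<ominus>\<^bsub>weyl0\<^esub> scal_op (p i)) \<subseteq> carrier weyl0"
    by (rule image_subsetI) (rule ring.ring_simprules(4)[OF ring_weyl0 t_op_in_weyl0 scal_op_in_weyl0])
  from ring.genideal_self[OF ring_weyl0 this]
  have "t_op i \<ominus>\<^bsub>weyl0\<^esub> scal_op (p i) \<in> m_ideal p" by (auto simp: m_ideal_def)
  then show ?thesis
    unfolding weight_ideal_def generated_submodule_def
    by (auto simp: weyl_minus t_op_in_weyl0 scal_op_in_weyl0)
qed

text \<open>The generators of \<open>weyl0\<close> have degree zero, and sums and products keep it.
  Through \<open>homog_unique\<close> this yields that \<open>weyl0\<close> is commutative.\<close>

lemma weyl0_homog:
  fixes a :: "('i, 'k::field_char_0) pol_op"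
  assumes "a \<in> carrier weyl0"
  shows "\<exists>f. homog (\<lambda>_. 0) f a"
  using assms unfolding carrier_weyl0
proof (induction rule: generate_ring.induct)
  case one
  show ?case unfolding End_pol_simps using homog_id by blast
next
  case (incl h)
  then consider i where "h = t_op i" | c where "h = scal_op c" by blast
  then show ?case
  proof cases
    case (1 i)
    show ?thesis unfolding 1 by (rule exI) (rule homog_t)
  next
    case (2 c)
    show ?thesis unfolding 2 by (rule exI) (rule homog_scal)
  qed
next
  case (a_inv h)
  then obtain f where f: "homog (\<lambda>_. 0) f h" by blast
  have "scal_op (- 1) \<circ> h = (\<lambda>b. - h b)"
    by (simp add: comp_def scal_op_minus_1)
  then show ?case
    using homog_comp[OF f homog_scal[of "- 1"]]
      End_pol_uminus[OF subsetD[OF carrier_weyl_subset homog_weyl[OF f]]]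
    by auto
next
  case (eng_add a b)
  then show ?case using homog_add by fastforce
next
  case (eng_mult a b)
  then obtain f g where fg: "homog (\<lambda>_. 0) f a" "homog (\<lambda>_. 0) g b" by blast
  have "homog (\<lambda>_. 0) (\<lambda>v. f v * g v) (a \<circ> b)" using homog_comp[OF fg(2,1)] by simp
  then show ?case unfolding End_pol_simps by (intro exI[of _ "\<lambda>v. f v * g v"])
qed

lemma left_ideal_max_weight_ideal:
  fixes p :: "'i \<Rightarrow> 'k::field_char_0"
  shows "submodule (max_weight_ideal p) weyl (regular_module weyl)"
proof (rule left_idealI)
  have "b \<circ> (\<lambda>_. 0) = (\<lambda>_ :: ('i, 'k) pol. 0)" if "b \<in> carrier weyl" for b :: "('i, 'k) pol_op"
    using End_polD(3)[OF subsetD[OF carrier_weyl_subset that]] by auto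
  then show "(\<lambda>_. 0) \<in> max_weight_ideal p"
    unfolding max_weight_ideal_def by (simp add: weyl_zero)
next
  fix a b :: "('i, 'k) pol_op" assume ab: "a \<in> max_weight_ideal p" "b \<in> max_weight_ideal p"
  have "diag_coeff p (c \<circ> (\<lambda>x. a x + b x)) = 0" if c: "c \<in> carrier weyl" for c
  proof -
    have "c \<circ> (\<lambda>x. a x + b x) = (\<lambda>x. (c \<circ> a) x + (c \<circ> b) x)"
      by (rule ext) (simp add: End_polD(1)[OF subsetD[OF carrier_weyl_subset c]])
    then show ?thesis
      using ab c diag_coeff_add[of "c \<circ> a" "c \<circ> b" p] by (simp add: max_weight_ideal_def weyl_comp)
  qed
  then show "(\<lambda>x. a x + b x) \<in> max_weight_ideal p"
    using ab by (simp add: max_weight_ideal_def weyl_add)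
next
  fix a b :: "('i, 'k) pol_op" assume "a \<in> carrier weyl" "b \<in> max_weight_ideal p"
  then show "a \<circ> b \<in> max_weight_ideal p"
    by (auto simp: max_weight_ideal_def weyl_comp simp flip: comp_assoc)
qed (auto simp: max_weight_ideal_def)

text \<open>\<open>m_ideal p\<close> is generated as a two-sided ideal of \<open>weyl0\<close>, so
  it is caught inside a two-sided ideal, the intersection of \<open>N\<close> with
  \<open>weyl0\<close>. Right multiples are left multiples there because \<open>weyl0\<close> is
  commutative.\<close>

lemma weight_ideal_subsetI:
  fixes p :: "'i \<Rightarrow> 'k::field_char_0"
  assumes N: "submodule N weyl (regular_module weyl)"
    and gens: "\<And>i. (\<lambda>x. t_op i x - scal_op (p i) x) \<in> N"
  shows "weight_ideal p \<subseteq> N"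
proof (rule weight_ideal_subset[OF N])
  note ND = left_idealD[OF N]
  let ?K = "N \<inter> carrier weyl0"
  have left: "b \<circ> a \<in> ?K" if "a \<in> ?K" "b \<in> carrier weyl0" for a b
    using that ND(5)[of b a] carrier_weyl0_subset ring.ring_simprules(5)[OF ring_weyl0, of b a] by auto
  have right: "a \<circ> b \<in> ?K" if ab: "a \<in> ?K" "b \<in> carrier weyl0" for a b
  proof -
    obtain f where f: "homog (\<lambda>_. 0) f a" using weyl0_homog ab(1) by blast
    obtain g where g: "homog (\<lambda>_. 0) g b" using weyl0_homog[OF ab(2)] by blast
    have "homog (\<lambda>_. 0) (\<lambda>v. f v * g v) (a \<circ> b)" "homog (\<lambda>_. 0) (\<lambda>v. f v * g v) (b \<circ> a)"
      using homog_comp[OF g f] homog_comp[OF f g] by (simp_all add: mult.commute)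
    then have "a \<circ> b = b \<circ> a" by (rule homog_unique)
    then show ?thesis using left[OF ab] by simp
  qed
  have "\<zero>\<^bsub>weyl0\<^esub> \<in> carrier weyl0" by (rule ring.ring_simprules(2)[OF ring_weyl0])
  then have zero: "(\<lambda>_. 0) \<in> ?K" using ND(2) by simp
  have add: "(\<lambda>x. a x + b x) \<in> ?K" if "a \<in> ?K" "b \<in> ?K" for a b
    using that ND(3)[of a b] ring.ring_simprules(1)[OF ring_weyl0, of a b] by simp
  have neg: "(\<lambda>x. - a x) \<in> ?K" if "a \<in> ?K" for a
    using that ND(4)[OF ND(2), of a] ring.ring_simprules(3)[OF ring_weyl0, of a] weyl0_uminus[of a] by simp
  have "subgroup ?K (add_monoid weyl0)"
  proof (rule subgroup.intro)
    show "inv\<^bsub>add_monoid weyl0\<^esub> a \<in> ?K" if "a \<in> ?K" for a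
      using neg[OF that] weyl0_uminus[of a] that unfolding a_inv_def by simp
  qed (use zero add in auto)
  then have "ideal ?K weyl0"
    by (rule idealI[OF ring_weyl0]) (use left right in simp_all)
  moreover have "t_op i \<ominus>\<^bsub>weyl0\<^esub> scal_op (p i) \<in> ?K" for i
    using gens[of i] ring.ring_simprules(4)[OF ring_weyl0 t_op_in_weyl0 scal_op_in_weyl0]
    by (simp add: weyl_minus(2)[OF t_op_in_weyl0 scal_op_in_weyl0])
  ultimately have "m_ideal p \<subseteq> ?K"
    unfolding m_ideal_def by (intro ring.genideal_minimal[OF ring_weyl0]) auto
  then show "m_ideal p \<subseteq> N" by simp
qed

text \<open>The generators have symbol \<open>v i - p i\<close>, which vanishes at
  \<open>p\<close>.\<close>

lemma weight_ideal_subset_max: "weight_ideal p \<subseteq> max_weight_ideal p"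
proof (rule weight_ideal_subsetI[OF left_ideal_max_weight_ideal])
  fix i
  have "homog (\<lambda>_. 0) (\<lambda>v. v i + - p i) (\<lambda>x. t_op i x + scal_op (- p i) x)"
    by (rule homog_add[OF homog_t homog_scal])
  moreover have "(\<lambda>x. t_op i x + scal_op (- p i) x) = (\<lambda>x. t_op i x - scal_op (p i) x)"
    by (rule ext) (simp add: scal_op_def single_uminus)
  ultimately have h: "homog (\<lambda>_. 0) (\<lambda>v. v i + - p i) (\<lambda>x. t_op i x - scal_op (p i) x)" by simp
  show "(\<lambda>x. t_op i x - scal_op (p i) x) \<in> max_weight_ideal p"
    using homog_weyl[OF h] by (simp add: max_weight_ideal_def diag_coeff_comp[OF _ h])
qed

text \<open>Modulo the weight ideal each \<open>t_op i\<close> may be replaced by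
  \<open>p i\<close>, hence a polynomial in the \<open>t_op i\<close> by its value at
  \<open>p\<close>.\<close>

lemma homog_degree_0_cong:
  fixes p :: "'i \<Rightarrow> 'k::field_char_0"
  assumes "homog (\<lambda>_. 0) f a"
  shows "(\<lambda>x. a x - scal_op (f p) x) \<in> weight_ideal p"
proof -
  note I = left_idealD[OF left_ideal_weight_ideal[of p]]
  \<comment> \<open>Induction on the symbol builds some operator with that symbol; by
    \<open>homog_unique\<close> it is the given one.\<close>
  have "\<exists>a. homog (\<lambda>_. 0) f a \<and> (\<lambda>x. a x - scal_op (f p) x) \<in> weight_ideal p"
    using homog_polyfun[OF assms]
  proof (induction rule: polyfun.induct)
    case (const c)
    show ?case using homog_scal[of c] I(2) by (intro exI[of _ "scal_op c"]) simp
  next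
    case (coord i)
    show ?case by (intro exI[of _ "t_op i"] conjI homog_t weight_ideal_t)
  next
    case (add f g)
    then obtain a b where a: "homog (\<lambda>_. 0) f a" "(\<lambda>x. a x - scal_op (f p) x) \<in> weight_ideal p"
      and b: "homog (\<lambda>_. 0) g b" "(\<lambda>x. b x - scal_op (g p) x) \<in> weight_ideal p" by blast
    have "(\<lambda>x. (a x + b x) - scal_op (f p + g p) x) =
        (\<lambda>x. (a x - scal_op (f p) x) + (b x - scal_op (g p) x))"
      by (auto simp: scal_op_def single_add algebra_simps)
    then show ?case using homog_add[OF a(1) b(1)] I(3)[OF a(2) b(2)] by auto
  next
    case (mult f g)
    then obtain a b where a: "homog (\<lambda>_. 0) f a" "(\<lambda>x. a x - scal_op (f p) x) \<in> weight_ideal p"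
      and b: "homog (\<lambda>_. 0) g b" "(\<lambda>x. b x - scal_op (g p) x) \<in> weight_ideal p" by blast
    have aw: "a \<in> carrier weyl" "a \<in> carrier End_pol"
      using homog_weyl[OF a(1)] carrier_weyl_subset by auto
    \<comment> \<open>The splitting \<open>a b - f g = a (b - g) + g (a - f)\<close>, in which both
      summands are left multiples of members of the ideal.\<close>
    have "(a \<circ> b) x - scal_op (f p * g p) x =
        (a \<circ> (\<lambda>x. b x - scal_op (g p) x)) x + (scal_op (g p) \<circ> (\<lambda>x. a x - scal_op (f p) x)) x" for x
    proof -
      have "a (b x - scal_op (g p) x) = a (b x) - scal_op (g p) (a x)"
        by (simp add: End_pol_diff[OF aw(2)] End_polD(2)[OF aw(2)])
      moreover have "scal_op (g p) (a x - scal_op (f p) x) = scal_op (g p) (a x) - scal_op (f p * g p) x"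
        by (simp add: End_pol_diff[OF scal_op_in_End_pol] scal_op_scal_op mult.commute[of "g p"])
      ultimately show ?thesis by simp
    qed
    then have "(\<lambda>x. (a \<circ> b) x - scal_op (f p * g p) x) \<in> weight_ideal p"
      using I(3)[OF I(5)[OF aw(1) b(2)] I(5)[OF scal_op_in_weyl a(2)]] by simp
    moreover have "homog (\<lambda>_. 0) (\<lambda>v. f v * g v) (a \<circ> b)"
      using homog_comp[OF b(1) a(1)] by simp
    ultimately show ?case by blast
  qed
  then show ?thesis using homog_unique[OF assms] by blast
qed

section \<open>Separation of weights\<close>

text \<open>Applying \<open>t_op i - wt r i\<close> removes the summand \<open>x r\<close> up to an
  element of \<open>N\<close> and rescales the others, so that induction applies to the rest.
  Working modulo an arbitrary submodule serves left ideals of the algebra and, with \<open>N\<close>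
  zero, sums of weight spaces.\<close>

lemma weight_separation:
  fixes M :: "(('i, 'k::field_char_0) pol_op, 'm) module" and wt :: "'s \<Rightarrow> 'i \<Rightarrow> 'k"
  assumes M: "left_module weyl M" and N: "submodule N weyl M"
    and "finite S" "inj_on wt S" "\<And>s. s \<in> S \<Longrightarrow> x s \<in> carrier M"
    and "\<And>s i. s \<in> S \<Longrightarrow> t_op i \<odot>\<^bsub>M\<^esub> x s \<ominus>\<^bsub>M\<^esub> scal_op (wt s i) \<odot>\<^bsub>M\<^esub> x s \<in> N"
    and "(\<Oplus>\<^bsub>M\<^esub>s\<in>S. x s) \<in> N" "s \<in> S"
  shows "x s \<in> N"
  using assms(3-)
proof (induction S arbitrary: x s)
  case empty
  then show ?case by simp
next
  case (insert r T)
  interpret left_module weyl M by fact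
  note NE = submoduleE[OF N]
  have xM: "x \<in> insert r T \<rightarrow> carrier M" "x r \<in> carrier M" "x \<in> T \<rightarrow> carrier M" using insert.prems by auto
  have T: "x q \<in> N" if q: "q \<in> T" for q
  proof -
    have "wt q \<noteq> wt r" using insert q by (auto simp: inj_on_def)
    then obtain i where i: "wt q i \<noteq> wt r i" by auto
    define c where "c = t_op i \<ominus>\<^bsub>weyl\<^esub> scal_op (wt r i)"
    have c: "c \<in> carrier weyl" unfolding c_def by (simp add: t_op_in_weyl scal_op_in_weyl)
    \<comment> \<open>\<open>y u\<close> is what \<open>c\<close> makes of \<open>x u\<close>, up to
      the error term \<open>d u\<close> in \<open>N\<close>; it vanishes for
      \<open>u = r\<close>.\<close>
    define y where "y = (\<lambda>u. scal_op (wt u i - wt r i) \<odot>\<^bsub>M\<^esub> x u)"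
    have yM: "y \<in> insert r T \<rightarrow> carrier M" using xM by (auto simp: y_def scal_op_in_weyl)
    have scal_diff: "scal_op (d - e) = scal_op d \<ominus>\<^bsub>weyl\<^esub> scal_op e" for d e :: 'k
      unfolding weyl_minus(1)[OF scal_op_in_weyl scal_op_in_weyl]
      by (rule ext) (simp add: scal_op_def single_diff left_diff_distrib)
    define d where "d = (\<lambda>u. t_op i \<odot>\<^bsub>M\<^esub> x u \<ominus>\<^bsub>M\<^esub> scal_op (wt u i) \<odot>\<^bsub>M\<^esub> x u)"
    have dN: "d u \<in> N" if "u \<in> insert r T" for u
      unfolding d_def using insert.prems(3)[OF that] .
    have dM: "d \<in> insert r T \<rightarrow> carrier M" using dN NE(1) by auto
    have cx: "c \<odot>\<^bsub>M\<^esub> x u = d u \<oplus>\<^bsub>M\<^esub> y u" if "u \<in> insert r T" for u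
    proof -
      have u: "x u \<in> carrier M" using xM(1) that by auto
      have *: "A \<ominus>\<^bsub>M\<^esub> C = (A \<ominus>\<^bsub>M\<^esub> B) \<oplus>\<^bsub>M\<^esub> (B \<ominus>\<^bsub>M\<^esub> C)"
        if "A \<in> carrier M" "B \<in> carrier M" "C \<in> carrier M" for A B C
        using that by (simp add: a_minus_def M.a_assoc M.r_neg1)
      have "c \<odot>\<^bsub>M\<^esub> x u = t_op i \<odot>\<^bsub>M\<^esub> x u \<ominus>\<^bsub>M\<^esub> scal_op (wt r i) \<odot>\<^bsub>M\<^esub> x u"
        unfolding c_def by (rule smult_l_diff[OF t_op_in_weyl scal_op_in_weyl u])
      moreover have "y u = scal_op (wt u i) \<odot>\<^bsub>M\<^esub> x u \<ominus>\<^bsub>M\<^esub> scal_op (wt r i) \<odot>\<^bsub>M\<^esub> x u"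
        unfolding y_def scal_diff by (rule smult_l_diff[OF scal_op_in_weyl scal_op_in_weyl u])
      ultimately show ?thesis
        unfolding d_def using u by (simp only:) (intro * smult_closed t_op_in_weyl scal_op_in_weyl)
    qed
    have "c \<odot>\<^bsub>M\<^esub> (\<Oplus>\<^bsub>M\<^esub>u\<in>insert r T. x u) = (\<Oplus>\<^bsub>M\<^esub>u\<in>insert r T. c \<odot>\<^bsub>M\<^esub> x u)"
      by (rule smult_finsum) (use insert.hyps c xM in auto)
    also have "\<dots> = (\<Oplus>\<^bsub>M\<^esub>u\<in>insert r T. d u \<oplus>\<^bsub>M\<^esub> y u)"
      by (rule M.finsum_cong') (use cx dM yM in auto)
    also have "\<dots> = (\<Oplus>\<^bsub>M\<^esub>u\<in>insert r T. d u) \<oplus>\<^bsub>M\<^esub> (\<Oplus>\<^bsub>M\<^esub>u\<in>insert r T. y u)"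
      by (rule M.finsum_addf) (use dM yM in auto)
    finally have "(\<Oplus>\<^bsub>M\<^esub>u\<in>insert r T. d u) \<oplus>\<^bsub>M\<^esub> (\<Oplus>\<^bsub>M\<^esub>u\<in>insert r T. y u) \<in> N"
      using NE(4)[OF c insert.prems(4)] by simp
    moreover have "(\<Oplus>\<^bsub>M\<^esub>u\<in>insert r T. d u) \<in> N"
      by (rule submodule_finsum[OF N]) (use insert.hyps dN in auto)
    ultimately have sum_y: "(\<Oplus>\<^bsub>M\<^esub>u\<in>insert r T. y u) \<in> N"
      using submodule_cancel[OF N _ M.finsum_closed[OF yM]] by blast
    have "scal_op 0 = (\<zero>\<^bsub>weyl\<^esub> :: ('i, 'k) pol_op)" by (simp add: scal_op_def)
    then have "y r = \<zero>\<^bsub>M\<^esub>" unfolding y_def using smult_l_null[OF xM(2)] by simp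
    then have "(\<Oplus>\<^bsub>M\<^esub>u\<in>T. y u) \<in> N"
      using sum_y insert.hyps yM by simp
    have "y q \<in> N"
    proof (rule insert.IH[of y])
      show "(\<Oplus>\<^bsub>M\<^esub>u\<in>T. y u) \<in> N" by fact
      show "inj_on wt T" using insert.prems(1) by (simp add: inj_on_insert)
      show "y u \<in> carrier M" if "u \<in> T" for u using yM that by auto
      \<comment> \<open>Scalars commute with \<open>t_op j\<close>, so rescaling preserves the
        weight modulo \<open>N\<close>.\<close>
      show "t_op j \<odot>\<^bsub>M\<^esub> y u \<ominus>\<^bsub>M\<^esub> scal_op (wt u j) \<odot>\<^bsub>M\<^esub> y u \<in> N" if u: "u \<in> T" for u j
      proof -
        have xu: "x u \<in> carrier M" using xM u by auto
        let ?s = "scal_op (wt u i - wt r i) :: ('i, 'k) pol_op"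
        have "t_op j \<odot>\<^bsub>M\<^esub> y u \<ominus>\<^bsub>M\<^esub> scal_op (wt u j) \<odot>\<^bsub>M\<^esub> y u =
            ((t_op j \<ominus>\<^bsub>weyl\<^esub> scal_op (wt u j)) \<otimes>\<^bsub>weyl\<^esub> ?s) \<odot>\<^bsub>M\<^esub> x u"
          unfolding y_def using xu
          by (simp add: smult_l_diff smult_assoc1 t_op_in_weyl scal_op_in_weyl del: weyl_simps)
        also have "(t_op j \<ominus>\<^bsub>weyl\<^esub> scal_op (wt u j)) \<otimes>\<^bsub>weyl\<^esub> ?s =
            ?s \<otimes>\<^bsub>weyl\<^esub> (t_op j \<ominus>\<^bsub>weyl\<^esub> scal_op (wt u j))"
          using scal_op_comm[OF R.minus_closed[OF t_op_in_weyl scal_op_in_weyl], symmetric] by simp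
        also have "\<dots> \<odot>\<^bsub>M\<^esub> x u = ?s \<odot>\<^bsub>M\<^esub> (t_op j \<odot>\<^bsub>M\<^esub> x u \<ominus>\<^bsub>M\<^esub> scal_op (wt u j) \<odot>\<^bsub>M\<^esub> x u)"
          using xu
          by (simp add: smult_l_diff smult_assoc1 t_op_in_weyl scal_op_in_weyl del: weyl_simps)
        also have "\<dots> \<in> N"
          using NE(4) scal_op_in_weyl insert.prems(3)[of u] u by blast
        finally show ?thesis .
      qed
    qed (use q in auto)
    \<comment> \<open>The factor \<open>wt q i - wt r i\<close> is nonzero by the choice of
      \<open>i\<close> and can be divided out.\<close>
    then have "scal_op (inverse (wt q i - wt r i)) \<odot>\<^bsub>M\<^esub> y q \<in> N"
      using NE(4) scal_op_in_weyl by blast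
    moreover have "scal_op (inverse (wt q i - wt r i)) \<otimes>\<^bsub>weyl\<^esub> scal_op (wt q i - wt r i) = (\<one>\<^bsub>weyl\<^esub> :: ('i, 'k) pol_op)"
      using i by (simp add: comp_def scal_op_scal_op scal_op_1 id_def)
    ultimately show "x q \<in> N"
      unfolding y_def using xM(3) q
      by (simp add: scal_op_in_weyl Pi_iff smult_assoc1[symmetric] del: weyl_simps)
  qed
  have "(\<Oplus>\<^bsub>M\<^esub>u\<in>T. x u) \<in> N"
    by (rule submodule_finsum[OF N]) (use insert.hyps T in auto)
  moreover have "(\<Oplus>\<^bsub>M\<^esub>u\<in>T. x u) \<oplus>\<^bsub>M\<^esub> x r \<in> N"
    using insert.prems(4) insert.hyps xM by (simp add: M.a_comm)
  ultimately have "x r \<in> N" using submodule_cancel[OF N _ xM(2)] by blast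
  then show ?case using T insert.prems(5) by blast
qed

lemma finsum_regular_weyl:
  assumes "finite S" "\<And>s. s \<in> S \<Longrightarrow> F s \<in> carrier weyl"
  shows "(\<Oplus>\<^bsub>regular_module weyl\<^esub>s\<in>S. F s) = (\<lambda>x. \<Sum>s\<in>S. F s x)"
  using assms
proof (induction S)
  case empty
  interpret left_module weyl "regular_module weyl" by (rule left_module_regular[OF ring_weyl])
  show ?case by simp
next
  case (insert s S)
  interpret left_module weyl "regular_module weyl" by (rule left_module_regular[OF ring_weyl])
  have "F \<in> S \<rightarrow> carrier (regular_module weyl)" "F s \<in> carrier (regular_module weyl)" using insert.prems by auto
  then show ?case using insert by simp
qed

text \<open>Moving \<open>a\<close> past \<open>t_op i\<close> in the left multiple
  \<open>a (t_op i - p i)\<close> shows that the class of \<open>a\<close> in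
  \<open>P_module p\<close> has weight \<open>p + z\<close>.\<close>

lemma homog_weight_ideal:
  assumes "homog z f a"
  shows "(\<lambda>x. (t_op i \<circ> a) x - (scal_op (p i + z i) \<circ> a) x) \<in> weight_ideal p"
proof -
  have "a \<circ> (\<lambda>x. t_op i x - scal_op (p i) x) \<in> weight_ideal p"
    by (rule left_idealD(5)[OF left_ideal_weight_ideal homog_weyl[OF assms] weight_ideal_t])
  moreover have "a \<circ> (\<lambda>x. t_op i x - scal_op (p i) x) =
      (\<lambda>x. (t_op i \<circ> a) x - (scal_op (p i + z i) \<circ> a) x)"
  proof
    fix x
    have a: "a \<in> carrier End_pol" using homog_weyl[OF assms] carrier_weyl_subset by blast
    have "a (t_op i x - scal_op (p i) x) = a (t_op i x) - scal_op (p i) (a x)"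
      by (simp add: End_pol_diff[OF a] End_polD(2)[OF a])
    then show "(a \<circ> (\<lambda>x. t_op i x - scal_op (p i) x)) x = (t_op i \<circ> a) x - (scal_op (p i + z i) \<circ> a) x"
      unfolding homog_t_comm[OF assms]
      by (simp add: scal_op_def single_add distrib_right)
  qed
  ultimately show ?thesis by simp
qed

text \<open>If a left ideal \<open>K\<close> over the weight ideal had an element with nonzero
  diagonal coefficient, separation of weights would put its degree zero component into
  \<open>K\<close>; modulo the weight ideal this is a nonzero scalar, so \<open>K\<close> would
  contain 1.\<close>

lemma largest_proper_weight_ideal:
  fixes p :: "'i \<Rightarrow> 'k::field_char_0"
  shows "largest_proper_left_ideal weyl (weight_ideal p) (max_weight_ideal p)"
  unfolding largest_proper_left_ideal_def
proof (intro conjI allI impI)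
  show "submodule (max_weight_ideal p) weyl (regular_module weyl)" by (rule left_ideal_max_weight_ideal)
  show "weight_ideal p \<subseteq> max_weight_ideal p" by (rule weight_ideal_subset_max)
  have "diag_coeff p (id \<circ> id) = 1" using diag_coeff_homog[OF homog_id] by simp
  then show "\<one>\<^bsub>weyl\<^esub> \<notin> max_weight_ideal p"
    using homog_weyl[OF homog_id] unfolding max_weight_ideal_def weyl_simps by force
next
  fix K :: "('i, 'k) pol_op set"
  assume "submodule K weyl (regular_module weyl) \<and> weight_ideal p \<subseteq> K \<and> \<one>\<^bsub>weyl\<^esub> \<notin> K"
  then have K: "submodule K weyl (regular_module weyl)" "weight_ideal p \<subseteq> K" "id \<notin> K" by auto
  note KD = left_idealD[OF K(1)]
  have "diag_coeff p c = 0" if c: "c \<in> K" for c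
  proof (rule ccontr)
    assume nz: "diag_coeff p c \<noteq> 0"
    obtain S F G where S: "finite S" "\<And>z. z \<in> S \<Longrightarrow> homog z (G z) (F z)" "c = (\<lambda>x. \<Sum>z\<in>S. F z x)"
      by (rule weyl_decomposition[OF subsetD[OF KD(1) c]]) (rule that)
    have F: "F z \<in> carrier weyl" if "z \<in> S" for z using homog_weyl[OF S(2)[OF that]] .
    have "diag_coeff p c = (\<Sum>z\<in>S. diag_coeff p (F z))"
      unfolding S(3) using diag_coeff_sum[OF S(1), of F] F by blast
    then obtain z where z: "z \<in> S" "diag_coeff p (F z) \<noteq> 0" using nz by (metis sum.neutral)
    have z0: "z = (\<lambda>_. 0)" and Gz: "G z p \<noteq> 0"
      using z diag_coeff_homog[OF S(2)[OF z(1)], of p] by (auto split: if_splits)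
    have "F z \<in> K"
    \<comment> \<open>The component of degree \<open>z\<close> has weight \<open>p + z\<close>
      modulo \<open>K\<close>, and these weights are distinct.\<close>
    proof (rule weight_separation[OF left_module_regular[OF ring_weyl] K(1) S(1), where wt = "\<lambda>z i. p i + z i"])
      show "inj_on (\<lambda>z i. p i + z i) S" by (auto simp: inj_on_def fun_eq_iff)
      show "(\<Oplus>\<^bsub>regular_module weyl\<^esub>z\<in>S. F z) \<in> K"
        using finsum_regular_weyl[OF S(1) F] c S(3) by simp
      show "t_op i \<odot>\<^bsub>regular_module weyl\<^esub> F z \<ominus>\<^bsub>regular_module weyl\<^esub>
          scal_op (p i + z i) \<odot>\<^bsub>regular_module weyl\<^esub> F z \<in> K" if "z \<in> S" for z i
        using homog_weight_ideal[OF S(2)[OF that]] K(2) F[OF that]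
        by (simp add: regular_weyl_minus weyl_comp t_op_in_weyl scal_op_in_weyl subset_iff)
    qed (use F z(1) in auto)
    moreover have "(\<lambda>x. F z x - scal_op (G z p) x) \<in> K"
      using homog_degree_0_cong[of "G z" "F z" p] S(2)[OF z(1)] z0 K(2) by auto
    ultimately have "(\<lambda>x. F z x - (F z x - scal_op (G z p) x)) \<in> K" by (rule KD(4))
    then have "scal_op (G z p) \<in> K" by simp
    then have "scal_op (inverse (G z p)) \<circ> scal_op (G z p) \<in> K" using KD(5) scal_op_in_weyl by blast
    moreover have "scal_op (inverse (G z p)) \<circ> scal_op (G z p) = (id :: ('i, 'k) pol_op)"
      using Gz by (simp add: comp_def scal_op_scal_op scal_op_1 id_def)
    ultimately show False using K(3) by simp
  qed
  \<comment> \<open>The form vanishes on \<open>K\<close>, hence on all left multiples of its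
    elements, as these lie in \<open>K\<close> again.\<close>
  then show "K \<subseteq> max_weight_ideal p"
    using KD(1,5) by (auto simp: max_weight_ideal_def)
qed

section \<open>Weight modules over the Weyl algebra\<close>

lemma finsum_weyl:
  assumes "finite S" "\<And>s. s \<in> S \<Longrightarrow> F s \<in> carrier weyl"
  shows "(\<Oplus>\<^bsub>weyl\<^esub>s\<in>S. F s) = (\<lambda>x. \<Sum>s\<in>S. F s x)"
proof -
  interpret ring weyl by (rule ring_weyl)
  show ?thesis
    using assms
  proof (induction S)
    case (insert s S)
    have "F \<in> S \<rightarrow> carrier weyl" "F s \<in> carrier weyl" using insert.prems by auto
    then show ?case using insert by simp
  qed simp
qed

section \<open>Weight spaces and weight decompositions\<close>

lemma weight_spaceD:
  assumes "x \<in> weight_space M p"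
  shows "x \<in> carrier M" "t_op i \<odot>\<^bsub>M\<^esub> x = scal_op (p i) \<odot>\<^bsub>M\<^esub> x"
  using assms by (auto simp: weight_space_def)

lemma zero_in_weight_space:
  assumes "left_module weyl M"
  shows "\<zero>\<^bsub>M\<^esub> \<in> weight_space M p"
proof -
  interpret left_module weyl M by fact
  show ?thesis by (simp add: weight_space_def t_op_in_weyl scal_op_in_weyl)
qed

lemma presents_weight_space:
  assumes "presents weyl M v I" "weight_ideal p \<subseteq> I"
  shows "v \<in> weight_space M p"
proof -
  have "t_op i \<ominus>\<^bsub>weyl\<^esub> scal_op (p i) \<in> I" for i
    using weight_ideal_t[of i p] assms(2) by (auto simp: weyl_minus(1)[OF t_op_in_weyl scal_op_in_weyl])
  then have "t_op i \<odot>\<^bsub>M\<^esub> v = scal_op (p i) \<odot>\<^bsub>M\<^esub> v" for i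
    using presents_diff[OF assms(1) t_op_in_weyl scal_op_in_weyl] by blast
  moreover have "v \<in> carrier M" using assms(1) by (simp add: presents_def)
  ultimately show ?thesis by (simp add: weight_space_def)
qed

lemma weight_space_homog:
  assumes "left_module weyl M" "x \<in> weight_space M p" "homog z f a"
  shows "a \<odot>\<^bsub>M\<^esub> x \<in> weight_space M (\<lambda>i. p i + z i)"
proof -
  interpret left_module weyl M by fact
  note x = weight_spaceD[OF assms(2)] and a = homog_weyl[OF assms(3)]
  have "t_op i \<odot>\<^bsub>M\<^esub> (a \<odot>\<^bsub>M\<^esub> x) = scal_op (p i + z i) \<odot>\<^bsub>M\<^esub> (a \<odot>\<^bsub>M\<^esub> x)" for i
  proof -
    have "t_op i \<odot>\<^bsub>M\<^esub> (a \<odot>\<^bsub>M\<^esub> x) = (t_op i \<otimes>\<^bsub>weyl\<^esub> a) \<odot>\<^bsub>M\<^esub> x"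
      by (rule smult_assoc1[OF t_op_in_weyl a x(1), symmetric])
    also have "t_op i \<otimes>\<^bsub>weyl\<^esub> a = (a \<otimes>\<^bsub>weyl\<^esub> t_op i) \<oplus>\<^bsub>weyl\<^esub> (scal_op (z i) \<otimes>\<^bsub>weyl\<^esub> a)"
      using homog_t_comm[OF assms(3)] by simp
    also have "\<dots> \<odot>\<^bsub>M\<^esub> x = a \<odot>\<^bsub>M\<^esub> (t_op i \<odot>\<^bsub>M\<^esub> x) \<oplus>\<^bsub>M\<^esub> scal_op (z i) \<odot>\<^bsub>M\<^esub> (a \<odot>\<^bsub>M\<^esub> x)"
      using a x(1) by (simp add: smult_l_distr smult_assoc1 t_op_in_weyl scal_op_in_weyl del: weyl_simps)
    also have "a \<odot>\<^bsub>M\<^esub> (t_op i \<odot>\<^bsub>M\<^esub> x) = (a \<otimes>\<^bsub>weyl\<^esub> scal_op (p i)) \<odot>\<^bsub>M\<^esub> x"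
      using a x by (simp add: smult_assoc1 scal_op_in_weyl del: weyl_simps)
    also have "a \<otimes>\<^bsub>weyl\<^esub> scal_op (p i) = scal_op (p i) \<otimes>\<^bsub>weyl\<^esub> a"
      using scal_op_comm[OF a] by simp
    also have "\<dots> \<odot>\<^bsub>M\<^esub> x = scal_op (p i) \<odot>\<^bsub>M\<^esub> (a \<odot>\<^bsub>M\<^esub> x)"
      using a x by (simp add: smult_assoc1 scal_op_in_weyl del: weyl_simps)
    also have "scal_op (p i) \<odot>\<^bsub>M\<^esub> (a \<odot>\<^bsub>M\<^esub> x) \<oplus>\<^bsub>M\<^esub> scal_op (z i) \<odot>\<^bsub>M\<^esub> (a \<odot>\<^bsub>M\<^esub> x) =
        (scal_op (p i) \<oplus>\<^bsub>weyl\<^esub> scal_op (z i)) \<odot>\<^bsub>M\<^esub> (a \<odot>\<^bsub>M\<^esub> x)"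
      using a x by (simp add: smult_l_distr scal_op_in_weyl del: weyl_simps)
    also have "scal_op (p i) \<oplus>\<^bsub>weyl\<^esub> scal_op (z i) = scal_op (p i + z i)"
      by (simp add: scal_op_def single_add distrib_right)
    finally show ?thesis .
  qed
  then show ?thesis using a x(1) by (simp add: weight_space_def)
qed

text \<open>The differences \<open>f q - g q\<close> have weight \<open>q\<close> and sum to zero;
  separation of weights with the zero submodule makes each of them zero.\<close>

lemma weight_family_unique:
  fixes M :: "(('i, 'k::field_char_0) pol_op, 'm) module"
  assumes M: "left_module weyl M"
    and f: "\<And>q. f q \<in> weight_space M q" "finite {q. f q \<noteq> \<zero>\<^bsub>M\<^esub>}"
    and g: "\<And>q. g q \<in> weight_space M q" "finite {q. g q \<noteq> \<zero>\<^bsub>M\<^esub>}"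
    and eq: "(\<Oplus>\<^bsub>M\<^esub>q\<in>{q. f q \<noteq> \<zero>\<^bsub>M\<^esub>}. f q) = (\<Oplus>\<^bsub>M\<^esub>q\<in>{q. g q \<noteq> \<zero>\<^bsub>M\<^esub>}. g q)"
  shows "f = g"
proof
  interpret left_module weyl M by fact
  \<comment> \<open>The two supports may differ, so both sums are extended by zeros to their
    union.\<close>
  define S where "S = {q. f q \<noteq> \<zero>\<^bsub>M\<^esub>} \<union> {q. g q \<noteq> \<zero>\<^bsub>M\<^esub>}"
  have S: "finite S" using f g by (simp add: S_def)
  have fM: "f q \<in> carrier M" and gM: "g q \<in> carrier M" for q
    by (rule weight_spaceD(1)[OF f(1)], rule weight_spaceD(1)[OF g(1)])
  have fS: "(\<Oplus>\<^bsub>M\<^esub>q\<in>{q. f q \<noteq> \<zero>\<^bsub>M\<^esub>}. f q) = (\<Oplus>\<^bsub>M\<^esub>q\<in>S. f q)"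
    by (rule M.add.finprod_mono_neutral_cong_left) (use S fM in \<open>auto simp: S_def\<close>)
  have gS: "(\<Oplus>\<^bsub>M\<^esub>q\<in>{q. g q \<noteq> \<zero>\<^bsub>M\<^esub>}. g q) = (\<Oplus>\<^bsub>M\<^esub>q\<in>S. g q)"
    by (rule M.add.finprod_mono_neutral_cong_left) (use S gM in \<open>auto simp: S_def\<close>)
  define h where "h = (\<lambda>q. f q \<ominus>\<^bsub>M\<^esub> g q)"
  have hM: "h q \<in> carrier M" for q unfolding h_def using fM gM by simp
  have hg: "h q \<oplus>\<^bsub>M\<^esub> g q = f q" for q
    unfolding h_def using fM[of q] gM[of q] by (simp add: a_minus_def M.a_assoc M.l_neg)
  have "(\<Oplus>\<^bsub>M\<^esub>q\<in>S. h q) \<oplus>\<^bsub>M\<^esub> (\<Oplus>\<^bsub>M\<^esub>q\<in>S. g q) = (\<Oplus>\<^bsub>M\<^esub>q\<in>S. h q \<oplus>\<^bsub>M\<^esub> g q)"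
    by (rule M.finsum_addf[symmetric]) (use hM gM in auto)
  also have "\<dots> = (\<Oplus>\<^bsub>M\<^esub>q\<in>S. g q)" using hg eq fS gS by simp
  finally have sum_h: "(\<Oplus>\<^bsub>M\<^esub>q\<in>S. h q) = \<zero>\<^bsub>M\<^esub>"
    using M.finsum_closed[of g S] M.finsum_closed[of h S] gM hM
    by (metis M.add.r_cancel_one Pi_I)
  fix q
  show "f q = g q"
  proof (cases "q \<in> S")
    case True
    have "h q \<in> {\<zero>\<^bsub>M\<^esub>}"
    proof (rule weight_separation[OF M zero_submodule S, where wt = "\<lambda>q. q"])
      show "(\<Oplus>\<^bsub>M\<^esub>q\<in>S. h q) \<in> {\<zero>\<^bsub>M\<^esub>}" using sum_h by simp
      show "t_op i \<odot>\<^bsub>M\<^esub> h s \<ominus>\<^bsub>M\<^esub> scal_op (s i) \<odot>\<^bsub>M\<^esub> h s \<in> {\<zero>\<^bsub>M\<^esub>}" for s i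
      proof -
        have "t_op i \<odot>\<^bsub>M\<^esub> h s = scal_op (s i) \<odot>\<^bsub>M\<^esub> h s"
          unfolding h_def a_minus_def
          using weight_spaceD(2)[OF f(1)[of s], of i] weight_spaceD(2)[OF g(1)[of s], of i] fM[of s] gM[of s]
          by (simp add: smult_r_distr smult_r_minus t_op_in_weyl scal_op_in_weyl)
        then show ?thesis using hM[of s] by (simp add: a_minus_def M.r_neg scal_op_in_weyl)
      qed
    qed (use hM True in auto)
    then show ?thesis using hg[of q] gM[of q] by simp
  next
    case False
    then show ?thesis by (simp add: S_def)
  qed
qed

text \<open>The component of weight \<open>q\<close> comes from the summand of degree
  \<open>q - p\<close>; the family is indexed by weights because \<open>weight_module\<close> asks
  for that form.\<close>

lemma weight_family_action:
  fixes M :: "(('i, 'k::field_char_0) pol_op, 'm) module"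
  assumes M: "left_module weyl M" and x: "x \<in> weight_space M p"
    and S: "finite S" "\<And>z. z \<in> S \<Longrightarrow> homog z (G z) (F z)"
  defines "f \<equiv> \<lambda>q. if (\<lambda>i. q i - p i) \<in> S then F (\<lambda>i. q i - p i) \<odot>\<^bsub>M\<^esub> x else \<zero>\<^bsub>M\<^esub>"
  shows "f q \<in> weight_space M q" "finite {q. f q \<noteq> \<zero>\<^bsub>M\<^esub>}"
    "(\<lambda>y. \<Sum>z\<in>S. F z y) \<odot>\<^bsub>M\<^esub> x = (\<Oplus>\<^bsub>M\<^esub>q\<in>{q. f q \<noteq> \<zero>\<^bsub>M\<^esub>}. f q)"
proof -
  interpret left_module weyl M by fact
  have xM: "x \<in> carrier M" using weight_spaceD(1)[OF x] .
  have F: "F z \<in> carrier weyl" if "z \<in> S" for z using homog_weyl[OF S(2)[OF that]] .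
  show fw: "f q \<in> weight_space M q" for q
    using weight_space_homog[OF M x S(2), of "\<lambda>i. q i - p i"] zero_in_weight_space[OF M]
    by (auto simp: f_def)
  have fM: "f q \<in> carrier M" for q by (rule weight_spaceD(1)[OF fw])
  \<comment> \<open>\<open>T\<close> may exceed the support, as some \<open>F z\<close> may kill
    \<open>x\<close>; summing over \<open>T\<close> lets the index be changed to degrees.\<close>
  define T where "T = (\<lambda>z i. p i + z i) ` S"
  have T: "finite T" using S(1) by (simp add: T_def)
  have sub: "{q. f q \<noteq> \<zero>\<^bsub>M\<^esub>} \<subseteq> T"
  proof
    fix q assume "q \<in> {q. f q \<noteq> \<zero>\<^bsub>M\<^esub>}"
    then have "(\<lambda>i. q i - p i) \<in> S" by (auto simp: f_def split: if_splits)
    then show "q \<in> T" unfolding T_def by (rule rev_image_eqI) simp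
  qed
  then show "finite {q. f q \<noteq> \<zero>\<^bsub>M\<^esub>}" using T finite_subset by blast
  have inj: "inj_on (\<lambda>z i. p i + z i) S" by (auto simp: inj_on_def fun_eq_iff)
  have "(\<Oplus>\<^bsub>M\<^esub>q\<in>{q. f q \<noteq> \<zero>\<^bsub>M\<^esub>}. f q) = (\<Oplus>\<^bsub>M\<^esub>q\<in>T. f q)"
    by (rule M.add.finprod_mono_neutral_cong_left) (use T sub fM in auto)
  also have "\<dots> = (\<Oplus>\<^bsub>M\<^esub>z\<in>S. f (\<lambda>i. p i + z i))"
    unfolding T_def by (rule M.finsum_reindex[OF _ inj]) (use fM in auto)
  also have "\<dots> = (\<Oplus>\<^bsub>M\<^esub>z\<in>S. F z \<odot>\<^bsub>M\<^esub> x)"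
    by (rule M.finsum_cong') (use F xM in \<open>auto simp: f_def\<close>)
  also have "\<dots> = (\<Oplus>\<^bsub>weyl\<^esub>z\<in>S. F z) \<odot>\<^bsub>M\<^esub> x"
    by (rule finsum_smult[symmetric]) (use S(1) xM F in auto)
  also have "(\<Oplus>\<^bsub>weyl\<^esub>z\<in>S. F z) = (\<lambda>y. \<Sum>z\<in>S. F z y)"
    by (rule finsum_weyl) (use S(1) F in auto)
  finally show "(\<lambda>y. \<Sum>z\<in>S. F z y) \<odot>\<^bsub>M\<^esub> x = (\<Oplus>\<^bsub>M\<^esub>q\<in>{q. f q \<noteq> \<zero>\<^bsub>M\<^esub>}. f q)" ..
qed

text \<open>The homogeneous parts of an operator, applied to the generator, give the decomposition;
  its uniqueness is \<open>weight_family_unique\<close>.\<close>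

lemma presents_weight_module:
  assumes "presents weyl M v (max_weight_ideal p)"
  shows "weight_module M"
  unfolding weight_module_def
proof (intro conjI ballI)
  show M: "left_module weyl M" using assms by (simp add: presents_def)
  have v: "v \<in> weight_space M p"
    by (rule presents_weight_space[OF assms weight_ideal_subset_max])
  fix x assume "x \<in> carrier M"
  then obtain a where a: "a \<in> carrier weyl" "x = a \<odot>\<^bsub>M\<^esub> v" using assms by (auto simp: presents_def)
  obtain S F G where S: "finite S" "\<And>z. z \<in> S \<Longrightarrow> homog z (G z) (F z)" "a = (\<lambda>x. \<Sum>z\<in>S. F z x)"
    by (rule weyl_decomposition[OF a(1)]) (rule that)
  note W = weight_family_action[where F = F and G = G, OF M v S(1,2)]
  show "\<exists>!f. (\<forall>p. f p \<in> weight_space M p) \<and> finite {p. f p \<noteq> \<zero>\<^bsub>M\<^esub>} \<and>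
      x = (\<Oplus>\<^bsub>M\<^esub>p\<in>{p. f p \<noteq> \<zero>\<^bsub>M\<^esub>}. f p)"
  proof (rule ex_ex1I)
    show "\<exists>f. (\<forall>p. f p \<in> weight_space M p) \<and> finite {p. f p \<noteq> \<zero>\<^bsub>M\<^esub>} \<and>
      x = (\<Oplus>\<^bsub>M\<^esub>p\<in>{p. f p \<noteq> \<zero>\<^bsub>M\<^esub>}. f p)"
      unfolding a(2) S(3) by (intro exI conjI allI) (rule W(1), assumption, rule W(2), assumption, rule W(3), assumption)
  qed (metis weight_family_unique[OF M])
qed

text \<open>By uniqueness of weight decompositions only the component of degree \<open>q - p\<close>
  of \<open>a\<close> contributes to \<open>w\<close>. This turns equations in the module into
  statements about symbols.\<close>

lemma homog_component_action:
  assumes M: "left_module weyl M" and x: "x \<in> weight_space M p"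
    and w: "w \<in> weight_space M q" "w \<noteq> \<zero>\<^bsub>M\<^esub>" and a: "a \<in> carrier weyl" "w = a \<odot>\<^bsub>M\<^esub> x"
  obtains z f b where "homog z f b" "q = (\<lambda>i. p i + z i)" "w = b \<odot>\<^bsub>M\<^esub> x"
proof -
  interpret left_module weyl M by fact
  obtain S F G where S: "finite S" "\<And>z. z \<in> S \<Longrightarrow> homog z (G z) (F z)" "a = (\<lambda>x. \<Sum>z\<in>S. F z x)"
    by (rule weyl_decomposition[OF a(1)]) (rule that)
  note W = weight_family_action[where F = F and G = G, OF M x S(1,2)]
  \<comment> \<open>The trivial decomposition of \<open>w\<close>, concentrated in weight
    \<open>q\<close>, to be compared with the one that \<open>a\<close> provides.\<close>
  define g where "g = (\<lambda>r. if r = q then w else \<zero>\<^bsub>M\<^esub>)"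
  have supp: "{r. g r \<noteq> \<zero>\<^bsub>M\<^esub>} = {q}" using w(2) by (auto simp: g_def)
  have "g r \<in> weight_space M r" for r
    using w(1) zero_in_weight_space[OF M] by (simp add: g_def)
  moreover have "finite {r. g r \<noteq> \<zero>\<^bsub>M\<^esub>}" unfolding supp by simp
  moreover have "(\<Oplus>\<^bsub>M\<^esub>r\<in>{r. g r \<noteq> \<zero>\<^bsub>M\<^esub>}. g r) = w"
    unfolding supp using weight_spaceD(1)[OF w(1)] by (simp add: g_def)
  ultimately have "(\<lambda>q. if (\<lambda>i. q i - p i) \<in> S then F (\<lambda>i. q i - p i) \<odot>\<^bsub>M\<^esub> x else \<zero>\<^bsub>M\<^esub>) = g"
    using a(2) S(3) W by (intro weight_family_unique[OF M]) simp_all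
  from fun_cong[OF this, of q] have "(\<lambda>i. q i - p i) \<in> S" "w = F (\<lambda>i. q i - p i) \<odot>\<^bsub>M\<^esub> x"
    using w(2) by (auto simp: g_def split: if_splits)
  then show thesis using that[OF S(2)[of "\<lambda>i. q i - p i"]] by simp
qed

section \<open>Presentations of simple weight modules by weight vectors\<close>

text \<open>The annihilator of \<open>v\<close> is a left ideal that contains the generators
  \<open>t_op i - p i\<close>, hence \<open>weight_ideal p\<close>; simplicity does the
  rest.\<close>

lemma simple_weight_vector_presents:
  assumes "simple_module weyl M" "v \<in> weight_space M p" "v \<noteq> \<zero>\<^bsub>M\<^esub>"
  shows "presents weyl M v (max_weight_ideal p)"
proof (rule simple_module_presents[OF assms(1) _ assms(3) _ largest_proper_weight_ideal])
  have M: "left_module weyl M" using assms(1) by (simp add: simple_module_def)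
  interpret left_module weyl M by fact
  note v = weight_spaceD[OF assms(2)]
  show "v \<in> carrier M" by (fact v(1))
  let ?N = "{a \<in> carrier weyl. a \<odot>\<^bsub>M\<^esub> v \<in> {\<zero>\<^bsub>M\<^esub>}}"
  have "(\<lambda>x. t_op i x - scal_op (p i) x) \<in> ?N" for i
  proof -
    have "(t_op i \<ominus>\<^bsub>weyl\<^esub> scal_op (p i)) \<odot>\<^bsub>M\<^esub> v = \<zero>\<^bsub>M\<^esub>"
      using v by (simp add: smult_l_diff t_op_in_weyl scal_op_in_weyl) (simp add: a_minus_def M.r_neg scal_op_in_weyl)
    then show ?thesis
      by (simp add: weyl_minus(1)[OF t_op_in_weyl scal_op_in_weyl] weyl_minus_closed t_op_in_weyl scal_op_in_weyl)
  qed
  then have "weight_ideal p \<subseteq> ?N"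
    by (rule weight_ideal_subsetI[OF left_ideal_preimage[OF M v(1) zero_submodule]])
  then show "a \<in> carrier weyl \<and> a \<odot>\<^bsub>M\<^esub> v = \<zero>\<^bsub>M\<^esub>" if "a \<in> weight_ideal p" for a
    using that by blast
qed

text \<open>A nonzero vector has some nonzero weight component.\<close>

lemma simple_weight_module_presents:
  assumes "simple_weight_module M"
  obtains p v where "presents weyl M v (max_weight_ideal p)"
proof -
  have simple: "simple_module weyl M" and weight: "weight_module M"
    using assms by (auto simp: simple_weight_module_def)
  interpret left_module weyl M using simple by (simp add: simple_module_def)
  obtain x where x: "x \<in> carrier M" "x \<noteq> \<zero>\<^bsub>M\<^esub>"
    using simple M.zero_closed unfolding simple_module_def by blast
  obtain f where f: "\<And>p. f p \<in> weight_space M p" "x = (\<Oplus>\<^bsub>M\<^esub>p\<in>{p. f p \<noteq> \<zero>\<^bsub>M\<^esub>}. f p)"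
    using weight x(1) unfolding weight_module_def by blast
  have "\<exists>p. f p \<noteq> \<zero>\<^bsub>M\<^esub>"
  proof (rule ccontr)
    assume "\<nexists>p. f p \<noteq> \<zero>\<^bsub>M\<^esub>"
    then have "{p. f p \<noteq> \<zero>\<^bsub>M\<^esub>} = {}" by blast
    then show False using f(2) x(2) by simp
  qed
  then show thesis using that simple_weight_vector_presents[OF simple f(1)] by blast
qed

text \<open>The regular module is divided first by the weight ideal and then by the unique maximal
  submodule, which \<open>presents_top\<close> identifies.\<close>

lemma presents_L_module:
  obtains v where "presents weyl (L_module p) v (max_weight_ideal p)"
proof -
  let ?J = "weight_ideal p"
  have "presents weyl (P_module p) (?J +>\<^bsub>regular_module weyl\<^esub> \<one>\<^bsub>weyl\<^esub>)
      {a \<in> carrier weyl. a \<odot>\<^bsub>regular_module weyl\<^esub> \<one>\<^bsub>weyl\<^esub> \<in> ?J}"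
    unfolding P_module_def weight_ideal_def[symmetric]
    by (rule presents_quotient[OF presents_regular[OF ring_weyl] left_ideal_weight_ideal])
  moreover have "{a \<in> carrier weyl. a \<odot>\<^bsub>regular_module weyl\<^esub> \<one>\<^bsub>weyl\<^esub> \<in> ?J} = ?J"
    using left_idealD(1)[OF left_ideal_weight_ideal[of p]] by auto
  ultimately have P: "presents weyl (P_module p) (?J +>\<^bsub>regular_module weyl\<^esub> \<one>\<^bsub>weyl\<^esub>) ?J" by simp
  note top = presents_top[OF P largest_proper_weight_ideal]
  from presents_quotient[OF P top(1)] show thesis
    unfolding top(2) L_module_def[symmetric] by (rule that)
qed

lemma homog_degree_0_action:
  assumes "presents weyl M v (max_weight_ideal p)" "homog (\<lambda>_. 0) f a"
  shows "a \<odot>\<^bsub>M\<^esub> v = scal_op (f p) \<odot>\<^bsub>M\<^esub> v"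
  using homog_degree_0_cong[OF assms(2), of p] weight_ideal_subset_max[of p]
    presents_diff[OF assms(1) homog_weyl[OF assms(2)] scal_op_in_weyl]
    weyl_minus(1)[OF homog_weyl[OF assms(2)] scal_op_in_weyl]
  by auto

lemma presents_max_nonzero:
  assumes "presents weyl M v (max_weight_ideal p)"
  shows "v \<noteq> \<zero>\<^bsub>M\<^esub>"
proof
  interpret left_module weyl M using assms by (simp add: presents_def)
  assume "v = \<zero>\<^bsub>M\<^esub>"
  then have "\<one>\<^bsub>weyl\<^esub> \<in> max_weight_ideal p" using assms R.one_closed by (simp add: presents_def del: weyl_simps)
  then show False using largest_proper_weight_ideal[of p] by (simp add: largest_proper_left_ideal_def)
qed

lemma scal_op_0: "scal_op 0 = \<zero>\<^bsub>weyl\<^esub>"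
  by (simp add: scal_op_def)

section \<open>The weights that occur in a simple weight module\<close>

text \<open>Homogeneous operators lead from \<open>v\<close> to \<open>w\<close> and back. Their
  composite fixes the nonzero vector \<open>v\<close>, so both symbols are nonzero where they act,
  which keeps every coordinate on its side of the natural numbers.\<close>

lemma presents_weight_bar:
  assumes p: "presents weyl M v (max_weight_ideal p)" and q: "presents weyl M w (max_weight_ideal q)"
  shows "q \<in> weight_bar p"
proof -
  have M: "left_module weyl M" using p by (simp add: presents_def)
  interpret left_module weyl M by fact
  have v: "v \<in> weight_space M p" and w: "w \<in> weight_space M q"
    by (rule presents_weight_space[OF _ weight_ideal_subset_max], fact)+
  note vM = weight_spaceD(1)[OF v] and wM = weight_spaceD(1)[OF w]
  obtain a where a: "a \<in> carrier weyl" "w = a \<odot>\<^bsub>M\<^esub> v" using p wM by (auto simp: presents_def)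
  obtain z f b where b: "homog z f b" "q = (\<lambda>i. p i + z i)" "w = b \<odot>\<^bsub>M\<^esub> v"
    by (rule homog_component_action[OF M v w presents_max_nonzero[OF q] a]) (rule that)
  obtain a' where a': "a' \<in> carrier weyl" "v = a' \<odot>\<^bsub>M\<^esub> w" using q vM by (auto simp: presents_def)
  obtain y g c where c: "homog y g c" "p = (\<lambda>i. q i + y i)" "v = c \<odot>\<^bsub>M\<^esub> w"
    by (rule homog_component_action[OF M w v presents_max_nonzero[OF p] a']) (rule that)
  have y: "z i + y i = 0" for i using fun_cong[OF c(2), of i] by (simp add: b(2))
  have h: "homog (\<lambda>_. 0) (\<lambda>v. g (\<lambda>i. v i + z i) * f v) (c \<circ> b)"
    using homog_comp[OF b(1) c(1)] by (simp add: y)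
  have "v = (c \<otimes>\<^bsub>weyl\<^esub> b) \<odot>\<^bsub>M\<^esub> v"
    unfolding smult_assoc1[OF homog_weyl[OF c(1)] homog_weyl[OF b(1)] vM] using b(3) c(3) by simp
  then have "v = scal_op (g q * f p) \<odot>\<^bsub>M\<^esub> v"
    using homog_degree_0_action[OF p h] by (simp add: b(2))
  moreover have "scal_op 0 \<odot>\<^bsub>M\<^esub> v = \<zero>\<^bsub>M\<^esub>" unfolding scal_op_0 by (rule smult_l_null[OF vM])
  ultimately have nz: "g q \<noteq> 0" "f p \<noteq> 0" using presents_max_nonzero[OF p] by auto
  \<comment> \<open>If a coordinate left the natural numbers, \<open>homog_exit\<close> would kill
    \<open>f p\<close> on the way there or \<open>g q\<close> on the way back.\<close>
  have pq: "p i \<in> \<nat> \<longleftrightarrow> q i \<in> \<nat>" for i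
    using homog_exit[OF b(1), of p i] homog_exit[OF c(1), of q i] nz
    by (metis b(2) c(2))
  \<comment> \<open>An integer that is not natural is negative, so this case follows from the
    previous one.\<close>
  have "q i \<in> neg_integers" if neg: "p i \<in> neg_integers" for i
  proof -
    have "p i \<in> \<int>" using neg by (auto simp: neg_integers_def)
    moreover have "z i \<in> \<int>" using homog_Z_fin[OF b(1)] by (simp add: Z_fin_def)
    ultimately have "q i \<in> \<int>" by (simp add: b(2))
    then show ?thesis using Ints_neg_or_Nats pq neg_integers_not_Nats neg by blast
  qed
  then show ?thesis
    using pq homog_Z_fin[OF b(1)] b(2) unfolding weight_bar_def by blast
qed

text \<open>Since \<open>b \<circ> a\<close> acts on \<open>v\<close> as the nonzero scalar
  \<open>h p\<close>, the vector \<open>a v\<close> is nonzero; in a simple module a nonzero weight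
  vector is a generator with the required annihilator.\<close>

lemma presents_move:
  assumes p: "presents weyl M v (max_weight_ideal p)" and a: "homog z f a"
    and b: "b \<in> carrier weyl" "homog (\<lambda>_. 0) h (b \<circ> a)" "h p \<noteq> 0"
  shows "presents weyl M (a \<odot>\<^bsub>M\<^esub> v) (max_weight_ideal (\<lambda>i. p i + z i))"
proof (rule simple_weight_vector_presents)
  have M: "left_module weyl M" using p by (simp add: presents_def)
  interpret left_module weyl M by fact
  have v: "v \<in> weight_space M p"
    by (rule presents_weight_space[OF p weight_ideal_subset_max])
  note vM = weight_spaceD(1)[OF v]
  show "simple_module weyl M" by (rule presents_simple[OF p largest_proper_weight_ideal])
  show "a \<odot>\<^bsub>M\<^esub> v \<in> weight_space M (\<lambda>i. p i + z i)" by (rule weight_space_homog[OF M v a])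
  show "a \<odot>\<^bsub>M\<^esub> v \<noteq> \<zero>\<^bsub>M\<^esub>"
  proof
    assume "a \<odot>\<^bsub>M\<^esub> v = \<zero>\<^bsub>M\<^esub>"
    then have "(b \<otimes>\<^bsub>weyl\<^esub> a) \<odot>\<^bsub>M\<^esub> v = \<zero>\<^bsub>M\<^esub>"
      unfolding smult_assoc1[OF b(1) homog_weyl[OF a] vM] using b(1) by simp
    then have "scal_op (h p) \<odot>\<^bsub>M\<^esub> v = \<zero>\<^bsub>M\<^esub>" using homog_degree_0_action[OF p b(2)] by simp
    then have "scal_op (inverse (h p)) \<odot>\<^bsub>M\<^esub> (scal_op (h p) \<odot>\<^bsub>M\<^esub> v) = \<zero>\<^bsub>M\<^esub>"
      by (simp add: scal_op_in_weyl)
    moreover have "scal_op (inverse (h p)) \<otimes>\<^bsub>weyl\<^esub> scal_op (h p) = \<one>\<^bsub>weyl\<^esub>"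
      using b(3) by (auto simp: scal_op_scal_op scal_op_1)
    ultimately have "v = \<zero>\<^bsub>M\<^esub>"
      using smult_assoc1[OF scal_op_in_weyl scal_op_in_weyl vM, of "inverse (h p)" "h p"] smult_one[OF vM] by metis
    then show False using presents_max_nonzero[OF p] by simp
  qed
qed

text \<open>Each step applies \<open>X_op i\<close>, which \<open>Y_op i\<close> undoes up to the
  factor \<open>p i + n + 1\<close>. This is zero only at -1, and the hypothesis forbids the passage
  from -1 to 0.\<close>

lemma presents_up:
  assumes "presents weyl M v (max_weight_ideal p)" "p i \<in> neg_integers \<Longrightarrow> p i + of_nat n \<notin> \<nat>"
  shows "\<exists>w. presents weyl M w (max_weight_ideal (p(i := p i + of_nat n)))"
  using assms(2)
proof (induction n)
  case 0
  then show ?case using assms(1) by auto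
next
  case (Suc n)
  let ?q = "p(i := p i + of_nat n)"
  \<comment> \<open>The hypothesis for \<open>Suc n\<close> implies the one for \<open>n\<close>, as
    \<open>\<nat>\<close> is closed under adding 1.\<close>
  have "p i + of_nat n \<notin> \<nat>" if "p i \<in> neg_integers"
  proof
    assume "p i + of_nat n \<in> \<nat>"
    from Nats_add[OF this Nats_1] have "p i + of_nat n + 1 \<in> \<nat>" .
    then show False using Suc.prems[OF that] by (simp add: ac_simps)
  qed
  then obtain w where w: "presents weyl M w (max_weight_ideal ?q)" using Suc.IH by blast
  \<comment> \<open>A zero factor would make \<open>p i\<close> negative with \<open>Suc n\<close>
    steps leading to 0, which is natural.\<close>
  have "?q i + 1 \<noteq> 0"
  proof
    assume "?q i + 1 = 0"
    then have eq: "p i + of_nat (Suc n) = 0" by (simp add: ac_simps)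
    then have "p i = - of_nat (Suc n)" by (simp only: eq_neg_iff_add_eq_0)
    then have "p i \<in> neg_integers" unfolding neg_integers_def by (intro CollectI exI[of _ "Suc n"]) auto
    then show False using Suc.prems eq by auto
  qed
  from presents_move[where h = "\<lambda>v. v i + 1", OF w homog_X Y_op_in_weyl homog_YX this]
  have "\<exists>w. presents weyl M w (max_weight_ideal (\<lambda>j. ?q j + (if j = i then 1 else 0)))" ..
  moreover have "(\<lambda>j. ?q j + (if j = i then 1 else 0)) = p(i := p i + of_nat (Suc n))"
    by (auto simp: fun_eq_iff)
  ultimately show ?case by (simp only:)
qed

text \<open>The mirror image: \<open>Y_op i\<close> lowers, \<open>X_op i\<close> undoes it up to
  the factor \<open>p i - n\<close>, and the only obstruction is the passage from 0 to -1.\<close>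

lemma presents_down:
  assumes "presents weyl M v (max_weight_ideal p)" "p i \<in> \<nat> \<Longrightarrow> p i - of_nat n \<notin> neg_integers"
  shows "\<exists>w. presents weyl M w (max_weight_ideal (p(i := p i - of_nat n)))"
  using assms(2)
proof (induction n)
  case 0
  then show ?case using assms(1) by auto
next
  case (Suc n)
  let ?q = "p(i := p i - of_nat n)"
  have "p i - of_nat n \<notin> neg_integers" if "p i \<in> \<nat>"
  proof
    assume "p i - of_nat n \<in> neg_integers"
    then obtain m where "p i - of_nat n = - of_nat m" by (auto simp: neg_integers_def)
    then have "p i - of_nat (Suc n) = - of_nat (Suc m)" by (simp add: algebra_simps)
    then have "p i - of_nat (Suc n) \<in> neg_integers"
      unfolding neg_integers_def by (intro CollectI exI[of _ "Suc m"]) auto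
    then show False using Suc.prems[OF that] by simp
  qed
  then obtain w where w: "presents weyl M w (max_weight_ideal ?q)" using Suc.IH by blast
  \<comment> \<open>A zero factor means \<open>p i = n\<close>, and the next step would end at
    -1.\<close>
  have "?q i \<noteq> 0"
  proof
    assume "?q i = 0"
    then have eq: "p i = of_nat n" by simp
    then have "p i - of_nat (Suc n) = - of_nat 1" by simp
    then have "p i - of_nat (Suc n) \<in> neg_integers"
      unfolding neg_integers_def by (intro CollectI exI[of _ 1]) auto
    then show False using Suc.prems eq by simp
  qed
  from presents_move[where h = "\<lambda>v. v i", OF w homog_Y X_op_in_weyl homog_t[of i, unfolded t_op_def] this]
  have "\<exists>w. presents weyl M w (max_weight_ideal (\<lambda>j. ?q j + (if j = i then - 1 else 0)))" ..
  moreover have "(\<lambda>j. ?q j + (if j = i then - 1 else 0)) = p(i := p i - of_nat (Suc n))"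
    by (auto simp: fun_eq_iff)
  ultimately show ?case by (simp only:)
qed

text \<open>The sign of the integer \<open>c - p i\<close> decides between raising and lowering; the
  sign conditions exclude a crossing between -1 and 0 either way.\<close>

lemma presents_change_coordinate:
  assumes "presents weyl M v (max_weight_ideal p)" "c - p i \<in> \<int>"
    and "p i \<in> neg_integers \<Longrightarrow> c \<in> neg_integers" "p i \<in> \<nat> \<Longrightarrow> c \<in> \<nat>"
  shows "\<exists>w. presents weyl M w (max_weight_ideal (p(i := c)))"
proof -
  obtain d where d: "c - p i = of_int d" using assms(2) by (auto elim: Ints_cases)
  show ?thesis
  proof (cases "d \<ge> 0")
    case True
    then have c: "c = p i + of_nat (nat d)" using d by (simp add: algebra_simps)
    show ?thesis
      unfolding c by (rule presents_up[OF assms(1)]) (use assms(3) neg_integers_not_Nats c in blast)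
  next
    case False
    then have c: "c = p i - of_nat (nat (- d))" using d by (simp add: algebra_simps)
    show ?thesis
      unfolding c by (rule presents_down[OF assms(1)]) (use assms(4) neg_integers_not_Nats c in blast)
  qed
qed

text \<open>The difference \<open>q - p\<close> has finite support, so the coordinates can be
  changed one at a time.\<close>

lemma presents_of_weight_bar:
  assumes "presents weyl M v (max_weight_ideal p)" "q \<in> weight_bar p"
  shows "\<exists>w. presents weyl M w (max_weight_ideal q)"
proof -
  obtain z where z: "z \<in> Z_fin" "q = (\<lambda>i. p i + z i)"
    and sign: "\<And>i. p i \<in> neg_integers \<Longrightarrow> q i \<in> neg_integers" "\<And>i. p i \<in> \<nat> \<Longrightarrow> q i \<in> \<nat>"
    using assms(2) by (auto simp: weight_bar_def)
  have "\<exists>w. presents weyl M w (max_weight_ideal (\<lambda>i. if i \<in> T then q i else p i))" if "finite T" for T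
    using that
  proof (induction T)
    case empty
    then show ?case using assms(1) by auto
  next
    case (insert j T)
    let ?r = "\<lambda>i. if i \<in> T then q i else p i"
    obtain w where w: "presents weyl M w (max_weight_ideal ?r)" using insert.IH by blast
    have "q j - p j \<in> \<int>" using z by (simp add: Z_fin_def)
    then have "\<exists>w. presents weyl M w (max_weight_ideal (?r(j := q j)))"
      using insert.hyps(2) sign by (intro presents_change_coordinate[OF w]) auto
    moreover have "?r(j := q j) = (\<lambda>i. if i \<in> insert j T then q i else p i)" by auto
    ultimately show ?case by simp
  qed
  from this[of "{i. z i \<noteq> 0}"] obtain w where
    w: "presents weyl M w (max_weight_ideal (\<lambda>i. if i \<in> {i. z i \<noteq> 0} then q i else p i))"
    using z(1) by (auto simp: Z_fin_def)
  moreover have "(\<lambda>i. if i \<in> {i. z i \<noteq> 0} then q i else p i) = q" using z(2) by auto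
  ultimately show ?thesis by auto
qed

section \<open>The classification\<close>

lemma left_module_L_module:
  fixes p :: "'i \<Rightarrow> 'k::field_char_0"
  shows "left_module weyl (L_module p)"
  by (rule presents_L_module[of p]) (simp add: presents_def)

text \<open>If the modules are isomorphic, both weights occur in \<open>L_module q\<close>, so
  \<open>q\<close> lies in \<open>weight_bar p\<close>, the class of \<open>p\<close>. If the
  classes agree, weight \<open>q\<close> occurs in \<open>L_module p\<close>, and both modules are
  the quotient by \<open>max_weight_ideal q\<close>.\<close>

lemma L_module_isomorphic_iff:
  fixes p q :: "'i \<Rightarrow> 'k::field_char_0"
  shows "module_isomorphic weyl (L_module p) (L_module q) \<longleftrightarrow> weight_bar p = weight_bar q"
proof
  assume iso: "module_isomorphic weyl (L_module p) (L_module q)"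
  obtain v where v: "presents weyl (L_module p) v (max_weight_ideal p)" by (rule presents_L_module)
  obtain w where w: "presents weyl (L_module q) w (max_weight_ideal q)" by (rule presents_L_module)
  obtain v' where "presents weyl (L_module q) v' (max_weight_ideal p)"
    by (rule presents_transport[OF v iso left_module_L_module])
  from presents_weight_bar[OF this w] have "(p, q) \<in> weight_sim"
    using weight_sim_class[of p] by blast
  then show "weight_bar p = weight_bar q" by (simp add: weight_sim_def)
next
  assume "weight_bar p = weight_bar q"
  then have q: "q \<in> weight_bar p" using weight_sim_class[of p] by (auto simp: weight_sim_def)
  obtain v where v: "presents weyl (L_module p) v (max_weight_ideal p)" by (rule presents_L_module)
  obtain w where w: "presents weyl (L_module p) w (max_weight_ideal q)"
    using presents_of_weight_bar[OF v q] by blast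
  obtain w' where w': "presents weyl (L_module q) w' (max_weight_ideal q)" by (rule presents_L_module)
  show "module_isomorphic weyl (L_module p) (L_module q)" by (rule presents_isomorphic[OF w w'])
qed

lemma simple_weight_module_L_module:
  fixes p :: "'i \<Rightarrow> 'k::field_char_0"
  shows "simple_weight_module (L_module p)"
  by (rule presents_L_module[of p])
    (simp add: simple_weight_module_def presents_weight_module presents_simple[OF _ largest_proper_weight_ideal])

text \<open>A weight vector of weight \<open>p\<close> gives \<open>M\<close> the same presentation
  as \<open>L_module p\<close>.\<close>

lemma simple_weight_module_isomorphic_L_module:
  fixes M :: "(('i, 'k::field_char_0) pol_op, 'm) module"
  assumes "simple_weight_module M"
  shows "\<exists>p. module_isomorphic weyl (L_module p) M"
proof -
  obtain p v where v: "presents weyl M v (max_weight_ideal p)"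
    by (rule simple_weight_module_presents[OF assms]) (rule that)
  obtain w where w: "presents weyl (L_module p) w (max_weight_ideal p)" by (rule presents_L_module)
  show ?thesis using presents_isomorphic[OF w v] by blast
qed

text \<open>\<open>iso_class\<close> collects modules on one element type only; the last conjunct
  extends surjectivity to simple weight modules on an arbitrary type.\<close>

theorem theorem5:
  assumes "infinite (UNIV :: 'i set)"
    and "(UNIV :: 'i set) \<prec> (UNIV :: 'k::{alg_closed_field, field_char_0} set)"
  shows "(\<exists>\<Phi>. (\<forall>p :: 'i \<Rightarrow> 'k. \<Phi> (weight_sim `` {p}) = iso_class weyl (L_module p)) \<and>
            bij_betw \<Phi> (UNIV // weight_sim)
              {iso_class weyl M |M. simple_weight_module M}) \<and>
         (\<forall>M :: (('i, 'k) pol_op, 'm) module.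
            simple_weight_module M \<longrightarrow> (\<exists>p. module_isomorphic weyl (L_module p) M))"
proof (intro conjI allI impI simple_weight_module_isomorphic_L_module)
  \<comment> \<open>A representative of the class is chosen; by \<open>class_eq\<close> the value
    does not depend on it.\<close>
  define \<Phi> :: "('i \<Rightarrow> 'k) set \<Rightarrow> _" where
    "\<Phi> = (\<lambda>C. iso_class weyl (L_module (SOME p. weight_sim `` {p} = C)))"
  have class_eq: "weight_sim `` {p} = weight_sim `` {q} \<longleftrightarrow> iso_class weyl (L_module p) = iso_class weyl (L_module q)"
    for p q :: "'i \<Rightarrow> 'k"
    unfolding weight_sim_class iso_class_eq[OF left_module_L_module left_module_L_module] L_module_isomorphic_iff ..
  have \<Phi>: "\<Phi> (weight_sim `` {p}) = iso_class weyl (L_module p)" for p :: "'i \<Rightarrow> 'k"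
    unfolding \<Phi>_def by (rule class_eq[THEN iffD1]) (rule someI[of _ p], rule refl)
  have "bij_betw \<Phi> (UNIV // weight_sim) {iso_class weyl M |M. simple_weight_module M}"
    unfolding bij_betw_def
  proof (rule conjI[OF inj_onI], goal_cases)
    case (1 C D)
    then obtain p q where "C = weight_sim `` {p}" "D = weight_sim `` {q}"
      by (auto elim!: quotientE)
    then show ?case using 1(3) class_eq by (simp only: \<Phi>)
  next
    case 2
    show ?case
    proof (intro equalityI subsetI)
      fix K assume "K \<in> \<Phi> ` (UNIV // weight_sim)"
      then obtain p where "K = iso_class weyl (L_module p)" by (auto elim!: quotientE simp: \<Phi>)
      then show "K \<in> {iso_class weyl M |M. simple_weight_module M}"
        using simple_weight_module_L_module[of p] by blast
    next
      fix K :: "(('i, 'k) pol_op, ('i, 'k) pol_op set set) module set"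
      assume "K \<in> {iso_class weyl M |M. simple_weight_module M}"
      then obtain M where M: "simple_weight_module M" "K = iso_class weyl M" by blast
      obtain p where "module_isomorphic weyl (L_module p) M"
        using simple_weight_module_isomorphic_L_module[OF M(1)] by blast
      moreover have "left_module weyl M"
        using M(1) by (simp add: simple_weight_module_def simple_module_def)
      ultimately have "iso_class weyl (L_module p) = K"
        unfolding M(2) using iso_class_eq[OF left_module_L_module] by blast
      then have "\<Phi> (weight_sim `` {p}) = K" using \<Phi> by simp
      then show "K \<in> \<Phi> ` (UNIV // weight_sim)" by (metis UNIV_I imageI quotientI)
    qed
  qed
  with \<Phi> show "\<exists>\<Phi>. (\<forall>p :: 'i \<Rightarrow> 'k. \<Phi> (weight_sim `` {p}) = iso_class weyl (L_module p)) \<and>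
            bij_betw \<Phi> (UNIV // weight_sim)
              {iso_class weyl M |M. simple_weight_module M}"
    by blast
qed

end
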